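(* Let $(\mathfrak{g},\mathfrak{h})$ be an (infinite-dimensional) locally finite split simple complex Lie algebra with root system $\Delta$ and Weyl group $W\leq \mathrm{GL}(\mathfrak{h}^* )$. Let $\lambda\in\mathfrak{h}^*$ be discrete and bounded. Then for a character (group homomorphism) $\chi\colon \mathbb{Z}[\Delta]\to\mathbb{R}$, the following are equivalent: (1) $\inf \chi(W.\lambda-\lambda)>-\infty$. (2) There exist characters $\chi_{\min},\chi_{\mathrm{sum}}\colon\mathbb{Z}[\Delta]\to\mathbb{R}$ with $\chi=\chi_{\min}+\chi_{\mathrm{sum}}$ such that $\inf\chi_{\min}(W.\lambda-\lambda)=0$ and $\chi_{\mathrm{sum}}$ is summable.
   Context: A complex Lie algebra $\mathfrak{g}$ is split if it has a root decomposition $\mathfrak{g}=\mathfrak{h}+\sum_{\alpha\in\Delta}\mathfrak{g}_\alpha$ with respect to a maximal abelian subalgebra $\mathfrak{h}$; it is locally finite if every finite subset generates a finite-dimensional subalgebra. For $\alpha\in\Delta$, the coroot $\alpha^\vee$ is the unique element of $[\mathfrak{g}_\alpha,\mathfrak{g}_{-\alpha}]$ with $\alpha(\alpha^\vee)=2$. The Weyl group $W\leq\mathrm{GL}(\mathfrak{h}^* )$ is generated by the reflections $\mu\mapsto\mu-\mu(\alpha^\vee)\alpha$, $\alpha\in\Delta$. $\mathbb{Z}[\Delta]$ denotes the $\mathbb{Z}$-span of $\Delta$. By the known classification, there is an infinite set $J$ such that $\Delta$ is of one of the following types, where $(e_j)_{j\in J}$ is a basis of $\mathfrak{h}$ (types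 $B_J,C_J,D_J$), respectively of a one-dimensional extension $\tilde{\mathfrak{h}}\supset\mathfrak{h}$ (type $A_J$, where $\mathfrak{h}=\{\sum_j x_je_j : \sum_j x_j=0\}$), and $\epsilon_j$ are the linear functionals with $\epsilon_j(e_k)=\delta_{jk}$: $A_J=\{\epsilon_j-\epsilon_k : j\neq k\}$; $B_J=\{\pm\epsilon_j,\pm(\epsilon_j\pm\epsilon_k): j\neq k\}$; $C_J=\{\pm2\epsilon_j,\pm(\epsilon_j\pm\epsilon_k): j\neq k\}$; $D_J=\{\pm(\epsilon_j\pm\epsilon_k): j\neq k\}$ (with $j,k\in J$; in type $A_J$ roots are restricted to $\mathfrak{h}$). The coroots lie in $\mathrm{span}_{\mathbb{Z}}(e_j)_{j\in J}$. The corresponding Weyl groups act on the $\epsilon_j$ by: $W(A_J)$ = finitely supported permutations of $J$; $W(B_J)=W(C_J)$ = finitely supported permutations together with finitely many sign changes; $W(D_J)$ = finitely supported permutations together with an even finite number of sign changes. For $\lambda\in\mathfrak{h}^*$ put $\lambda_j:=\lambda(e_j)$ (in type $A_J$, after choosing a linear extension of $\lambda$ to $\tilde{\mathfrak{h}}$; different extensions change all $\lambda_j$ by a common constant). $\lambda$ is called discrete if (for a suitable extension in type $A_J$) all $\lambda_j$ are real and $\{\lambda_j : j\in J\}$ is a discrete subset of $\mathbb{R}$, where discrete subset means a subset without accumulation point in $\mathbb{R}$. $\lambda$ is called bounded if $\sup_{j\in J}|\lambda_j|<\infty$. For discrete $\lambda$, the set $W.\lambda-\lambda=\{w.\lambda-\lambda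 : w\in W\}$ is contained in $\mathrm{span}_{\mathbb{R}}(\Delta)$, and characters $\mathbb{Z}[\Delta]\to\mathbb{R}$ are evaluated on it via their unique $\mathbb{R}$-linear extension to $\mathrm{span}_{\mathbb{R}}(\Delta)$. A character $\chi\colon\mathbb{Z}[\Delta]\to\mathbb{R}$ is summable if it is the restriction of a homomorphism $\tilde\chi\colon\mathrm{span}_{\mathbb{Z}}(\epsilon_j)_{j\in J}\to\mathbb{R}$ with $\sum_{j\in J}|\tilde\chi(\epsilon_j)|<\infty$. *)

theory Defs
  imports "HOL-Analysis.Analysis" "HOL-Library.Function_Algebras" "HOL-Library.Extended_Real"
begin

section \<open>Complex Lie algebras with a distinguished abelian subalgebra\<close>

locale complex_lie_algebra = vector_space scale
  for scale :: "complex \<Rightarrow> 'g::ab_group_add \<Rightarrow> 'g" (infixr "*C" 75) +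
  fixes bracket :: "'g \<Rightarrow> 'g \<Rightarrow> 'g" ("\<lbrakk>_,/ _\<rbrakk>")
  assumes bracket_add_left: "\<lbrakk>x + y, z\<rbrakk> = \<lbrakk>x, z\<rbrakk> + \<lbrakk>y, z\<rbrakk>"
    and bracket_add_right: "\<lbrakk>x, y + z\<rbrakk> = \<lbrakk>x, y\<rbrakk> + \<lbrakk>x, z\<rbrakk>"
    and bracket_scale_left: "\<lbrakk>c *C x, y\<rbrakk> = c *C \<lbrakk>x, y\<rbrakk>"
    and bracket_scale_right: "\<lbrakk>x, c *C y\<rbrakk> = c *C \<lbrakk>x, y\<rbrakk>"
    and bracket_self: "\<lbrakk>x, x\<rbrakk> = 0"
    and jacobi: "\<lbrakk>x, \<lbrakk>y, z\<rbrakk>\<rbrakk> + \<lbrakk>y, \<lbrakk>z, x\<rbrakk>\<rbrakk> + \<lbrakk>z, \<lbrakk>x, y\<rbrakk>\<rbrakk> = 0"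
begin

definition subalgebra :: "'g set \<Rightarrow> bool" where
  "subalgebra S \<longleftrightarrow> subspace S \<and> (\<forall>x\<in>S. \<forall>y\<in>S. \<lbrakk>x, y\<rbrakk> \<in> S)"

definition abelian_subalgebra :: "'g set \<Rightarrow> bool" where
  "abelian_subalgebra S \<longleftrightarrow> subalgebra S \<and> (\<forall>x\<in>S. \<forall>y\<in>S. \<lbrakk>x, y\<rbrakk> = 0)"

definition maximal_abelian_subalgebra :: "'g set \<Rightarrow> bool" where
  "maximal_abelian_subalgebra S \<longleftrightarrow>
     abelian_subalgebra S \<and> (\<forall>K. abelian_subalgebra K \<and> S \<subseteq> K \<longrightarrow> K = S)"

definition lie_ideal :: "'g set \<Rightarrow> bool" where
  "lie_ideal I \<longleftrightarrow> subspace I \<and> (\<forall>x. \<forall>y\<in>I. \<lbrakk>x, y\<rbrakk> \<in> I)"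

definition simple_lie :: bool where
  "simple_lie \<longleftrightarrow> (\<exists>x y. \<lbrakk>x, y\<rbrakk> \<noteq> 0) \<and> (\<forall>I. lie_ideal I \<longrightarrow> I = {0} \<or> I = UNIV)"

definition locally_finite_lie :: bool where
  "locally_finite_lie \<longleftrightarrow>
     (\<forall>F. finite F \<longrightarrow> (\<exists>B. finite B \<and> span B = subalgebra hull F))"

end

text \<open>Elements of the dual space \<open>H\<^sup>*\<close> are represented by functions on the whole Lie algebra that are
  linear on \<open>H\<close> and vanish outside \<open>H\<close>, so that equality in \<open>H\<^sup>*\<close> is equality of functions and
  the vector space operations are pointwise.\<close>

locale lie_pair = complex_lie_algebra +
  fixes H :: "'a set"
begin

definition dual :: "('a \<Rightarrow> complex) set" where
  "dual = {\<mu>. (\<forall>x\<in>H. \<forall>y\<in>H. \<mu> (x + y) = \<mu> x + \<mu> y) \<and>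
              (\<forall>c. \<forall>x\<in>H. \<mu> (c *C x) = c * \<mu> x) \<and> (\<forall>x. x \<notin> H \<longrightarrow> \<mu> x = 0)}"

definition root_space :: "('a \<Rightarrow> complex) \<Rightarrow> 'a set" where
  "root_space \<alpha> = {x. \<forall>h\<in>H. \<lbrakk>h, x\<rbrakk> = \<alpha> h *C x}"

definition roots :: "('a \<Rightarrow> complex) set" where
  "roots = {\<alpha> \<in> dual. \<alpha> \<noteq> 0 \<and> root_space \<alpha> \<noteq> {0}}"

text \<open>Once \<open>H\<close> is maximal abelian, \<open>H\<close> is the simultaneous eigenspace for the weight 0, so the
  sum below is automatically direct.\<close>

definition splitting :: bool where
  "splitting \<longleftrightarrow> maximal_abelian_subalgebra H \<and> span (H \<union> (\<Union>\<alpha>\<in>roots. root_space \<alpha>)) = UNIV"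

definition coroot :: "('a \<Rightarrow> complex) \<Rightarrow> 'a" where
  "coroot \<alpha> = (THE h. h \<in> span {\<lbrakk>x, y\<rbrakk> |x y. x \<in> root_space \<alpha> \<and> y \<in> root_space (- \<alpha>)} \<and> \<alpha> h = 2)"

definition reflection :: "('a \<Rightarrow> complex) \<Rightarrow> ('a \<Rightarrow> complex) \<Rightarrow> 'a \<Rightarrow> complex" where
  "reflection \<alpha> \<mu> = \<mu> - (\<lambda>h. \<mu> (coroot \<alpha>) * \<alpha> h)"

text \<open>Reflections are involutions, so the monoid they generate is a group.\<close>

inductive_set weyl_group :: "(('a \<Rightarrow> complex) \<Rightarrow> 'a \<Rightarrow> complex) set" where
  weyl_id: "id \<in> weyl_group"
| weyl_step: "w \<in> weyl_group \<Longrightarrow> \<alpha> \<in> roots \<Longrightarrow> reflection \<alpha> \<circ> w \<in> weyl_group"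

definition orbit_differences :: "('a \<Rightarrow> complex) \<Rightarrow> ('a \<Rightarrow> complex) set" where
  "orbit_differences \<mu> = {w \<mu> - \<mu> |w. w \<in> weyl_group}"

end

locale locally_finite_split_simple = lie_pair +
  assumes simple: simple_lie
    and locally_finite: locally_finite_lie
    and splitting: splitting


section \<open>Characters of the root lattice\<close>

interpretation int_fun: module "\<lambda>(n::int) (\<mu>::'a \<Rightarrow> complex) x. of_int n * \<mu> x"
  by unfold_locales (simp_all add: fun_eq_iff algebra_simps)

interpretation real_fun: vector_space "\<lambda>(r::real) (\<mu>::'a \<Rightarrow> complex) x. of_real r * \<mu> x"
  by unfold_locales (simp_all add: fun_eq_iff algebra_simps)

definition int_span :: "('a \<Rightarrow> complex) set \<Rightarrow> ('a \<Rightarrow> complex) set" where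
  "int_span S = int_fun.span S"

definition real_span :: "('a \<Rightarrow> complex) set \<Rightarrow> ('a \<Rightarrow> complex) set" where
  "real_span S = real_fun.span S"

text \<open>Only the values on \<open>int_span S\<close> are relevant for a homomorphism \<open>int_span S \<rightarrow> \<real>\<close>.\<close>

definition character_on :: "('a \<Rightarrow> complex) set \<Rightarrow> (('a \<Rightarrow> complex) \<Rightarrow> real) \<Rightarrow> bool" where
  "character_on S chi \<longleftrightarrow>
     (\<forall>\<mu>\<in>int_span S. \<forall>\<nu>\<in>int_span S. chi (\<mu> + \<nu>) = chi \<mu> + chi \<nu>)"

text \<open>The extension is unique on \<open>real_span S\<close>; it exists whenever \<open>int_span S\<close> has a basis that
  is linearly independent over the reals, as for the root systems below.\<close>

definition real_extension ::
    "('a \<Rightarrow> complex) set \<Rightarrow> (('a \<Rightarrow> complex) \<Rightarrow> real) \<Rightarrow> ('a \<Rightarrow> complex) \<Rightarrow> real" where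
  "real_extension S chi = (SOME \<psi>.
     (\<forall>\<mu>\<in>int_span S. \<psi> \<mu> = chi \<mu>) \<and>
     (\<forall>\<mu>\<in>real_span S. \<forall>\<nu>\<in>real_span S. \<psi> (\<mu> + \<nu>) = \<psi> \<mu> + \<psi> \<nu>) \<and>
     (\<forall>r. \<forall>\<mu>\<in>real_span S. \<psi> (\<lambda>x. of_real r * \<mu> x) = r * \<psi> \<mu>))"


section \<open>Coordinates for the classical root systems\<close>

datatype root_type = Type_A | Type_B | Type_C | Type_D

definition signed_pairs :: "'j set \<Rightarrow> ('j \<Rightarrow> 'b::ab_group_add) \<Rightarrow> 'b set" where
  "signed_pairs J \<epsilon> =
     (\<Union>j\<in>J. \<Union>k\<in>J - {j}. {\<epsilon> j + \<epsilon> k, \<epsilon> j - \<epsilon> k, - (\<epsilon> j + \<epsilon> k), - (\<epsilon> j - \<epsilon> k)})"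

fun standard_roots :: "root_type \<Rightarrow> 'j set \<Rightarrow> ('j \<Rightarrow> 'b::ab_group_add) \<Rightarrow> 'b set" where
  "standard_roots Type_A J \<epsilon> = {\<epsilon> j - \<epsilon> k |j k. j \<in> J \<and> k \<in> J \<and> j \<noteq> k}"
| "standard_roots Type_B J \<epsilon> = (\<Union>j\<in>J. {\<epsilon> j, - \<epsilon> j}) \<union> signed_pairs J \<epsilon>"
| "standard_roots Type_C J \<epsilon> =
     (\<Union>j\<in>J. {\<epsilon> j + \<epsilon> j, - (\<epsilon> j + \<epsilon> j)}) \<union> signed_pairs J \<epsilon>"
| "standard_roots Type_D J \<epsilon> = signed_pairs J \<epsilon>"

text \<open>
  The type \<open>'v\<close> is the extension of \<open>H\<close> that has \<open>(e j)\<^sub>j\<close> as a basis, and \<open>\<iota>\<close> is the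
  inclusion of \<open>H\<close>.  In types B, C, D the inclusion is onto, that is, the extension is \<open>H\<close> itself;
  in type A its image is the hyperplane of vectors with coordinate sum 0.
  The functionals \<open>\<epsilon>\<^sub>j\<close> are restricted to \<open>H\<close>.  As \<open>J\<close> is infinite, restriction to \<open>H\<close> is
  injective on the integer span of the \<open>\<epsilon>\<^sub>j\<close> in type A as well, so nothing is lost by this.
\<close>

definition coordinate_functional ::
    "'g set \<Rightarrow> (complex \<Rightarrow> 'v::ab_group_add \<Rightarrow> 'v) \<Rightarrow> ('g \<Rightarrow> 'v) \<Rightarrow> 'j set \<Rightarrow> ('j \<Rightarrow> 'v) \<Rightarrow>
     'j \<Rightarrow> 'g \<Rightarrow> complex" where
  "coordinate_functional H scaleV \<iota> J e j h =
     (if h \<in> H then module.representation scaleV (e ` J) (\<iota> h) (e j) else 0)"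

locale classical_coordinates = locally_finite_split_simple scale bracket H +
    ext: vector_space scaleV
  for scale :: "complex \<Rightarrow> 'g::ab_group_add \<Rightarrow> 'g"
    and bracket :: "'g \<Rightarrow> 'g \<Rightarrow> 'g"
    and H :: "'g set"
    and scaleV :: "complex \<Rightarrow> 'v::ab_group_add \<Rightarrow> 'v" +
  fixes \<iota> :: "'g \<Rightarrow> 'v" and T :: root_type and J :: "'j set" and e :: "'j \<Rightarrow> 'v"
  assumes infinite_J: "infinite J"
    and inj_e: "inj_on e J"
    and independent_e: "ext.independent (e ` J)"
    and span_e: "ext.span (e ` J) = UNIV"
    and incl_add: "x \<in> H \<Longrightarrow> y \<in> H \<Longrightarrow> \<iota> (x + y) = \<iota> x + \<iota> y"
    and incl_scale: "x \<in> H \<Longrightarrow> \<iota> (scale c x) = scaleV c (\<iota> x)"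
    and inj_incl: "inj_on \<iota> H"
    and range_incl: "\<iota> ` H =
      (if T = Type_A
       then {\<Sum>j\<in>F. scaleV (x j) (e j) |F x. finite F \<and> F \<subseteq> J \<and> (\<Sum>j\<in>F. x j) = 0}
       else UNIV)"
    and roots_eq: "roots = standard_roots T J (coordinate_functional H scaleV \<iota> J e)"

text \<open>In types B, C, D the extension of \<open>\<mu>\<close> to \<open>'v\<close> is unique.\<close>

definition extends_functional ::
    "'g set \<Rightarrow> (complex \<Rightarrow> 'v::ab_group_add \<Rightarrow> 'v) \<Rightarrow> ('g \<Rightarrow> 'v) \<Rightarrow>
     ('g \<Rightarrow> complex) \<Rightarrow> ('v \<Rightarrow> complex) \<Rightarrow> bool" where
  "extends_functional H scaleV \<iota> \<mu> \<mu>' \<longleftrightarrow>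
     Vector_Spaces.linear scaleV (*) \<mu>' \<and> (\<forall>h\<in>H. \<mu>' (\<iota> h) = \<mu> h)"

definition discrete_functional ::
    "'g set \<Rightarrow> (complex \<Rightarrow> 'v::ab_group_add \<Rightarrow> 'v) \<Rightarrow> ('g \<Rightarrow> 'v) \<Rightarrow> 'j set \<Rightarrow> ('j \<Rightarrow> 'v) \<Rightarrow>
     ('g \<Rightarrow> complex) \<Rightarrow> bool" where
  "discrete_functional H scaleV \<iota> J e \<mu> \<longleftrightarrow>
     (\<exists>\<mu>'. extends_functional H scaleV \<iota> \<mu> \<mu>' \<and> (\<forall>j\<in>J. \<mu>' (e j) \<in> \<real>) \<and>
        \<not> (\<exists>a::real. a islimpt (\<lambda>j. Re (\<mu>' (e j))) ` J))"

definition bounded_functional ::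
    "'g set \<Rightarrow> (complex \<Rightarrow> 'v::ab_group_add \<Rightarrow> 'v) \<Rightarrow> ('g \<Rightarrow> 'v) \<Rightarrow> 'j set \<Rightarrow> ('j \<Rightarrow> 'v) \<Rightarrow>
     ('g \<Rightarrow> complex) \<Rightarrow> bool" where
  "bounded_functional H scaleV \<iota> J e \<mu> \<longleftrightarrow>
     (\<exists>\<mu>'. extends_functional H scaleV \<iota> \<mu> \<mu>' \<and> bounded ((\<lambda>j. \<mu>' (e j)) ` J))"

definition summable_character ::
    "('a \<Rightarrow> complex) set \<Rightarrow> 'j set \<Rightarrow> ('j \<Rightarrow> 'a \<Rightarrow> complex) \<Rightarrow> (('a \<Rightarrow> complex) \<Rightarrow> real) \<Rightarrow> bool"
  where
  "summable_character R J \<epsilon> chi \<longleftrightarrow>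
     (\<exists>chi'. character_on (\<epsilon> ` J) chi' \<and> (\<forall>\<mu>\<in>int_span R. chi \<mu> = chi' \<mu>) \<and>
        (\<lambda>j. \<bar>chi' (\<epsilon> j)\<bar>) summable_on J)"

end

theory Submission
  imports Defs
begin

text \<open>
  Existence and uniqueness of coroots have to be derived from simplicity: the root spaces of the
  roots \<open>\<alpha>\<close> with \<open>\<alpha> [g\<^sub>\<alpha>, g\<^sub>-\<^sub>\<alpha>] = 0\<close> span an ideal that misses \<open>H\<close>, so there are none, and
  a coroot is determined by the fact that its reflection permutes the roots.  This identifies the
  Weyl orbit of \<open>lam\<close> with the orbit of the coordinate family \<open>l\<close> under (signed) transpositions.

  Write \<open>d\<close> for the coordinates of a character.  Being discrete and bounded, \<open>l\<close> has finitely many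
  values.  If the character is bounded below on the orbit, then swapping many disjoint pairs at once
  shows that for each value \<open>s\<close> there is a threshold \<open>c s\<close> such that, up to a summable error,
  \<open>d \<ge> c s\<close> where \<open>l \<le> s\<close> and \<open>d \<le> c s\<close> where \<open>l > s\<close>.  Clamping \<open>d\<close> to these thresholds (made
  antitone in \<open>s\<close>) gives the minimal part: its values are supergradients of a concave function \<open>g\<close>
  at the points \<open>l j\<close>, hence the change of the character along the orbit is at least the change of
  \<open>\<Sum>\<^sub>j g (l j)\<close>, which is zero because the orbit only permutes the \<open>l j\<close> (and \<open>g\<close> is even when signs
  may change).  In the signed types the same argument is applied to \<open>\<bar>l j\<bar>\<close>.
\<close>

section \<open>Integrability of the roots and uniqueness of coroots\<close>

text \<open>The hypotheses describe the roots in coordinates but say nothing about brackets, whereas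
  \<open>coroot\<close> is a \<open>THE\<close> over a span of brackets; its value is known only
  once this span is a line on which the root does not vanish. The set of roots is infinite, so the
  classical appeals to finiteness are replaced by boundedness: a fixed element of \<open>H\<close>
  has finitely many nonzero coordinates, hence all roots take bounded values there, and no root can
  be moved forever along one direction. In the coordinate part the obstacle is the sign changes.
  Passing from \<open>l\<close> to its absolute value needs nonpositive slopes; this comes from a
  separate estimate for sign changes and enters the threshold argument as one more, artificial value
  with threshold 0. A second difficulty is that in type A the coordinates of the weight and of the
  character are determined only up to additive constants, which have to be matched before
  summability of a difference makes sense.\<close>

context complex_lie_algebra
begin

lemma bracket_zero_left [simp]: "\<lbrakk>0, x\<rbrakk> = 0"
  using bracket_scale_left[of 0 0 x] by simp

lemma bracket_zero_right [simp]: "\<lbrakk>x, 0\<rbrakk> = 0"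
  using bracket_scale_right[of x 0 0] by simp

lemma bracket_anticomm: "\<lbrakk>x, y\<rbrakk> = - \<lbrakk>y, x\<rbrakk>"
proof -
  have "\<lbrakk>x + y, x + y\<rbrakk> = \<lbrakk>x, y\<rbrakk> + \<lbrakk>y, x\<rbrakk>"
    by (simp only: bracket_add_left bracket_add_right) (simp add: bracket_self)
  then show ?thesis by (simp add: bracket_self eq_neg_iff_add_eq_0)
qed

lemma bracket_derivation: "\<lbrakk>x, \<lbrakk>y, z\<rbrakk>\<rbrakk> = \<lbrakk>\<lbrakk>x, y\<rbrakk>, z\<rbrakk> + \<lbrakk>y, \<lbrakk>x, z\<rbrakk>\<rbrakk>"
proof -
  have "\<lbrakk>z, \<lbrakk>x, y\<rbrakk>\<rbrakk> = - \<lbrakk>\<lbrakk>x, y\<rbrakk>, z\<rbrakk>" by (rule bracket_anticomm)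
  moreover have "\<lbrakk>y, \<lbrakk>z, x\<rbrakk>\<rbrakk> = - \<lbrakk>y, \<lbrakk>x, z\<rbrakk>\<rbrakk>"
    using bracket_anticomm[of z x] bracket_scale_right[of y "-1" "\<lbrakk>x, z\<rbrakk>"] by simp
  ultimately have "\<lbrakk>x, \<lbrakk>y, z\<rbrakk>\<rbrakk> + - \<lbrakk>y, \<lbrakk>x, z\<rbrakk>\<rbrakk> + - \<lbrakk>\<lbrakk>x, y\<rbrakk>, z\<rbrakk> = 0"
    using jacobi[of x y z] by simp
  then show ?thesis by (simp only: add_eq_0_iff2 minus_minus) (simp only: diff_eq_eq diff_conv_add_uminus[symmetric])
qed

lemma bracket_minus_right: "\<lbrakk>x, - y\<rbrakk> = - \<lbrakk>x, y\<rbrakk>"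
  using bracket_scale_right[of x "-1" y] by simp

lemma bracket_minus_left: "\<lbrakk>- x, y\<rbrakk> = - \<lbrakk>x, y\<rbrakk>"
  using bracket_scale_left[of "-1" x y] by simp

lemma bracket_sum_right: "\<lbrakk>x, sum f A\<rbrakk> = (\<Sum>a\<in>A. \<lbrakk>x, f a\<rbrakk>)"
  by (induction A rule: infinite_finite_induct) (simp_all add: bracket_add_right)

end

section \<open>Root spaces as simultaneous eigenspaces of \<open>H\<close>\<close>

context lie_pair
begin

lemma subspace_root_space: "subspace (root_space \<alpha>)"
  unfolding subspace_def root_space_def
  by (auto simp: bracket_add_right bracket_scale_right scale_right_distrib mult.commute)

lemma root_space_bracket:
  assumes "x \<in> root_space \<alpha>" "y \<in> root_space \<beta>"
  shows "\<lbrakk>x, y\<rbrakk> \<in> root_space (\<alpha> + \<beta>)"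
  using assms unfolding root_space_def
  by (auto simp: bracket_derivation[of _ x y] bracket_scale_left bracket_scale_right scale_left_distrib)

lemma rootsD: "\<alpha> \<in> roots \<Longrightarrow> \<alpha> \<in> dual" "\<alpha> \<in> roots \<Longrightarrow> \<alpha> \<noteq> 0"
  unfolding roots_def by auto

lemma root_vector_obtain:
  assumes "\<alpha> \<in> roots" obtains x where "x \<in> root_space \<alpha>" "x \<noteq> 0"
  using assms subspace_0[OF subspace_root_space] unfolding roots_def by auto

lemma weight_is_root:
  "\<mu> \<in> dual \<Longrightarrow> x \<in> root_space \<mu> \<Longrightarrow> x \<noteq> 0 \<Longrightarrow> \<mu> \<in> insert 0 roots"
  unfolding roots_def by auto

lemma dual_add: "\<mu> \<in> dual \<Longrightarrow> \<nu> \<in> dual \<Longrightarrow> \<mu> + \<nu> \<in> dual"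
  unfolding dual_def by (auto simp: algebra_simps)

lemma dual_scale: "\<mu> \<in> dual \<Longrightarrow> (\<lambda>h. c * \<mu> h) \<in> dual"
  unfolding dual_def by (auto simp: algebra_simps)

lemma dual_shift: "\<mu> \<in> dual \<Longrightarrow> \<alpha> \<in> dual \<Longrightarrow> (\<lambda>h. \<mu> h + c * \<alpha> h) \<in> dual"
  unfolding dual_def by (auto simp: algebra_simps)

lemma dual_apply_minus: "\<mu> \<in> dual \<Longrightarrow> h \<in> H \<Longrightarrow> \<mu> (- h) = - \<mu> h"
proof -
  assume "\<mu> \<in> dual" "h \<in> H"
  then have "\<mu> ((-1) *C h) = (-1) * \<mu> h" unfolding dual_def by blast
  then show ?thesis by simp
qed

lemma dual_eqI: "\<mu> \<in> dual \<Longrightarrow> \<nu> \<in> dual \<Longrightarrow> (\<And>h. h \<in> H \<Longrightarrow> \<mu> h = \<nu> h) \<Longrightarrow> \<mu> = \<nu>"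
  unfolding dual_def by (rule ext) (metis (mono_tags, lifting) mem_Collect_eq)

lemma root_vectors_independent:
  assumes "finite A" "A \<subseteq> dual" "\<forall>\<alpha>\<in>A. u \<alpha> \<in> root_space \<alpha>" "(\<Sum>\<alpha>\<in>A. u \<alpha>) = 0"
  shows "\<forall>\<alpha>\<in>A. u \<alpha> = 0"
  using assms
proof (induction A arbitrary: u rule: finite_induct)
  case empty then show ?case by simp
next
  case (insert \<beta> A)
  have u0: "u \<alpha> = 0" if "\<alpha> \<in> A" for \<alpha>
  proof -
    have "\<alpha> \<noteq> \<beta>" using that insert.hyps by auto
    moreover have "\<alpha> \<in> dual" "\<beta> \<in> dual" using that insert.prems(1) by auto
    ultimately obtain h where h: "h \<in> H" "\<alpha> h \<noteq> \<beta> h"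
      using dual_eqI[of \<alpha> \<beta>] by metis
    have act: "\<lbrakk>h, u \<gamma>\<rbrakk> = \<gamma> h *C u \<gamma>" if "\<gamma> \<in> insert \<beta> A" for \<gamma>
      using insert.prems(2) that h(1) unfolding root_space_def by blast
    \<comment> \<open>Acting with \<open>h\<close> multiplies each summand by its weight;
      subtracting \<open>\<beta> h\<close> times the relation removes the \<open>\<beta>\<close>
      summand, so the induction hypothesis applies to the rest.\<close>
    have "(\<Sum>\<gamma>\<in>insert \<beta> A. \<gamma> h *C u \<gamma>) = \<lbrakk>h, \<Sum>\<gamma>\<in>insert \<beta> A. u \<gamma>\<rbrakk>"
      unfolding bracket_sum_right using act by (intro sum.cong) auto
    also have "\<dots> = \<beta> h *C (\<Sum>\<gamma>\<in>insert \<beta> A. u \<gamma>)" by (simp add: insert.prems(3))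
    finally have "(\<Sum>\<gamma>\<in>insert \<beta> A. \<gamma> h *C u \<gamma> - \<beta> h *C u \<gamma>) = 0"
      by (simp add: sum_subtractf scale_sum_right)
    then have "(\<Sum>\<gamma>\<in>A. (\<gamma> h - \<beta> h) *C u \<gamma>) = 0"
      using insert.hyps by (simp add: scale_left_diff_distrib)
    then have "\<forall>\<gamma>\<in>A. (\<gamma> h - \<beta> h) *C u \<gamma> = 0"
      using insert.prems subspace_root_space
      by (intro insert.IH) (auto intro: subspace_scale)
    then show ?thesis using h that by auto
  qed
  then show ?case using insert.hyps insert.prems(3) by (auto simp: sum.neutral)
qed

end

text \<open>The study of coroots takes only three properties from the coordinates: symmetry,
  boundedness at each point of \<open>H\<close> as a substitute for finiteness, and reducedness in
  the form that proportional roots differ at most by a sign.\<close>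

locale bounded_reduced_roots = lie_pair +
  assumes simple: simple_lie
    and splitting: splitting
    and roots_uminus: "\<alpha> \<in> roots \<Longrightarrow> - \<alpha> \<in> roots"
    and roots_bounded: "h \<in> H \<Longrightarrow> \<exists>B. \<forall>\<alpha>\<in>roots. cmod (\<alpha> h) \<le> B"
    and roots_reduced: "\<alpha> \<in> roots \<Longrightarrow> (\<lambda>h. c * \<alpha> h) \<in> roots \<Longrightarrow> c = 1 \<or> c = - 1"
begin

lemma H_subspace: "subspace H" and H_abelian: "x \<in> H \<Longrightarrow> y \<in> H \<Longrightarrow> \<lbrakk>x, y\<rbrakk> = 0"
  using splitting unfolding splitting_def maximal_abelian_subalgebra_def abelian_subalgebra_def subalgebra_def
  by auto

text \<open>Maximality of \<open>H\<close>: an \<open>x\<close> commuting with \<open>H\<close>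
  spans together with \<open>H\<close> an abelian subalgebra, which must be \<open>H\<close> itself.
  This places brackets of opposite root vectors in \<open>H\<close>.\<close>

lemma root_space_zero: "root_space 0 = H"
proof
  show "H \<subseteq> root_space 0" using H_abelian by (auto simp: root_space_def)
  show "root_space 0 \<subseteq> H"
  proof
    fix x assume "x \<in> root_space 0"
    then have comm: "\<lbrakk>h, x\<rbrakk> = 0" if "h \<in> H" for h using that by (auto simp: root_space_def)
    define K where "K = {h + c *C x |h c. h \<in> H}"
    have comm': "\<lbrakk>x, h\<rbrakk> = 0" if "h \<in> H" for h using comm[OF that] bracket_anticomm[of x h] by simp
    have br: "\<lbrakk>u, v\<rbrakk> = 0" if "u \<in> K" "v \<in> K" for u v
      using that unfolding K_def
      by (auto simp: bracket_add_left bracket_add_right bracket_scale_left bracket_scale_right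
            comm comm' H_abelian bracket_self)
    have sub: "subspace K"
      unfolding subspace_def
    proof (intro conjI ballI allI)
      show "0 \<in> K" unfolding K_def using subspace_0[OF H_subspace]
        by (auto intro!: exI[of _ 0])
    next
      fix u v assume "u \<in> K" "v \<in> K"
      then obtain h c h' c' where "u = h + c *C x" "v = h' + c' *C x" "h \<in> H" "h' \<in> H"
        unfolding K_def by auto
      then have "u + v = (h + h') + (c + c') *C x" "h + h' \<in> H"
        using H_subspace by (auto simp: scale_left_distrib subspace_add)
      then show "u + v \<in> K" unfolding K_def by blast
    next
      fix u c assume "u \<in> K"
      then obtain h d where "u = h + d *C x" "h \<in> H" unfolding K_def by auto
      then have "c *C u = c *C h + (c * d) *C x" "c *C h \<in> H"
        using H_subspace by (auto simp: scale_right_distrib subspace_scale)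
      then show "c *C u \<in> K" unfolding K_def by blast
    qed
    have "abelian_subalgebra K"
      unfolding abelian_subalgebra_def subalgebra_def using sub br subspace_0[OF sub] by auto
    moreover have "H \<subseteq> K"
    proof
      fix h assume "h \<in> H"
      moreover have "h = h + 0 *C x" by simp
      ultimately show "h \<in> K" unfolding K_def by blast
    qed
    ultimately have "K = H" using splitting unfolding splitting_def maximal_abelian_subalgebra_def by blast
    moreover have "x = 0 + 1 *C x" by simp
    then have "x \<in> K" unfolding K_def using subspace_0[OF H_subspace] by blast
    ultimately show "x \<in> H" by simp
  qed
qed

lemma bracket_opposite: "x \<in> root_space \<alpha> \<Longrightarrow> y \<in> root_space (- \<alpha>) \<Longrightarrow> \<lbrakk>x, y\<rbrakk> \<in> H"
  using root_space_bracket[of x \<alpha> y "- \<alpha>"] by (simp add: root_space_zero)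

text \<open>Evaluated at \<open>h\<close>, the string grows like
  \<open>n * cmod (\<delta> h)\<close>, whereas roots are bounded at \<open>h\<close>. This one
  argument makes powers of ad-operators vanish and later shows that unipotent maps permuting the
  roots are trivial.\<close>

lemma no_infinite_string:
  assumes "\<delta> \<in> dual" "\<And>n::nat. (\<lambda>u. \<beta> u + of_nat n * \<delta> u) \<in> insert 0 roots"
  shows "\<delta> = 0"
proof (rule dual_eqI)
  show "0 \<in> dual" by (simp add: dual_def)
  show "\<delta> \<in> dual" by fact
  fix h assume h: "h \<in> H"
  obtain B where B: "\<And>\<alpha>. \<alpha> \<in> roots \<Longrightarrow> cmod (\<alpha> h) \<le> B" using roots_bounded[OF h] by blast
  have "cmod (\<beta> h + of_nat n * \<delta> h) \<le> max B 0" for n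
    using assms(2)[of n] B by (fastforce simp: fun_eq_iff)
  have "of_nat n * cmod (\<delta> h) \<le> max B 0 + cmod (\<beta> h)" for n
  proof -
    have "of_nat n * cmod (\<delta> h) = cmod ((\<beta> h + of_nat n * \<delta> h) - \<beta> h)" by (simp add: norm_mult)
    also have "\<dots> \<le> cmod (\<beta> h + of_nat n * \<delta> h) + cmod (\<beta> h)" by (rule norm_triangle_ineq4)
    also have "\<dots> \<le> max B 0 + cmod (\<beta> h)" using \<open>cmod (\<beta> h + of_nat n * \<delta> h) \<le> max B 0\<close> by simp
    finally show ?thesis .
  qed
  then have "\<not> 0 < cmod (\<delta> h)"
    using reals_Archimedean3[of "cmod (\<delta> h)"] by (meson not_less)
  then show "\<delta> h = 0 h" by simp
qed

section \<open>Root strings and the sl2 computation\<close>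

lemma ad_power_root_space:
  assumes "x \<in> root_space \<alpha>" "z \<in> root_space \<beta>"
  shows "(bracket x ^^ n) z \<in> root_space (\<lambda>u. \<beta> u + of_nat n * \<alpha> u)"
proof (induction n)
  case 0 then show ?case using assms by simp
next
  case (Suc n)
  have "(\<lambda>u. \<beta> u + of_nat (Suc n) * \<alpha> u) = \<alpha> + (\<lambda>u. \<beta> u + of_nat n * \<alpha> u)"
    by (auto simp: fun_eq_iff algebra_simps)
  then show ?case using root_space_bracket[OF assms(1) Suc] by simp
qed

lemma ad_power_last:
  assumes "\<alpha> \<in> roots" "x \<in> root_space \<alpha>" "\<beta> \<in> dual" "z \<in> root_space \<beta>" "z \<noteq> 0"
  obtains n where "(bracket x ^^ n) z \<noteq> 0" "(bracket x ^^ Suc n) z = 0"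
proof -
  have "\<exists>n. (bracket x ^^ n) z = 0"
  proof (rule ccontr)
    assume neg: "\<nexists>n. (bracket x ^^ n) z = 0"
    have "(\<lambda>u. \<beta> u + of_nat n * \<alpha> u) \<in> insert 0 roots" for n
      by (rule weight_is_root[OF dual_shift ad_power_root_space])
        (use assms neg rootsD in auto)
    then have "\<alpha> = 0" by (intro no_infinite_string[of \<alpha> \<beta>]) (use assms rootsD in auto)
    then show False using assms rootsD by auto
  qed
  then obtain n where "(bracket x ^^ n) z = 0" "\<And>i. i < n \<Longrightarrow> (bracket x ^^ i) z \<noteq> 0"
    using exists_least_iff[of "\<lambda>n. (bracket x ^^ n) z = 0"] by blast
  then show ?thesis using that assms(5) by (cases n) auto
qed

text \<open>The sl2 computation with an \<open>h\<close> that is not normalised, so that it also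
  covers \<open>\<alpha> h = 0\<close>. Here \<open>p\<close> is the last power of ad x that does
  not kill a given root vector for \<open>\<beta>\<close>, \<open>q\<close> is the last power of ad
  y that does not kill the resulting highest weight vector v, and the equation expresses that
  [x, y^(q+1) v] = 0.\<close>

lemma root_string:
  assumes \<alpha>: "\<alpha> \<in> roots" and x: "x \<in> root_space \<alpha>" and y: "y \<in> root_space (- \<alpha>)"
    and \<beta>: "\<beta> \<in> roots" and h: "h = \<lbrakk>x, y\<rbrakk>"
  shows "\<exists>p q. (\<forall>k\<le>q. (\<lambda>u. \<beta> u + (of_nat p - of_nat k) * \<alpha> u) \<in> insert 0 roots) \<and>
    2 * (\<beta> h + of_nat p * \<alpha> h) = of_nat q * \<alpha> h"
proof -
  obtain z where z: "z \<in> root_space \<beta>" "z \<noteq> 0" using root_vector_obtain[OF \<beta>] .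
  obtain p where p: "(bracket x ^^ p) z \<noteq> 0" "(bracket x ^^ Suc p) z = 0"
    using ad_power_last[OF \<alpha> x rootsD(1)[OF \<beta>] z] .
  define v where "v = (bracket x ^^ p) z"
  define \<gamma> where "\<gamma> = (\<lambda>u. \<beta> u + of_nat p * \<alpha> u)"
  have \<gamma>: "\<gamma> \<in> dual" unfolding \<gamma>_def by (intro dual_shift rootsD \<alpha> \<beta>)
  have v: "v \<in> root_space \<gamma>" "v \<noteq> 0" "\<lbrakk>x, v\<rbrakk> = 0"
    using p ad_power_root_space[OF x z(1), of p] unfolding v_def \<gamma>_def by auto
  obtain q where q: "(bracket y ^^ q) v \<noteq> 0" "(bracket y ^^ Suc q) v = 0"
    using ad_power_last[OF roots_uminus[OF \<alpha>] y \<gamma> v(1,2)] .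
  define Y where "Y k = (bracket y ^^ k) v" for k
  have Y: "Y k \<in> root_space (\<lambda>u. \<gamma> u - of_nat k * \<alpha> u)" for k
    using ad_power_root_space[OF y v(1), of k] unfolding Y_def by simp
  have Yn: "Y k \<noteq> 0" if "k \<le> q" for k
  proof
    assume "Y k = 0"
    moreover have "Y q = (bracket y ^^ (q - k)) (Y k)"
      unfolding Y_def using that by (simp flip: funpow_add o_apply[of "_ ^^ _"])
    moreover have "(bracket y ^^ n) 0 = 0" for n by (induction n) auto
    ultimately show False using q unfolding Y_def by simp
  qed
  have hH: "h \<in> H" using bracket_opposite[OF x y] h by simp
  \<comment> \<open>The usual formula [x, y^(k+1) v] = (k+1) (\<gamma>(h) - k \<alpha>(h) / 2) y^k
    v; the factor \<alpha>(h) / 2 is 1 in the normalised case.\<close>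
  have xY: "\<lbrakk>x, Y (Suc k)\<rbrakk> = (of_nat (Suc k) * (\<gamma> h - of_nat k * \<alpha> h / 2)) *C Y k" for k
  proof (induction k)
    case 0
    have "\<lbrakk>x, \<lbrakk>y, v\<rbrakk>\<rbrakk> = \<lbrakk>h, v\<rbrakk>" by (simp add: bracket_derivation[of x y v] v h)
    then show ?case using v(1) hH by (simp add: Y_def root_space_def)
  next
    case (Suc k)
    have "\<lbrakk>x, Y (Suc (Suc k))\<rbrakk> = \<lbrakk>h, Y (Suc k)\<rbrakk> + \<lbrakk>y, \<lbrakk>x, Y (Suc k)\<rbrakk>\<rbrakk>"
      using bracket_derivation[of x y "Y (Suc k)"] by (simp add: h Y_def)
    also have "\<lbrakk>h, Y (Suc k)\<rbrakk> = (\<gamma> h - of_nat (Suc k) * \<alpha> h) *C Y (Suc k)"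
      using Y[of "Suc k"] hH by (simp add: root_space_def)
    also have "\<lbrakk>y, \<lbrakk>x, Y (Suc k)\<rbrakk>\<rbrakk> = (of_nat (Suc k) * (\<gamma> h - of_nat k * \<alpha> h / 2)) *C Y (Suc k)"
      unfolding Suc.IH by (simp add: bracket_scale_right) (simp add: Y_def)
    finally show ?case unfolding scale_left_distrib[symmetric]
      by (rule trans) (rule arg_cong[where f="\<lambda>c. c *C Y (Suc k)"], simp add: field_simps)
  qed
  have "(of_nat (Suc q) * (\<gamma> h - of_nat q * \<alpha> h / 2)) *C Y q = 0"
    using xY[of q] q(2) by (simp add: Y_def)
  then have "of_nat (Suc q) * (\<gamma> h - of_nat q * \<alpha> h / 2) = (0::complex)"
    using Yn[of q] by simp
  then have "\<gamma> h = of_nat q * \<alpha> h / 2"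
    unfolding mult_eq_0_iff of_nat_eq_0_iff by simp
  then have eq: "2 * (\<beta> h + of_nat p * \<alpha> h) = of_nat q * \<alpha> h" unfolding \<gamma>_def by (simp add: field_simps)
  have "(\<lambda>u. \<beta> u + (of_nat p - of_nat k) * \<alpha> u) \<in> insert 0 roots" if "k \<le> q" for k
  proof -
    have "(\<lambda>u. \<beta> u + (of_nat p - of_nat k) * \<alpha> u) = (\<lambda>u. \<gamma> u - of_nat k * \<alpha> u)"
      by (auto simp: \<gamma>_def algebra_simps)
    then show ?thesis
      using weight_is_root[OF dual_shift[OF rootsD(1)[OF \<beta>] rootsD(1)[OF \<alpha>]] _ Yn[OF that]] Y[of k] by metis
  qed
  with eq show ?thesis by blast
qed

text \<open>For \<open>\<alpha> h = 2\<close> the string relation reads \<beta>(h) = q - 2p, so the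
  reflected weight is the string member at k = q - p, provided that p <= q. Exchanging
  \<open>x\<close> and \<open>y\<close> gives a second string with -\<beta>(h) = q' - 2p'. Since q +
  q' = 2 (p + p'), at least one of p <= q and p' <= q' holds.\<close>

lemma sl2_reflection:
  assumes \<alpha>: "\<alpha> \<in> roots" and x: "x \<in> root_space \<alpha>" and y: "y \<in> root_space (- \<alpha>)"
    and a2: "\<alpha> \<lbrakk>x, y\<rbrakk> = 2" and \<beta>: "\<beta> \<in> insert 0 roots"
  shows "(\<lambda>u. \<beta> u - \<beta> \<lbrakk>x, y\<rbrakk> * \<alpha> u) \<in> insert 0 roots"
proof (cases "\<beta> = 0")
  case True then show ?thesis by (auto simp: fun_eq_iff)
next
  case False
  then have \<beta>: "\<beta> \<in> roots" using assms by simp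
  define h where "h = \<lbrakk>x, y\<rbrakk>"
  have h: "h \<in> H" unfolding h_def using bracket_opposite[OF x y] .
  have yx: "\<lbrakk>y, x\<rbrakk> = - h" unfolding h_def by (rule bracket_anticomm)
  obtain p q where pq: "\<And>k. k \<le> q \<Longrightarrow> (\<lambda>u. \<beta> u + (of_nat p - of_nat k) * \<alpha> u) \<in> insert 0 roots"
    "2 * (\<beta> h + of_nat p * \<alpha> h) = of_nat q * \<alpha> h"
    using root_string[OF \<alpha> x y \<beta> h_def] by blast
  obtain p' q' where pq': "\<And>k. k \<le> q' \<Longrightarrow> (\<lambda>u. \<beta> u + (of_nat p' - of_nat k) * (- \<alpha>) u) \<in> insert 0 roots"
    "2 * (\<beta> (- h) + of_nat p' * (- \<alpha>) (- h)) = of_nat q' * (- \<alpha>) (- h)"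
    using root_string[OF roots_uminus[OF \<alpha>] y _ \<beta> yx[symmetric]] x by auto
  have [simp]: "\<alpha> h = 2" using a2 by (simp add: h_def)
  have \<beta>h: "\<beta> h = of_nat q - 2 * of_nat p"
  proof -
    have "2 * (\<beta> h + 2 * of_nat p) = 2 * of_nat q" using pq(2) by (simp add: mult.commute)
    then have "\<beta> h + 2 * of_nat p = of_nat q" by (simp only: mult_cancel_left) simp
    then show ?thesis by (simp add: eq_diff_eq)
  qed
  have [simp]: "\<beta> (- h) = - \<beta> h" "\<alpha> (- h) = - \<alpha> h"
    by (rule dual_apply_minus[OF rootsD(1)[OF \<beta>] h], rule dual_apply_minus[OF rootsD(1)[OF \<alpha>] h])
  have \<beta>h': "- \<beta> h = of_nat q' - 2 * of_nat p'"
  proof -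
    have "2 * (- \<beta> h + 2 * of_nat p') = 2 * of_nat q'" using pq'(2) by (simp add: mult.commute)
    then have "- \<beta> h + 2 * of_nat p' = of_nat q'" by (simp only: mult_cancel_left) simp
    then show ?thesis by (simp add: eq_diff_eq)
  qed
  have "(of_nat q - 2 * of_nat p) + (of_nat q' - 2 * of_nat p') = (0 :: complex)"
    unfolding \<beta>h[symmetric] \<beta>h'[symmetric] by simp
  then have "of_nat (q + q') = (of_nat (2 * p + 2 * p') :: complex)" by (simp add: algebra_simps)
  then have "q + q' = 2 * p + 2 * p'" by (simp only: of_nat_eq_iff)
  then consider "p \<le> q" | "p' \<le> q'" by linarith
  then show ?thesis
  proof cases
    case 1
    have "(\<lambda>u. \<beta> u + (of_nat p - of_nat (q - p)) * \<alpha> u) = (\<lambda>u. \<beta> u - \<beta> h * \<alpha> u)"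
      unfolding \<beta>h using 1 by (auto simp: fun_eq_iff of_nat_diff algebra_simps)
    then show ?thesis using pq(1)[of "q - p"] by (simp add: h_def)
  next
    case 2
    have "(\<lambda>u. \<beta> u + (of_nat p' - of_nat (q' - p')) * (- \<alpha>) u) = (\<lambda>u. \<beta> u - \<beta> h * \<alpha> u)"
      using 2 \<beta>h' by (auto simp: fun_eq_iff of_nat_diff algebra_simps eq_neg_iff_add_eq_0 minus_equation_iff[of "\<beta> h"])
    then show ?thesis using pq'(1)[of "q' - p'"] by (simp add: h_def)
  qed
qed

text \<open>An \<open>h\<close> killed by all roots commutes with \<open>H\<close> and with every
  root space, hence is central; the centre is an ideal, and simplicity leaves only 0.\<close>

lemma roots_separate:
  assumes "h \<in> H" "\<And>\<beta>. \<beta> \<in> roots \<Longrightarrow> \<beta> h = 0"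
  shows "h = 0"
proof (rule ccontr)
  assume "h \<noteq> 0"
  have "subspace {z. \<lbrakk>h, z\<rbrakk> = 0}"
    by (auto simp: subspace_def bracket_add_right bracket_scale_right)
  moreover have "H \<union> (\<Union>\<alpha>\<in>roots. root_space \<alpha>) \<subseteq> {z. \<lbrakk>h, z\<rbrakk> = 0}"
    using assms H_abelian by (auto simp: root_space_def)
  ultimately have "span (H \<union> (\<Union>\<alpha>\<in>roots. root_space \<alpha>)) \<subseteq> {z. \<lbrakk>h, z\<rbrakk> = 0}"
    by (rule span_minimal[rotated])
  then have h: "\<lbrakk>h, z\<rbrakk> = 0" for z using splitting unfolding splitting_def by auto
  define Z where "Z = {u. \<forall>z. \<lbrakk>z, u\<rbrakk> = 0}"
  have "lie_ideal Z" unfolding lie_ideal_def subspace_def Z_def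
    by (auto simp: bracket_add_right bracket_scale_right)
  moreover have "h \<in> Z" unfolding Z_def using h bracket_anticomm[of _ h] by simp
  ultimately have "Z = UNIV" using simple \<open>h \<noteq> 0\<close> unfolding simple_lie_def by blast
  then show False using simple unfolding simple_lie_def Z_def by blast
qed

text \<open>Since \<open>x\<close> can be rescaled, the value 2 stands for any nonzero value of
  \<open>\<alpha>\<close> on a bracket of opposite root vectors; such a root carries an
  sl2-triple.\<close>

definition integrable_root :: "('a \<Rightarrow> complex) \<Rightarrow> bool" where
  "integrable_root \<alpha> \<longleftrightarrow> \<alpha> \<in> roots \<and> (\<exists>x\<in>root_space \<alpha>. \<exists>y\<in>root_space (- \<alpha>). \<alpha> \<lbrakk>x, y\<rbrakk> = 2)"

text \<open>By rescaling, \<open>\<alpha>\<close> must vanish on the bracket. Then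
  \<open>root_string\<close> degenerates to 2 \<beta>([x, y]) = 0 for every root \<beta>, and the
  roots separate the points of \<open>H\<close>.\<close>

lemma nonintegrable_bracket:
  assumes \<alpha>: "\<alpha> \<in> roots" and "\<not> integrable_root \<alpha>" and x: "x \<in> root_space \<alpha>" and y: "y \<in> root_space (- \<alpha>)"
  shows "\<lbrakk>x, y\<rbrakk> = 0"
proof (rule roots_separate)
  show H: "\<lbrakk>x, y\<rbrakk> \<in> H" using bracket_opposite[OF x y] .
  have a0: "\<alpha> \<lbrakk>x, y\<rbrakk> = 0"
  proof (rule ccontr)
    assume n: "\<alpha> \<lbrakk>x, y\<rbrakk> \<noteq> 0"
    have "(2 / \<alpha> \<lbrakk>x, y\<rbrakk>) *C x \<in> root_space \<alpha>" using x subspace_root_space by (auto intro: subspace_scale)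
    moreover have "\<alpha> \<lbrakk>(2 / \<alpha> \<lbrakk>x, y\<rbrakk>) *C x, y\<rbrakk> = 2"
      using rootsD(1)[OF \<alpha>] H n by (simp add: bracket_scale_left dual_def)
    ultimately show False using assms unfolding integrable_root_def by blast
  qed
  fix \<beta> assume "\<beta> \<in> roots"
  then obtain p q where "2 * (\<beta> \<lbrakk>x, y\<rbrakk> + of_nat p * \<alpha> \<lbrakk>x, y\<rbrakk>) = of_nat q * \<alpha> \<lbrakk>x, y\<rbrakk>"
    using root_string[OF \<alpha> x y _ refl] by blast
  then show "\<beta> \<lbrakk>x, y\<rbrakk> = 0" using a0 by simp
qed

text \<open>Reducedness excludes 2 \<alpha>, so [x, u] = 0 and 2 u = [[x, y], u] = [x, [y, u]]. As
  [y, u] lies in \<open>H\<close>, the right side is a multiple of \<open>x\<close>.\<close>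

lemma sl2_root_space:
  assumes \<alpha>: "\<alpha> \<in> roots" and x: "x \<in> root_space \<alpha>" and y: "y \<in> root_space (- \<alpha>)"
    and a2: "\<alpha> \<lbrakk>x, y\<rbrakk> = 2" and u: "u \<in> root_space \<alpha>"
  shows "\<exists>c. u = c *C x"
proof -
  have "\<lbrakk>x, u\<rbrakk> = 0"
  proof (rule ccontr)
    assume n: "\<lbrakk>x, u\<rbrakk> \<noteq> 0"
    have eq: "\<alpha> + \<alpha> = (\<lambda>h. 2 * \<alpha> h)" by auto
    have "(\<lambda>h. 2 * \<alpha> h) \<in> insert 0 roots"
      using weight_is_root[OF dual_add root_space_bracket[OF x u] n] rootsD(1)[OF \<alpha>] unfolding eq by blast
    moreover have "(\<lambda>h. 2 * \<alpha> h) \<noteq> 0" using rootsD(2)[OF \<alpha>] by (auto simp: fun_eq_iff)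
    ultimately have "(2::complex) = 1 \<or> (2::complex) = -1" using roots_reduced[OF \<alpha>] by blast
    then show False by auto
  qed
  then have "\<lbrakk>x, \<lbrakk>y, u\<rbrakk>\<rbrakk> = \<lbrakk>\<lbrakk>x, y\<rbrakk>, u\<rbrakk>" by (simp add: bracket_derivation[of x y u])
  also have "\<dots> = 2 *C u" using u bracket_opposite[OF x y] a2 unfolding root_space_def by auto
  finally have 1: "2 *C u = \<lbrakk>x, \<lbrakk>y, u\<rbrakk>\<rbrakk>" by simp
  have "\<lbrakk>u, y\<rbrakk> \<in> H" using bracket_opposite[OF u y] .
  then have "\<lbrakk>\<lbrakk>u, y\<rbrakk>, x\<rbrakk> = \<alpha> \<lbrakk>u, y\<rbrakk> *C x" using x unfolding root_space_def by auto
  moreover have "\<lbrakk>x, \<lbrakk>y, u\<rbrakk>\<rbrakk> = \<lbrakk>\<lbrakk>u, y\<rbrakk>, x\<rbrakk>"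
    by (metis bracket_anticomm bracket_minus_left)
  ultimately have "2 *C u = \<alpha> \<lbrakk>u, y\<rbrakk> *C x" using 1 by simp
  then have "(1/2) *C (2 *C u) = (1/2) *C (\<alpha> \<lbrakk>u, y\<rbrakk> *C x)" by simp
  then show ?thesis by auto
qed

text \<open>A nonzero [u, v] would be a multiple of the sl2 vector \<open>x\<close> of \<gamma> =
  \<alpha> + \<beta>. As [v, y] has weight -\<alpha>, its bracket with \<open>u\<close> vanishes,
  and the derivation rule writes a multiple of [x, y] as a bracket of root vectors for \<beta> and
  -\<beta>. This is impossible if \<beta> is not integrable, and otherwise makes the coroots of
  \<beta> and \<gamma> proportional. The closure property is what turns the span of the
  nonintegrable root spaces into an ideal.\<close>

lemma nonintegrable_closed:
  assumes \<alpha>: "\<alpha> \<in> roots" "\<not> integrable_root \<alpha>" and \<beta>: "\<beta> \<in> roots" and \<gamma>: "integrable_root (\<alpha> + \<beta>)"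
    and u: "u \<in> root_space \<alpha>" and v: "v \<in> root_space \<beta>"
  shows "\<lbrakk>u, v\<rbrakk> = 0"
proof (rule ccontr)
  assume n: "\<lbrakk>u, v\<rbrakk> \<noteq> 0"
  define \<gamma> where "\<gamma> = \<alpha> + \<beta>"
  have \<gamma>r: "\<gamma> \<in> roots" using \<gamma> unfolding \<gamma>_def integrable_root_def by simp
  obtain x y where xy: "x \<in> root_space \<gamma>" "y \<in> root_space (- \<gamma>)" "\<gamma> \<lbrakk>x, y\<rbrakk> = 2"
    using \<gamma> unfolding \<gamma>_def integrable_root_def by auto
  obtain a where a: "\<lbrakk>u, v\<rbrakk> = a *C x"
    using sl2_root_space[OF \<gamma>r xy] root_space_bracket[OF u v] unfolding \<gamma>_def by blast
  have a0: "a \<noteq> 0" using n a by auto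
  have "\<lbrakk>v, y\<rbrakk> \<in> root_space (- \<alpha>)"
    using root_space_bracket[OF v xy(2)] unfolding \<gamma>_def by simp
  then have z: "\<lbrakk>u, \<lbrakk>v, y\<rbrakk>\<rbrakk> = 0" using nonintegrable_bracket[OF \<alpha> u] by simp
  have uy: "\<lbrakk>u, y\<rbrakk> \<in> root_space (- \<beta>)"
    using root_space_bracket[OF u xy(2)] unfolding \<gamma>_def by simp
  have eq: "a *C \<lbrakk>x, y\<rbrakk> = \<lbrakk>v, - \<lbrakk>u, y\<rbrakk>\<rbrakk>"
    using bracket_derivation[of u v y] z a by (simp add: bracket_scale_left bracket_minus_right eq_neg_iff_add_eq_0)
  have uy': "- \<lbrakk>u, y\<rbrakk> \<in> root_space (- \<beta>)" using uy subspace_root_space by (auto intro: subspace_neg)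
  have xyH: "\<lbrakk>x, y\<rbrakk> \<in> H" using bracket_opposite xy by blast
  have xy0: "\<lbrakk>x, y\<rbrakk> \<noteq> 0"
  proof
    assume "\<lbrakk>x, y\<rbrakk> = 0"
    moreover have "\<gamma> 0 = 0" using rootsD(1)[OF \<gamma>r] subspace_0[OF H_subspace]
      unfolding dual_def by (auto dest!: spec[of _ 0] bspec[of _ _ 0])
    ultimately show False using xy by simp
  qed
  show False
  proof (cases "integrable_root \<beta>")
    case False
    then show False using nonintegrable_bracket[OF \<beta> False v uy'] eq a0 xy0 by simp
  next
    case True
    then obtain x' y' where xy': "x' \<in> root_space \<beta>" "y' \<in> root_space (- \<beta>)" "\<beta> \<lbrakk>x', y'\<rbrakk> = 2"
      unfolding integrable_root_def by auto
    obtain b where b: "v = b *C x'" using sl2_root_space[OF \<beta> xy' v] by blast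
    have "(- \<beta>) \<lbrakk>y', x'\<rbrakk> = 2"
      using bracket_anticomm[of y' x'] dual_apply_minus[OF rootsD(1)[OF \<beta>] bracket_opposite[OF xy'(1,2)]] xy'(3)
      by simp
    then obtain d where d: "- \<lbrakk>u, y\<rbrakk> = d *C y'"
      using sl2_root_space[OF roots_uminus[OF \<beta>] xy'(2) _ _ uy', of x'] xy'(1) by auto
    have "a *C \<lbrakk>x, y\<rbrakk> = (b * d) *C \<lbrakk>x', y'\<rbrakk>"
      unfolding eq d unfolding b by (simp add: bracket_scale_left bracket_scale_right mult.commute)
    then have "(1/a) *C (a *C \<lbrakk>x, y\<rbrakk>) = (1/a) *C ((b * d) *C \<lbrakk>x', y'\<rbrakk>)" by simp
    then obtain c where c: "\<lbrakk>x, y\<rbrakk> = c *C \<lbrakk>x', y'\<rbrakk>" using a0 by auto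
    have c0: "c \<noteq> 0" using c xy0 by auto
    define h where "h = \<lbrakk>x', y'\<rbrakk>"
    have hH: "h \<in> H" unfolding h_def using bracket_opposite xy' by blast
    \<comment> \<open>The coroots of \<open>\<beta>\<close> and \<open>\<gamma>\<close> are proportional, so the product of the two reflections is
      unipotent; since the roots are bounded, it must be trivial, which forces \<open>\<beta> = c \<gamma>\<close>.\<close>
    define \<delta> where "\<delta> = (\<lambda>u. \<beta> u - c * \<gamma> u)"
    have \<delta>d: "\<delta> \<in> dual" using dual_shift[OF rootsD(1)[OF \<beta>] rootsD(1)[OF \<gamma>r], of "- c"] unfolding \<delta>_def by simp
    have \<beta>h: "\<beta> h = 2" using xy' h_def by simp
    have "\<gamma> (c *C h) = c * \<gamma> h" using rootsD(1)[OF \<gamma>r] hH unfolding dual_def by auto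
    then have \<gamma>h: "c * \<gamma> h = 2" using xy c h_def by simp
    have step: "(\<lambda>u. \<mu> u + \<mu> h * \<delta> u) \<in> insert 0 roots" if \<mu>: "\<mu> \<in> insert 0 roots" for \<mu>
    proof -
      have "\<mu> \<lbrakk>x, y\<rbrakk> = c * \<mu> h" using \<mu> rootsD(1) hH c unfolding h_def dual_def by fastforce
      then have "(\<lambda>u. \<mu> u - c * \<mu> h * \<gamma> u) \<in> insert 0 roots"
        using sl2_reflection[OF \<gamma>r xy \<mu>] by simp
      from sl2_reflection[OF \<beta> xy' this, folded h_def]
      have "(\<lambda>u. (\<mu> u - c * \<mu> h * \<gamma> u) - (\<mu> h - c * \<mu> h * \<gamma> h) * \<beta> u) \<in> insert 0 roots" .
      moreover have "(\<lambda>u. (\<mu> u - c * \<mu> h * \<gamma> u) - (\<mu> h - c * \<mu> h * \<gamma> h) * \<beta> u) = (\<lambda>u. \<mu> u + \<mu> h * \<delta> u)"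
      proof
        fix u
        have "c * \<mu> h * \<gamma> h = 2 * \<mu> h" using \<gamma>h by (metis mult.commute mult.left_commute)
        then show "(\<mu> u - c * \<mu> h * \<gamma> u) - (\<mu> h - c * \<mu> h * \<gamma> h) * \<beta> u = \<mu> u + \<mu> h * \<delta> u"
          by (simp add: \<delta>_def algebra_simps)
      qed
      ultimately show ?thesis by simp
    qed
    \<comment> \<open>Adding multiples of \<delta> therefore keeps the value 2 at \<open>h\<close>,
      and each application of \<open>step\<close> adds the same 2 \<delta>.\<close>
    have \<delta>h: "\<delta> h = 0" unfolding \<delta>_def using \<beta>h \<gamma>h by simp
    have iter: "(\<lambda>u. \<beta> u + of_nat n * (2 * \<delta> u)) \<in> insert 0 roots" for n
    proof (induction n)
      case 0 then show ?case using \<beta> by simp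
    next
      case (Suc n)
      from step[OF Suc] have "(\<lambda>u. \<beta> u + of_nat n * (2 * \<delta> u) + 2 * \<delta> u) \<in> insert 0 roots"
        by (simp add: \<delta>h \<beta>h)
      moreover have "(\<lambda>u. \<beta> u + of_nat (Suc n) * (2 * \<delta> u)) = (\<lambda>u. \<beta> u + of_nat n * (2 * \<delta> u) + 2 * \<delta> u)"
        by (simp add: fun_eq_iff algebra_simps)
      ultimately show ?case by (simp only:)
    qed
    have "(\<lambda>u. 2 * \<delta> u) = 0" by (rule no_infinite_string[OF dual_scale[OF \<delta>d] iter])
    then have "\<beta> = (\<lambda>u. c * \<gamma> u)" unfolding \<delta>_def by (auto simp: fun_eq_iff)
    then have "c = 1 \<or> c = -1" using roots_reduced[OF \<gamma>r] \<beta> by auto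
    then show False
    proof
      assume "c = 1"
      then have "\<alpha> = 0" using \<open>\<beta> = _\<close> unfolding \<gamma>_def by (auto simp: fun_eq_iff)
      then show False using \<alpha> rootsD by auto
    next
      assume "c = -1"
      then have "\<alpha> = (\<lambda>u. - 2 * \<beta> u)" using \<open>\<beta> = _\<close> unfolding \<gamma>_def
        by (auto simp: fun_eq_iff)
      then have "(-2::complex) = 1 \<or> (-2::complex) = -1" using roots_reduced[OF \<beta>, of "-2"] \<alpha> by auto
      then show False by auto
    qed
  qed
qed

lemma all_integrable:
  assumes "\<alpha> \<in> roots" shows "integrable_root \<alpha>"
proof (rule ccontr)
  assume \<alpha>: "\<not> integrable_root \<alpha>"
  define R where "R = {\<beta> \<in> roots. \<not> integrable_root \<beta>}"
  define N where "N = span (\<Union>\<beta>\<in>R. root_space \<beta>)"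
  have gen: "\<lbrakk>z, u\<rbrakk> \<in> N" if z: "z \<in> H \<union> (\<Union>\<alpha>\<in>roots. root_space \<alpha>)" and \<beta>: "\<beta> \<in> R" and u: "u \<in> root_space \<beta>" for z u \<beta>
  proof (cases "z \<in> H")
    case True
    then have "\<lbrakk>z, u\<rbrakk> = \<beta> z *C u" using u unfolding root_space_def by auto
    then show ?thesis unfolding N_def using \<beta> u by (auto intro: span_scale span_base)
  next
    case False
    then obtain \<gamma> where \<gamma>: "\<gamma> \<in> roots" "z \<in> root_space \<gamma>" using z by auto
    have \<beta>r: "\<beta> \<in> roots" "\<not> integrable_root \<beta>" using \<beta> R_def by auto
    have br: "\<lbrakk>u, z\<rbrakk> \<in> root_space (\<beta> + \<gamma>)" using root_space_bracket[OF u \<gamma>(2)] .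
    have "\<lbrakk>u, z\<rbrakk> \<in> N"
    proof (cases "\<lbrakk>u, z\<rbrakk> = 0")
      case True then show ?thesis unfolding N_def by (simp add: span_zero)
    next
      case n: False
      have "\<beta> + \<gamma> \<in> insert 0 roots"
        using weight_is_root[OF _ br n] dual_add \<beta>r \<gamma> rootsD by blast
      moreover have "\<beta> + \<gamma> \<noteq> 0"
      proof
        assume "\<beta> + \<gamma> = 0"
        then have "z \<in> root_space (- \<beta>)" using \<gamma> by (metis add_eq_0_iff)
        then show False using nonintegrable_bracket[OF \<beta>r u] n by simp
      qed
      moreover have "\<not> integrable_root (\<beta> + \<gamma>)" using nonintegrable_closed[OF \<beta>r \<gamma>(1) _ u \<gamma>(2)] n by blast
      ultimately have "\<beta> + \<gamma> \<in> R" unfolding R_def by simp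
      then show ?thesis unfolding N_def using br by (auto intro!: span_base)
    qed
    then show ?thesis unfolding N_def using bracket_anticomm[of z u] by (simp add: span_neg)
  qed
  have gen': "\<lbrakk>z, u\<rbrakk> \<in> N" if z: "z \<in> H \<union> (\<Union>\<alpha>\<in>roots. root_space \<alpha>)" and u: "u \<in> N" for z u
    using u unfolding N_def
  proof (induction rule: span_induct_alt)
    case base then show ?case by (simp add: span_zero)
  next
    case (step c x y)
    then have "\<lbrakk>z, x\<rbrakk> \<in> N" using gen[OF z] by blast
    then show ?case using step unfolding N_def
      by (simp add: bracket_add_right bracket_scale_right span_add span_scale)
  qed
  have "\<lbrakk>z, u\<rbrakk> \<in> N" if u: "u \<in> N" for z u
  proof -
    have "z \<in> span (H \<union> (\<Union>\<alpha>\<in>roots. root_space \<alpha>))" using splitting unfolding splitting_def by auto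
    then show ?thesis
    proof (induction rule: span_induct_alt)
      case base then show ?case by (simp add: N_def span_zero)
    next
      case (step c x y)
      then show ?case using gen'[of x u] u unfolding N_def
        by (simp add: bracket_add_left bracket_scale_left span_add span_scale)
    qed
  qed
  then have "lie_ideal N" unfolding lie_ideal_def N_def by auto
  moreover have "N \<noteq> {0}"
  proof -
    obtain x where "x \<in> root_space \<alpha>" "x \<noteq> 0" using root_vector_obtain[OF assms] .
    moreover from this have "x \<in> N" unfolding N_def R_def using assms \<alpha> by (auto intro!: span_base)
    ultimately show ?thesis by auto
  qed
  ultimately have N: "N = UNIV" using simple unfolding simple_lie_def by blast
  have expand: "\<exists>A u. finite A \<and> A \<subseteq> R \<and> (\<forall>\<beta>\<in>A. u \<beta> \<in> root_space \<beta>) \<and> v = (\<Sum>\<beta>\<in>A. u \<beta>)" if "v \<in> N" for v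
    using that unfolding N_def
  proof (induction rule: span_induct_alt)
    case base then show ?case by (intro exI[of _ "{}"]) auto
  next
    case (step c x y)
    then obtain A u \<beta> where A: "finite A" "A \<subseteq> R" "\<forall>\<beta>\<in>A. u \<beta> \<in> root_space \<beta>" "y = (\<Sum>\<beta>\<in>A. u \<beta>)"
      and \<beta>: "\<beta> \<in> R" "x \<in> root_space \<beta>" by auto
    \<comment> \<open>The weight of the new term may or may not occur in \<open>A\<close> already;
      extending \<open>u\<close> by 0 outside \<open>A\<close> treats both cases at once.\<close>
    define u' where "u' \<gamma> = (if \<gamma> \<in> A then u \<gamma> else 0) + (if \<gamma> = \<beta> then c *C x else 0)" for \<gamma>
    have "(\<Sum>\<gamma>\<in>insert \<beta> A. u' \<gamma>) = (\<Sum>\<gamma>\<in>insert \<beta> A. if \<gamma> \<in> A then u \<gamma> else 0) + c *C x"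
      unfolding u'_def sum.distrib using A(1) by (simp add: sum.delta)
    also have "(\<Sum>\<gamma>\<in>insert \<beta> A. if \<gamma> \<in> A then u \<gamma> else 0) = (\<Sum>\<gamma>\<in>A. u \<gamma>)"
      using A(1) by (intro sum.mono_neutral_cong_right) auto
    finally have "c *C x + y = (\<Sum>\<gamma>\<in>insert \<beta> A. u' \<gamma>)" using A(4) by (simp add: add.commute)
    moreover have "u' \<gamma> \<in> root_space \<gamma>" if "\<gamma> \<in> insert \<beta> A" for \<gamma>
      using A(3) \<beta>(2) subspace_root_space[of \<gamma>] that
      by (auto simp: u'_def subspace_0 intro!: subspace_add subspace_scale)
    ultimately show ?case using A(1,2) \<beta>(1)
      by (intro exI[of _ "insert \<beta> A"] exI[of _ u']) auto
  qed
  obtain h where h: "h \<in> H" "\<alpha> h \<noteq> 0"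
    using dual_eqI[of \<alpha> 0] rootsD[OF assms] by (auto simp: dual_def)
  obtain A u where A: "finite A" "A \<subseteq> R" "\<forall>\<beta>\<in>A. u \<beta> \<in> root_space \<beta>" "h = (\<Sum>\<beta>\<in>A. u \<beta>)"
    using expand[of h] N by auto
  have 0: "0 \<notin> A" using A(2) rootsD unfolding R_def by auto
  \<comment> \<open>Weight 0 receives the vector \<open>- h\<close>, which turns the expansion of
    \<open>h\<close> into a vanishing sum of vectors of distinct weights.\<close>
  define u' where "u' = u (0 := - h)"
  have "\<forall>\<beta>\<in>insert 0 A. u' \<beta> = 0"
  proof (rule root_vectors_independent)
    show "finite (insert 0 A)" using A by simp
    show "insert 0 A \<subseteq> dual" using A(2) rootsD unfolding R_def by (auto simp: dual_def)
    show "\<forall>\<beta>\<in>insert 0 A. u' \<beta> \<in> root_space \<beta>"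
      using A(3) 0 h(1) subspace_neg[OF H_subspace] root_space_zero by (auto simp: u'_def)
    have "(\<Sum>\<beta>\<in>A. u' \<beta>) = h" unfolding A(4) using 0 by (intro sum.cong) (auto simp: u'_def)
    then show "(\<Sum>\<beta>\<in>insert 0 A. u' \<beta>) = 0" using A(1) 0 by (simp add: u'_def)
  qed
  then have "h = 0" by (simp add: u'_def)
  moreover have "\<alpha> 0 = 0" using rootsD(1)[OF assms] subspace_0[OF H_subspace]
      unfolding dual_def by (auto dest!: spec[of _ 0] bspec[of _ _ 0])
  ultimately show False using h by simp
qed

text \<open>Makes coroots computable from the set of roots alone, without knowing brackets. Root
  spaces are lines, so the span in \<open>coroot\<close> is a line and the \<open>THE\<close> is its
  point \<open>h\<close> with the value 2; it remains to compare \<open>h\<close> and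
  \<open>h'\<close> on all roots.\<close>

lemma coroot_eqI:
  assumes \<alpha>: "\<alpha> \<in> roots" and h': "h' \<in> H" "\<alpha> h' = 2"
    and refl: "\<And>\<beta>. \<beta> \<in> roots \<Longrightarrow> (\<lambda>u. \<beta> u - \<beta> h' * \<alpha> u) \<in> roots"
  shows "coroot \<alpha> = h'"
proof -
  obtain x y where xy: "x \<in> root_space \<alpha>" "y \<in> root_space (- \<alpha>)" "\<alpha> \<lbrakk>x, y\<rbrakk> = 2"
    using all_integrable[OF \<alpha>] unfolding integrable_root_def by auto
  define h where "h = \<lbrakk>x, y\<rbrakk>"
  have hH: "h \<in> H" unfolding h_def using bracket_opposite xy by blast
  have "- y \<in> root_space (- \<alpha>)" using xy subspace_root_space by (auto intro: subspace_neg)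
  have yx: "(- \<alpha>) \<lbrakk>y, x\<rbrakk> = 2"
    using bracket_anticomm[of y x] dual_apply_minus[OF rootsD(1)[OF \<alpha>] bracket_opposite[OF xy(1,2)]] xy(3)
    by simp
  have brs: "\<exists>c. \<lbrakk>u, v\<rbrakk> = c *C h" if uv: "u \<in> root_space \<alpha>" "v \<in> root_space (- \<alpha>)" for u v
  proof -
    obtain b where b: "u = b *C x" using sl2_root_space[OF \<alpha> xy uv(1)] by blast
    obtain d where d: "v = d *C y"
      using sl2_root_space[OF roots_uminus[OF \<alpha>] xy(2) _ yx uv(2)] xy(1) by auto
    show ?thesis unfolding b d h_def by (auto simp: bracket_scale_left bracket_scale_right)
  qed
  let ?B = "{\<lbrakk>x, y\<rbrakk> |x y. x \<in> root_space \<alpha> \<and> y \<in> root_space (- \<alpha>)}"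
  have sp: "span ?B \<subseteq> span {h}"
  proof (rule span_minimal)
    show "?B \<subseteq> span {h}" using brs by (fastforce simp: span_singleton)
  qed simp
  have "coroot \<alpha> = h"
    unfolding coroot_def
  proof (rule the_equality)
    show "h \<in> span ?B \<and> \<alpha> h = 2" unfolding h_def using xy by (auto intro!: span_base)
    fix k assume k: "k \<in> span ?B \<and> \<alpha> k = 2"
    then obtain c where c: "k = c *C h" using sp by (auto simp: span_singleton)
    have "\<alpha> (c *C h) = c * \<alpha> h" using rootsD(1)[OF \<alpha>] hH unfolding dual_def by auto
    then have "c = 1" using k c xy h_def by auto
    then show "k = h" using c by simp
  qed
  moreover have "h' - h = 0"
  proof (rule roots_separate)
    show "h' - h \<in> H" using hH h' H_subspace by (auto intro: subspace_diff)
    fix \<beta> assume \<beta>: "\<beta> \<in> roots"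
    have ah: "\<alpha> h = 2" using xy h_def by simp
    define d where "d = \<beta> h' - \<beta> h"
    \<comment> \<open>The product of the reflections given by \<open>h\<close> and \<open>h'\<close> is unipotent and permutes a bounded set.\<close>
    have step: "(\<lambda>u. \<mu> u + (\<mu> h' - \<mu> h) * \<alpha> u) \<in> insert 0 roots" if \<mu>: "\<mu> \<in> insert 0 roots" for \<mu>
    proof (cases "\<mu> = 0")
      case True then show ?thesis by (auto simp: fun_eq_iff)
    next
      case False
      then have "(\<lambda>u. \<mu> u - \<mu> h' * \<alpha> u) \<in> insert 0 roots" using refl \<mu> by blast
      from sl2_reflection[OF \<alpha> xy this, folded h_def]
      have "(\<lambda>u. \<mu> u - \<mu> h' * \<alpha> u - (\<mu> h - \<mu> h' * \<alpha> h) * \<alpha> u) \<in> insert 0 roots" .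
      then show ?thesis by (simp add: ah algebra_simps)
    qed
    \<comment> \<open>Adding a multiple of \<alpha> does not change the difference of the values at
      \<open>h'\<close> and \<open>h\<close>, since \<alpha> is 2 at both; so every step adds the
      same \<open>d * \<alpha> u\<close>.\<close>
    have iter: "(\<lambda>u. \<beta> u + of_nat n * (d * \<alpha> u)) \<in> insert 0 roots" for n
    proof (induction n)
      case 0 then show ?case using \<beta> by simp
    next
      case (Suc n)
      from step[OF Suc] have "(\<lambda>u. \<beta> u + of_nat n * (d * \<alpha> u) + d * \<alpha> u) \<in> insert 0 roots"
        by (simp add: ah h' d_def algebra_simps)
      moreover have "(\<lambda>u. \<beta> u + of_nat (Suc n) * (d * \<alpha> u)) = (\<lambda>u. \<beta> u + of_nat n * (d * \<alpha> u) + d * \<alpha> u)"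
        by (simp add: fun_eq_iff algebra_simps)
      ultimately show ?case by (simp only:)
    qed
    have "(\<lambda>u. d * \<alpha> u) = 0" by (rule no_infinite_string[OF dual_scale[OF rootsD(1)[OF \<alpha>]] iter])
    then have "d * \<alpha> h = 0" by (metis zero_fun_apply)
    then have "d = 0" using ah by simp
    moreover have "\<beta> (h' - h) = d"
    proof -
      have "\<beta> (h' + - h) = \<beta> h' + \<beta> (- h)"
        using rootsD(1)[OF \<beta>] h' hH subspace_neg[OF H_subspace] unfolding dual_def by blast
      then show ?thesis using dual_apply_minus[OF rootsD(1)[OF \<beta>] hH] by (simp add: d_def)
    qed
    ultimately show "\<beta> (h' - h) = 0" by simp
  qed
  ultimately show ?thesis by simp
qed

end

section \<open>Thresholds and the minimal part\<close>

text \<open>\<open>A\<close> collects the levels below which only finitely many indices of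
  \<open>L\<close> fall, \<open>A'\<close> the dual levels for \<open>U\<close>. A common level
  leaves only finite sums. Otherwise \<open>c = Sup A\<close> works: infinitely many indices of
  \<open>U\<close> have values above any level less than \<open>c\<close>, so finitely many
  offenders in \<open>L\<close> can be matched injectively with them, and the hypothesis bounds
  their total offence by \<open>B\<close> up to an arbitrarily small error. The case of
  \<open>U\<close> is symmetric.\<close>

lemma exists_threshold:
  fixes f :: "'j \<Rightarrow> real"
  assumes L: "L \<noteq> {}" and U: "U \<noteq> {}"
    and B: "\<And>F p. finite F \<Longrightarrow> F \<subseteq> L \<Longrightarrow> inj_on p F \<Longrightarrow> p ` F \<subseteq> U \<Longrightarrow> (\<Sum>j\<in>F. f (p j) - f j) \<le> B"
  shows "\<exists>c. (\<lambda>j. max 0 (c - f j)) summable_on L \<and> (\<lambda>j. max 0 (f j - c)) summable_on U"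
proof -
  define A where "A = {t. finite {j\<in>L. f j < t}}"
  define A' where "A' = {t. finite {k\<in>U. f k > t}}"
  have pair: "f k - f j \<le> B" if "j \<in> L" "k \<in> U" for j k
    using B[of "{j}" "\<lambda>_. k"] that by auto
  obtain j0 k0 where jk: "j0 \<in> L" "k0 \<in> U" using L U by auto
  \<comment> \<open>Single pairs already bound \<open>f\<close> from below on \<open>L\<close> and
    from above on \<open>U\<close>, so both families of levels are nonempty.\<close>
  have "{j\<in>L. f j < f k0 - B} = {}" using pair jk by (auto simp: not_less) fastforce
  then have A_ne: "f k0 - B \<in> A" unfolding A_def by (simp only: mem_Collect_eq finite.emptyI)
  have "{k\<in>U. f k > f j0 + B} = {}" using pair jk by (auto simp: not_less) fastforce
  then have A'_ne: "f j0 + B \<in> A'" unfolding A'_def by (simp only: mem_Collect_eq finite.emptyI)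
  have A_down: "s \<in> A" if "t \<in> A" "s \<le> t" for s t
    using that unfolding A_def by (auto elim!: rev_finite_subset)
  have A'_up: "s \<in> A'" if "t \<in> A'" "t \<le> s" for s t
    using that unfolding A'_def by (auto elim!: rev_finite_subset)
  show ?thesis
  proof (cases "A \<inter> A' = {}")
    case False
    then obtain c where c: "c \<in> A" "c \<in> A'" by auto
    have "(\<lambda>j. max 0 (c - f j)) summable_on {j\<in>L. f j < c}"
      using c unfolding A_def by (intro summable_on_finite) auto
    then have "(\<lambda>j. max 0 (c - f j)) summable_on L"
      by (subst summable_on_cong_neutral[where T="{j\<in>L. f j < c}" and g="\<lambda>j. max 0 (c - f j)"]) auto
    moreover have "(\<lambda>j. max 0 (f j - c)) summable_on {k\<in>U. f k > c}"
      using c unfolding A'_def by (intro summable_on_finite) auto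
    then have "(\<lambda>j. max 0 (f j - c)) summable_on U"
      by (subst summable_on_cong_neutral[where T="{k\<in>U. f k > c}" and g="\<lambda>j. max 0 (f j - c)"]) auto
    ultimately show ?thesis by blast
  next
    case True
    have less: "s \<le> t" if "s \<in> A" "t \<in> A'" for s t
      using A'_up[OF that(2), of s] that True by (cases "s \<le> t") auto
    define c where "c = Sup A"
    have bdd: "bdd_above A" using less A'_ne by (auto simp: bdd_above_def)
    have below: "infinite {k\<in>U. f k > t}" if t: "t < c" for t
    proof -
      obtain s where "s \<in> A" "t < s" using t A_ne less_cSup_iff[OF _ bdd, of t] unfolding c_def by blast
      then have "t \<in> A" using A_down by force
      then show ?thesis using True unfolding A'_def by auto
    qed
    have above: "infinite {j\<in>L. f j < t}" if "t > c" for t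
      using cSup_upper[OF _ bdd, of t] that unfolding c_def A_def by force
    \<comment> \<open>For fixed n the choice \<eta> = e / (n + 1) gives n \<eta> <= e; the added 1
      covers n = 0.\<close>
    have close: "s \<le> B" if "\<And>\<eta>. \<eta> > 0 \<Longrightarrow> s - real n * \<eta> \<le> B" for s n
    proof (rule field_le_epsilon)
      fix e :: real assume "e > 0"
      have "real n * (e / (real n + 1)) \<le> e" using \<open>e > 0\<close> by (simp add: field_simps)
      then show "s \<le> B + e" using that[of "e / (real n + 1)"] \<open>e > 0\<close> by simp
    qed
    have "(\<lambda>j. max 0 (c - f j)) summable_on L"
    proof (rule nonneg_bounded_partial_sums_imp_summable_on)
      show "\<forall>\<^sub>F F in finite_subsets_at_top L. (\<Sum>j\<in>F. max 0 (c - f j)) \<le> B"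
      proof (rule eventually_finite_subsets_at_top_weakI)
        fix F assume F: "finite F" "F \<subseteq> L"
        define F' where "F' = {j\<in>F. f j < c}"
        have F': "finite F'" "F' \<subseteq> L" using F by (auto simp: F'_def)
        have "(\<Sum>j\<in>F'. c - f j) - real (card F') * \<eta> \<le> B" if \<eta>: "\<eta> > 0" for \<eta>
        proof -
          obtain G where G: "G \<subseteq> {k\<in>U. f k > c - \<eta>}" "finite G" "card G = card F'"
            using infinite_arbitrarily_large[OF below[of "c - \<eta>"], of "card F'"] \<eta> by auto
          then obtain p where p: "bij_betw p F' G" using finite_same_card_bij[OF F'(1) G(2)] by auto
          have "(\<Sum>j\<in>F'. (c - f j) - \<eta>) \<le> (\<Sum>j\<in>F'. f (p j) - f j)"
            using G(1) bij_betwE[OF p] by (intro sum_mono) fastforce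
          also have "\<dots> \<le> B" using p G(1) F' by (intro B) (auto simp: bij_betw_def)
          finally show ?thesis by (simp add: sum_subtractf)
        qed
        then have "(\<Sum>j\<in>F'. c - f j) \<le> B" by (rule close)
        moreover have "(\<Sum>j\<in>F. max 0 (c - f j)) = (\<Sum>j\<in>F'. c - f j)"
          using F(1) by (intro sum.mono_neutral_cong_right) (auto simp: F'_def)
        ultimately show "(\<Sum>j\<in>F. max 0 (c - f j)) \<le> B" by simp
      qed
    qed auto
    moreover have "(\<lambda>j. max 0 (f j - c)) summable_on U"
    proof (rule nonneg_bounded_partial_sums_imp_summable_on)
      show "\<forall>\<^sub>F F in finite_subsets_at_top U. (\<Sum>j\<in>F. max 0 (f j - c)) \<le> B"
      proof (rule eventually_finite_subsets_at_top_weakI)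
        fix F assume F: "finite F" "F \<subseteq> U"
        define F' where "F' = {j\<in>F. f j > c}"
        have F': "finite F'" "F' \<subseteq> U" using F by (auto simp: F'_def)
        have "(\<Sum>j\<in>F'. f j - c) - real (card F') * \<eta> \<le> B" if \<eta>: "\<eta> > 0" for \<eta>
        proof -
          obtain G where G: "G \<subseteq> {j\<in>L. f j < c + \<eta>}" "finite G" "card G = card F'"
            using infinite_arbitrarily_large[OF above[of "c + \<eta>"], of "card F'"] \<eta> by auto
          then obtain p where p: "bij_betw p G F'" using finite_same_card_bij[OF G(2) F'(1)] by auto
          have "(\<Sum>j\<in>F'. f j - c) - real (card F') * \<eta> = (\<Sum>j\<in>F'. (f j - c) - \<eta>)"
            by (simp add: sum_subtractf)
          also have "\<dots> = (\<Sum>j\<in>G. (f (p j) - c) - \<eta>)"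
            using sum.reindex_bij_betw[OF p, of "\<lambda>j. (f j - c) - \<eta>"] by simp
          also have "\<dots> \<le> (\<Sum>j\<in>G. f (p j) - f j)"
            using G(1) by (intro sum_mono) fastforce
          also have "\<dots> \<le> B" using p G F' by (intro B) (auto simp: bij_betw_def)
          finally show ?thesis .
        qed
        then have "(\<Sum>j\<in>F'. f j - c) \<le> B" by (rule close)
        moreover have "(\<Sum>j\<in>F. max 0 (f j - c)) = (\<Sum>j\<in>F'. f j - c)"
          using F(1) by (intro sum.mono_neutral_cong_right) (auto simp: F'_def)
        ultimately show "(\<Sum>j\<in>F. max 0 (f j - c)) \<le> B" by simp
      qed
    qed auto
    ultimately show ?thesis by blast
  qed
qed

text \<open>\<open>g\<close> is the piecewise linear function with slope \<open>c r\<close> on the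
  segment starting at \<open>r\<close>; antitone slopes make it concave. The two conditions place
  \<open>a\<close> between the slopes to the right and to the left of \<open>s\<close>, so that
  \<open>a\<close> is a supergradient at \<open>s\<close>. The largest point of \<open>S\<close>
  starts no segment, hence the clause on \<open>r'\<close>.\<close>

lemma concave_potential_exists:
  fixes S :: "real set" and c :: "real \<Rightarrow> real"
  assumes "finite S" "antimono_on S c"
  shows "\<exists>g. \<forall>s\<in>S. \<forall>a. (\<forall>r\<in>S. r < s \<longrightarrow> a \<le> c r) \<longrightarrow>
    (\<forall>r\<in>S. s \<le> r \<longrightarrow> (\<exists>r'\<in>S. r < r') \<longrightarrow> c r \<le> a) \<longrightarrow> (\<forall>x\<in>S. g x \<le> g s + a * (x - s))"
  using assms
proof (induction S rule: finite_linorder_max_induct)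
  case empty then show ?case by simp
next
  case (insert b S)
  obtain g where g: "\<And>s a x. s \<in> S \<Longrightarrow> (\<And>r. r \<in> S \<Longrightarrow> r < s \<Longrightarrow> a \<le> c r) \<Longrightarrow>
    (\<And>r r'. r \<in> S \<Longrightarrow> s \<le> r \<Longrightarrow> r' \<in> S \<Longrightarrow> r < r' \<Longrightarrow> c r \<le> a) \<Longrightarrow> x \<in> S \<Longrightarrow> g x \<le> g s + a * (x - s)"
    using insert.IH monotone_on_subset[OF insert.prems] by (metis subset_insertI)
  have anti: "c s \<le> c r" if "r \<in> S" "s \<in> S" "r \<le> s" for r s
    using insert.prems that by (auto simp: monotone_on_def)
  show ?case
  proof (cases "S = {}")
    case True then show ?thesis by auto
  next
    case False
    define m where "m = Max S"
    have m: "m \<in> S" "\<And>s. s \<in> S \<Longrightarrow> s \<le> m" "m < b"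
      using False insert.hyps by (auto simp: m_def)
    define g' where "g' = g (b := g m + c m * (b - m))"
    \<comment> \<open>The slope of the new segment is itself a supergradient at \<open>m\<close> on
      the old points, so these lie below the line through the new segment.\<close>
    have gm: "g x \<le> g m + c m * (x - m)" if "x \<in> S" for x
      by (rule g) (use m anti that in \<open>auto simp: not_less[symmetric]\<close>)
    have "g' x \<le> g' s + a * (x - s)"
      if s: "s \<in> insert b S" and lo: "\<And>r. r \<in> insert b S \<Longrightarrow> r < s \<Longrightarrow> a \<le> c r"
        and hi: "\<And>r r'. r \<in> insert b S \<Longrightarrow> s \<le> r \<Longrightarrow> r' \<in> insert b S \<Longrightarrow> r < r' \<Longrightarrow> c r \<le> a"
        and x: "x \<in> insert b S" for s a x
    proof -
      consider "s = b" "x = b" | "s = b" "x \<in> S" | "s \<in> S" "x = b" | "s \<in> S" "x \<in> S"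
        using s x by auto
      then show ?thesis
      proof cases
        case 1 then show ?thesis by simp
      next
        case 2
        then have "a \<le> c m" using lo m by auto
        moreover have "x < b" using 2 insert.hyps by auto
        ultimately have "a * (b - x) \<le> c m * (b - x)" by (intro mult_right_mono) auto
        then show ?thesis using gm[OF 2(2)] 2 \<open>x < b\<close> by (simp add: g'_def algebra_simps)
      next
        case 3
        then have "c m \<le> a" using hi[of m b] m by auto
        then have "c m * (b - m) \<le> a * (b - m)" using m by (intro mult_right_mono) auto
        moreover have "g m \<le> g s + a * (m - s)"
          by (rule g) (use 3 m lo hi in auto)
        moreover have "s < b" using 3 insert.hyps by auto
        ultimately show ?thesis using 3 by (simp add: g'_def algebra_simps)
      next
        case 4
        then have "s < b" "x < b" using insert.hyps by auto
        moreover have "g x \<le> g s + a * (x - s)"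
          by (rule g) (use 4 lo hi in auto)
        ultimately show ?thesis by (simp add: g'_def)
      qed
    qed
    then show ?thesis by (intro exI[of _ g']) blast
  qed
qed

lemma summable_on_sum:
  fixes f :: "'s \<Rightarrow> 'j \<Rightarrow> real"
  shows "(\<And>s. s \<in> N \<Longrightarrow> f s summable_on J) \<Longrightarrow> (\<lambda>j. \<Sum>s\<in>N. f s j) summable_on J"
  by (induction N rule: infinite_finite_induct) (auto intro: summable_on_add)

text \<open>The given thresholds need not be antitone, so they are replaced by their running minima
  \<open>d s\<close>. Both summability statements survive: the lower one because
  \<open>d s \<le> c s\<close>, the upper one because \<open>d s\<close> equals some
  \<open>c r\<close> with \<open>r \<le> s\<close>, whose index set is larger. The last clause of
  the conclusion lets a threshold prescribed by the caller act as a bound on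
  \<open>f'\<close>.\<close>

lemma minimal_part_exists:
  fixes f \<mu> :: "'j \<Rightarrow> real" and S :: "real set"
  assumes S: "finite S" "\<mu> ` J \<subseteq> S"
    and c: "\<And>s s'. s \<in> S \<Longrightarrow> s' \<in> S \<Longrightarrow> s < s' \<Longrightarrow>
      (\<lambda>j. max 0 (c s - f j)) summable_on {j\<in>J. \<mu> j \<le> s} \<and>
      (\<lambda>j. max 0 (f j - c s)) summable_on {j\<in>J. s < \<mu> j}"
  shows "\<exists>f' g. (\<lambda>j. \<bar>f j - f' j\<bar>) summable_on J \<and>
    (\<forall>j\<in>J. \<forall>x\<in>S. g x - g (\<mu> j) \<le> f' j * (x - \<mu> j)) \<and>
    (\<forall>j\<in>J. \<forall>s\<in>S. s < \<mu> j \<longrightarrow> f' j \<le> c s)"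
proof -
  define d where "d s = Min (c ` {r\<in>S. r \<le> s})" for s
  have fin: "finite {r\<in>S. r \<le> s}" for s using S by simp
  have d_le: "d s \<le> c r" if "r \<in> S" "r \<le> s" for r s
    unfolding d_def using that S by (intro Min_le) auto
  have d_in: "\<exists>r\<in>S. r \<le> s \<and> d s = c r" if "s \<in> S" for s
    using Min_in[of "c ` {r\<in>S. r \<le> s}"] that S unfolding d_def by fastforce
  have anti: "antimono_on S d"
  proof (rule monotone_onI)
    fix s t :: real assume "s \<in> S" "t \<in> S" "s \<le> t"
    obtain r where "r \<in> S" "r \<le> s" "d s = c r" using d_in \<open>s \<in> S\<close> by blast
    then show "d s \<ge> d t" using d_le[of r t] \<open>s \<le> t\<close> by auto
  qed
  obtain g where g: "\<And>s a x. s \<in> S \<Longrightarrow> (\<And>r. r \<in> S \<Longrightarrow> r < s \<Longrightarrow> a \<le> d r) \<Longrightarrow>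
    (\<And>r r'. r \<in> S \<Longrightarrow> s \<le> r \<Longrightarrow> r' \<in> S \<Longrightarrow> r < r' \<Longrightarrow> d r \<le> a) \<Longrightarrow> x \<in> S \<Longrightarrow> g x \<le> g s + a * (x - s)"
    using concave_potential_exists[OF S(1) anti] by metis
  \<comment> \<open>The hypothesis provides estimates only where \<open>S\<close> has a larger
    element.\<close>
  define N where "N = {s\<in>S. \<exists>s'\<in>S. s < s'}"
  have N: "finite N" using S by (simp add: N_def)
  have lower: "(\<lambda>j. max 0 (d s - f j)) summable_on {j\<in>J. \<mu> j \<le> s}" if sN: "s \<in> N" for s
  proof -
    obtain s' where s': "s \<in> S" "s' \<in> S" "s < s'" using sN unfolding N_def by auto
    show ?thesis
      by (rule summable_on_comparison_test[OF conjunct1[OF c[OF s']]])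
        (use d_le[OF s'(1)] in \<open>auto simp: max_def intro: order_trans\<close>)
  qed
  have upper: "(\<lambda>j. max 0 (f j - d s)) summable_on {j\<in>J. s < \<mu> j}" if sN: "s \<in> N" for s
  proof -
    obtain s' where s': "s \<in> S" "s' \<in> S" "s < s'" using sN unfolding N_def by auto
    obtain r where r: "r \<in> S" "r \<le> s" "d s = c r" using d_in s' by blast
    have "(\<lambda>j. max 0 (f j - c r)) summable_on {j\<in>J. r < \<mu> j}" using c[of r s'] r s' by auto
    then show ?thesis unfolding r(3)
      by (rule summable_on_subset_banach) (use r in auto)
  qed
  define P where "P j = {s\<in>S. s < \<mu> j}" for j
  define Q where "Q j = {s\<in>N. \<mu> j \<le> s}" for j
  have PQ: "finite (P j)" "finite (Q j)" for j using S N by (auto simp: P_def Q_def)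
  \<comment> \<open>The cut from above comes before the raise from below; the raise respects the
    upper bounds because \<open>d\<close> is antitone and every element of \<open>Q j\<close>
    exceeds every element of \<open>P j\<close>.\<close>
  define h where "h j = Min (insert (f j) (d ` P j))" for j
  define f' where "f' j = Max (insert (h j) (d ` Q j))" for j
  have f'_lo: "d s \<le> f' j" if "s \<in> Q j" for s j
    unfolding f'_def using PQ that by (intro Max_ge) auto
  have f'_hi: "f' j \<le> d s" if "s \<in> P j" for s j
    unfolding f'_def
  proof (rule Max.boundedI)
    fix y assume "y \<in> insert (h j) (d ` Q j)"
    then show "y \<le> d s"
    proof
      assume "y = h j" then show ?thesis unfolding h_def using PQ that by (auto intro: Min_le)
    next
      assume "y \<in> d ` Q j"
      then obtain r where r: "r \<in> Q j" "y = d r" by auto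
      have "s \<le> r" "r \<in> S" "s \<in> S" using r that unfolding P_def Q_def N_def by auto
      then show ?thesis using anti r by (auto simp: monotone_on_def)
    qed
  qed (use PQ in auto)
  have P_N: "P j \<subseteq> N" if "j \<in> J" for j using that S unfolding P_def N_def by auto
  \<comment> \<open>All threshold violations at \<open>j\<close> added up. The clamped value is off
    from \<open>f j\<close> by at most one of them, so \<open>e\<close> is a summable
    majorant.\<close>
  define e where "e j = (\<Sum>s\<in>N. if \<mu> j \<le> s then max 0 (d s - f j) else 0)
     + (\<Sum>s\<in>N. if s < \<mu> j then max 0 (f j - d s) else 0)" for j
  have "e summable_on J"
    unfolding e_def
  proof (intro summable_on_add summable_on_sum)
    fix s assume "s \<in> N"
    show "(\<lambda>j. if \<mu> j \<le> s then max 0 (d s - f j) else 0) summable_on J"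
      by (subst summable_on_cong_neutral[where T="{j\<in>J. \<mu> j \<le> s}" and g="\<lambda>j. max 0 (d s - f j)"])
        (use lower[OF \<open>s \<in> N\<close>] in auto)
    show "(\<lambda>j. if s < \<mu> j then max 0 (f j - d s) else 0) summable_on J"
      by (subst summable_on_cong_neutral[where T="{j\<in>J. s < \<mu> j}" and g="\<lambda>j. max 0 (f j - d s)"])
        (use upper[OF \<open>s \<in> N\<close>] in auto)
  qed
  have dist: "\<bar>f j - f' j\<bar> \<le> e j" if j: "j \<in> J" for j
  proof -
    have e1: "(\<Sum>s\<in>N. if \<mu> j \<le> s then max 0 (d s - f j) else 0) \<ge> 0"
      and e2: "(\<Sum>s\<in>N. if s < \<mu> j then max 0 (f j - d s) else 0) \<ge> 0" by (auto intro: sum_nonneg)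
    have 1: "d s - f j \<le> e j" if "s \<in> Q j" for s
    proof -
      have "d s - f j \<le> (\<Sum>s\<in>N. if \<mu> j \<le> s then max 0 (d s - f j) else 0)"
        using that N by (intro order_trans[OF _ member_le_sum[of s]]) (auto simp: Q_def)
      then show ?thesis using e2 unfolding e_def by simp
    qed
    have 2: "f j - d s \<le> e j" if "s \<in> P j" for s
    proof -
      have "f j - d s \<le> (\<Sum>s\<in>N. if s < \<mu> j then max 0 (f j - d s) else 0)"
        using that N P_N[OF j] by (intro order_trans[OF _ member_le_sum[of s]]) (auto simp: P_def)
      then show ?thesis using e1 unfolding e_def by simp
    qed
    have e0: "0 \<le> e j" using e1 e2 unfolding e_def by simp
    have "h j \<in> insert (f j) (d ` P j)" unfolding h_def using PQ by (intro Min_in) auto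
    then have "f j - h j \<le> e j" using 2 e0 by auto
    moreover have "h j \<le> f' j" unfolding f'_def using PQ by auto
    moreover have "h j \<le> f j" unfolding h_def using PQ by auto
    moreover have "f' j \<in> insert (h j) (d ` Q j)" unfolding f'_def using PQ by (intro Max_in) auto
    ultimately show ?thesis using 1 e0 by (auto simp: abs_le_iff)
  qed
  have "(\<lambda>j. \<bar>f j - f' j\<bar>) summable_on J"
    by (rule summable_on_comparison_test[OF \<open>e summable_on J\<close>]) (use dist in auto)
  moreover have "g x - g (\<mu> j) \<le> f' j * (x - \<mu> j)" if "j \<in> J" "x \<in> S" for j x
  proof -
    have "g x \<le> g (\<mu> j) + f' j * (x - \<mu> j)"
      by (rule g) (use that S f'_lo[of _ j] f'_hi[of _ j] in \<open>auto simp: P_def Q_def N_def\<close>)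
    then show ?thesis by simp
  qed
  moreover have "f' j \<le> c s" if "j \<in> J" "s \<in> S" "s < \<mu> j" for j s
    using f'_hi[of s j] d_le[of s s] that by (auto simp: P_def)
  ultimately show ?thesis by (intro exI[of _ f'] exI[of _ g]) auto
qed

section \<open>Orbits of coordinate families\<close>

text \<open>A sign change at \<open>j\<close> is the move with \<open>k = j\<close> and \<open>t = -1\<close>.\<close>

definition swap_move :: "'j \<Rightarrow> 'j \<Rightarrow> real \<Rightarrow> ('j \<Rightarrow> real) \<Rightarrow> 'j \<Rightarrow> real" where
  "swap_move j k t \<nu> = \<nu> (j := t * \<nu> k, k := t * \<nu> j)"

text \<open>A triple stands for the reflection in a multiple of \<epsilon>_j - t \<epsilon>_k; the
  diagonal triples, present only in types B and C, are the reflections in multiples of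
  \<epsilon>_j.\<close>

definition moves :: "root_type \<Rightarrow> 'j set \<Rightarrow> ('j \<times> 'j \<times> real) set" where
  "moves T J = {(j, k, t). j \<in> J \<and> k \<in> J \<and> (t = 1 \<or> t = - 1) \<and>
     (if j = k then t = - 1 \<and> (T = Type_B \<or> T = Type_C) else T = Type_A \<longrightarrow> t = 1)}"

inductive_set coordinate_orbit :: "root_type \<Rightarrow> 'j set \<Rightarrow> ('j \<Rightarrow> real) \<Rightarrow> ('j \<Rightarrow> real) set"
  for T J l where
  base: "l \<in> coordinate_orbit T J l"
| move: "\<nu> \<in> coordinate_orbit T J l \<Longrightarrow> (j, k, t) \<in> moves T J \<Longrightarrow> swap_move j k t \<nu> \<in> coordinate_orbit T J l"

text \<open>Only changed indices are summed, so the sum is finite on an orbit although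
  \<open>J\<close> may be infinite. The target group is left open because the same bookkeeping
  serves characters, the potential \<open>g\<close> and complex functionals.\<close>

definition total_change :: "('j \<Rightarrow> real \<Rightarrow> 'b) \<Rightarrow> ('j \<Rightarrow> real) \<Rightarrow> ('j \<Rightarrow> real) \<Rightarrow> 'b::ab_group_add" where
  "total_change \<phi> l \<nu> = (\<Sum>j | \<nu> j \<noteq> l j. \<phi> j (\<nu> j) - \<phi> j (l j))"

abbreviation linear_change :: "('j \<Rightarrow> real) \<Rightarrow> ('j \<Rightarrow> real) \<Rightarrow> ('j \<Rightarrow> real) \<Rightarrow> real" where
  "linear_change d \<equiv> total_change (\<lambda>j x. d j * x)"

lemma total_change_superset:
  assumes "finite F" "{j. \<nu> j \<noteq> l j} \<subseteq> F"
  shows "total_change \<phi> l \<nu> = (\<Sum>j\<in>F. \<phi> j (\<nu> j) - \<phi> j (l j))"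
  unfolding total_change_def by (rule sum.mono_neutral_left) (use assms in auto)

lemma total_change_refl [simp]: "total_change \<phi> l l = 0"
  by (simp add: total_change_def)

lemma total_change_upd:
  assumes "finite {j. \<nu> j \<noteq> l j}"
  shows "total_change \<phi> l (\<nu> (j := x)) = total_change \<phi> l \<nu> + \<phi> j x - \<phi> j (\<nu> j)"
proof -
  let ?F = "insert j {j. \<nu> j \<noteq> l j}"
  have "total_change \<phi> l (\<nu> (j := x)) = (\<Sum>i\<in>?F. \<phi> i ((\<nu> (j := x)) i) - \<phi> i (l i))"
    using assms by (intro total_change_superset) auto
  also have "\<dots> = \<phi> j x - \<phi> j (l j) + (\<Sum>i\<in>?F - {j}. \<phi> i (\<nu> i) - \<phi> i (l i))"
    using assms by (subst sum.remove[of _ j]) (auto intro!: sum.cong)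
  also have "(\<Sum>i\<in>?F - {j}. \<phi> i (\<nu> i) - \<phi> i (l i)) =
      (\<Sum>i\<in>?F. \<phi> i (\<nu> i) - \<phi> i (l i)) - (\<phi> j (\<nu> j) - \<phi> j (l j))"
    using assms by (subst sum.remove[of ?F j]) auto
  also have "(\<Sum>i\<in>?F. \<phi> i (\<nu> i) - \<phi> i (l i)) = total_change \<phi> l \<nu>"
    using assms by (intro total_change_superset[symmetric]) auto
  finally show ?thesis by (rule trans) (simp add: algebra_simps)
qed

lemma finite_support_upd:
  "finite {j. \<nu> j \<noteq> l j} \<Longrightarrow> finite {i. (\<nu> (j := x)) i \<noteq> l i}"
  by (rule finite_subset[of _ "insert j {j. \<nu> j \<noteq> l j}"]) auto

lemma total_change_upd2:
  assumes "finite {j. \<nu> j \<noteq> l j}" "j \<noteq> k"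
  shows "total_change \<phi> l (\<nu> (j := x, k := y)) =
    total_change \<phi> l \<nu> + \<phi> j x - \<phi> j (\<nu> j) + \<phi> k y - \<phi> k (\<nu> k)"
proof -
  have "total_change \<phi> l (\<nu> (j := x, k := y)) =
      total_change \<phi> l (\<nu> (j := x)) + \<phi> k y - \<phi> k ((\<nu> (j := x)) k)"
    by (rule total_change_upd[OF finite_support_upd[OF assms(1)]])
  moreover have "(\<nu> (j := x)) k = \<nu> k" using assms(2) by simp
  ultimately show ?thesis unfolding total_change_upd[OF assms(1)] by simp
qed

lemma total_change_move:
  assumes "finite {j. \<nu> j \<noteq> l j}"
  shows "total_change \<phi> l (swap_move j k t \<nu>) = total_change \<phi> l \<nu> +
    (if j = k then \<phi> j (t * \<nu> j) - \<phi> j (\<nu> j)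
     else \<phi> j (t * \<nu> k) - \<phi> j (\<nu> j) + \<phi> k (t * \<nu> j) - \<phi> k (\<nu> k))"
  by (cases "j = k") (simp_all add: swap_move_def total_change_upd[OF assms] total_change_upd2[OF assms])

lemma finite_support_move:
  "finite {j. \<nu> j \<noteq> l j} \<Longrightarrow> finite {i. swap_move j k t \<nu> i \<noteq> l i}"
  unfolding swap_move_def by (intro finite_support_upd)

lemma coordinate_orbit_support:
  assumes "\<nu> \<in> coordinate_orbit T J l"
  shows "finite {j. \<nu> j \<noteq> l j}" "{j. \<nu> j \<noteq> l j} \<subseteq> J"
proof -
  show "finite {j. \<nu> j \<noteq> l j}"
    using assms by induction (auto intro: finite_support_move)
  show "{j. \<nu> j \<noteq> l j} \<subseteq> J"
    using assms by induction (auto simp: swap_move_def moves_def split: if_splits)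
qed

lemma coordinate_orbit_values:
  assumes "\<nu> \<in> coordinate_orbit T J l" "j \<in> J"
  shows "\<exists>k\<in>J. \<nu> j = l k \<or> T \<noteq> Type_A \<and> \<nu> j = - l k"
  using assms
proof (induction arbitrary: j)
  case base then show ?case by auto
next
  case (move \<nu> j' k t)
  have "\<exists>i\<in>J. swap_move j' k t \<nu> j = \<nu> i \<or> T \<noteq> Type_A \<and> swap_move j' k t \<nu> j = - \<nu> i"
    using move.hyps(2) move.prems by (auto simp: swap_move_def moves_def split: if_splits)
  then show ?case using move.IH by fastforce
qed

lemma coordinate_orbit_invariant:
  assumes "\<nu> \<in> coordinate_orbit T J l" and "T \<noteq> Type_A \<Longrightarrow> (\<And>x. g (- x) = g x)"
  shows "total_change (\<lambda>j. g) l \<nu> = 0"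
  using assms(1)
proof induction
  case base then show ?case by simp
next
  case (move \<nu> j k t)
  have "g (t * x) = g x" for x using assms(2) move.hyps(2) by (auto simp: moves_def split: if_splits)
  then show ?case using move by (simp add: total_change_move coordinate_orbit_support)
qed

text \<open>The slopes of \<open>d\<close> are supergradients of \<open>g\<close>, and the total of \<open>g\<close> does not change along
  the orbit.\<close>

lemma linear_change_nonneg:
  assumes \<nu>: "\<nu> \<in> coordinate_orbit T J l" and even: "T \<noteq> Type_A \<Longrightarrow> (\<And>x. g (- x) = g x)"
    and g: "\<And>j k. j \<in> J \<Longrightarrow> k \<in> J \<Longrightarrow> g (l k) - g (l j) \<le> d j * (l k - l j)"
    and g': "\<And>j k. j \<in> J \<Longrightarrow> k \<in> J \<Longrightarrow> T \<noteq> Type_A \<Longrightarrow> g (- l k) - g (l j) \<le> d j * (- l k - l j)"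
  shows "0 \<le> linear_change d l \<nu>"
proof -
  have "g (\<nu> j) - g (l j) \<le> d j * \<nu> j - d j * l j" if "j \<in> J" for j
    using coordinate_orbit_values[OF \<nu> that] g[OF that] g'[OF that] by (auto simp: right_diff_distrib)
  then have "total_change (\<lambda>j. g) l \<nu> \<le> linear_change d l \<nu>"
    unfolding total_change_def using coordinate_orbit_support[OF \<nu>] by (intro sum_mono) auto
  then show ?thesis using coordinate_orbit_invariant[where g = g, OF \<nu> even] by simp
qed

text \<open>Coordinates of orbit members are values of \<open>l\<close> up to sign, so each moves by
  at most \<open>2 * M\<close>. This is where boundedness of the weight makes a summable character
  harmless.\<close>

lemma linear_change_summable_bound:
  assumes \<nu>: "\<nu> \<in> coordinate_orbit T J l" and M: "\<And>j. j \<in> J \<Longrightarrow> \<bar>l j\<bar> \<le> M"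
    and d: "(\<lambda>j. \<bar>d j\<bar>) summable_on J"
  shows "\<bar>linear_change d l \<nu>\<bar> \<le> 2 * M * infsum (\<lambda>j. \<bar>d j\<bar>) J"
proof -
  let ?F = "{j. \<nu> j \<noteq> l j}"
  note F = coordinate_orbit_support[OF \<nu>]
  have M': "\<bar>\<nu> j\<bar> \<le> M" if "j \<in> J" for j
    using coordinate_orbit_values[OF \<nu> that] M by auto
  show ?thesis
  proof (cases "?F = {}")
    case True
    have "0 \<le> infsum (\<lambda>j. \<bar>d j\<bar>) J" by (rule infsum_nonneg) auto
    \<comment> \<open>\<open>M\<close> can be negative only for empty \<open>J\<close>, and then the
      infinite sum is 0.\<close>
    moreover have "0 \<le> M \<or> J = {}" using M by force
    ultimately show ?thesis using True unfolding total_change_def by auto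
  next
    case False
    then have M0: "0 \<le> M" using F M by force
    have "\<bar>linear_change d l \<nu>\<bar> \<le> (\<Sum>j\<in>?F. \<bar>d j * \<nu> j - d j * l j\<bar>)"
      unfolding total_change_def by (rule sum_abs)
    also have "\<dots> \<le> (\<Sum>j\<in>?F. 2 * M * \<bar>d j\<bar>)"
    proof (rule sum_mono)
      fix j assume "j \<in> ?F"
      then have "j \<in> J" using F by auto
      then have "\<bar>\<nu> j - l j\<bar> \<le> 2 * M" using M[of j] M'[of j] by simp
      then have "\<bar>\<nu> j - l j\<bar> * \<bar>d j\<bar> \<le> 2 * M * \<bar>d j\<bar>" by (intro mult_right_mono) auto
      moreover have "\<bar>d j * \<nu> j - d j * l j\<bar> = \<bar>\<nu> j - l j\<bar> * \<bar>d j\<bar>"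
        by (metis abs_mult mult.commute right_diff_distrib)
      ultimately show "\<bar>d j * \<nu> j - d j * l j\<bar> \<le> 2 * M * \<bar>d j\<bar>" by simp
    qed
    also have "\<dots> = 2 * M * (\<Sum>j\<in>?F. \<bar>d j\<bar>)" by (simp add: sum_distrib_left)
    also have "\<dots> \<le> 2 * M * infsum (\<lambda>j. \<bar>d j\<bar>) J"
      using M0 by (intro mult_left_mono finite_sum_le_infsum d F) auto
    finally show ?thesis .
  qed
qed

text \<open>In the normalised coordinates \<open>a j * l j\<close> and \<open>a j * d j\<close> the
  move with sign \<open>a j * a (p j)\<close> is a plain transposition, and exchanging two entries
  changes the pairing by minus the product of the two differences. The pairs are disjoint, so these
  changes add up.\<close>

lemma orbit_pair_bound:
  assumes C: "\<And>\<nu>. \<nu> \<in> coordinate_orbit T J l \<Longrightarrow> - C \<le> linear_change d l \<nu>"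
    and a: "\<And>j. a j = 1 \<or> a j = - 1" "\<And>j. T = Type_A \<Longrightarrow> a j = 1"
    and F: "finite F" "F \<subseteq> J" "inj_on p F" "p ` F \<subseteq> J" "F \<inter> p ` F = {}"
  shows "(\<Sum>j\<in>F. (a (p j) * d (p j) - a j * d j) * (a (p j) * l (p j) - a j * l j)) \<le> C"
proof -
  have "\<exists>\<nu>\<in>coordinate_orbit T J l. {j. \<nu> j \<noteq> l j} \<subseteq> F \<union> p ` F \<and>
    linear_change d l \<nu> = - (\<Sum>j\<in>F. (a (p j) * d (p j) - a j * d j) * (a (p j) * l (p j) - a j * l j))"
    using F
  proof (induction F rule: finite_induct)
    case empty
    show ?case by (intro bexI[OF _ coordinate_orbit.base]) auto
  next
    case (insert j F)
    have "\<exists>\<nu>\<in>coordinate_orbit T J l. {j. \<nu> j \<noteq> l j} \<subseteq> F \<union> p ` F \<and>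
      linear_change d l \<nu> = - (\<Sum>j\<in>F. (a (p j) * d (p j) - a j * d j) * (a (p j) * l (p j) - a j * l j))"
      using insert.prems by (intro insert.IH) auto
    then obtain \<nu> where \<nu>: "\<nu> \<in> coordinate_orbit T J l" "{j. \<nu> j \<noteq> l j} \<subseteq> F \<union> p ` F"
      "linear_change d l \<nu> = - (\<Sum>j\<in>F. (a (p j) * d (p j) - a j * d j) * (a (p j) * l (p j) - a j * l j))"
      by blast
    have jp: "j \<noteq> p j" "j \<in> J" "p j \<in> J" using insert.prems by auto
    have unch: "\<nu> j = l j" "\<nu> (p j) = l (p j)" using \<nu>(2) insert.prems insert.hyps by auto
    let ?t = "a j * a (p j)"
    have "?t = 1 \<or> ?t = -1" using a(1)[of j] a(1)[of "p j"] by auto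
    then have mv: "(j, p j, ?t) \<in> moves T J" using jp a(2) by (auto simp: moves_def)
    have "linear_change d l (swap_move j (p j) ?t \<nu>) = linear_change d l \<nu> +
      (d j * (?t * l (p j)) - d j * l j + d (p j) * (?t * l j) - d (p j) * l (p j))"
      unfolding total_change_move[OF coordinate_orbit_support(1)[OF \<nu>(1)]] using jp(1) by (simp add: unch)
    also have "d j * (?t * l (p j)) - d j * l j + d (p j) * (?t * l j) - d (p j) * l (p j) =
      - ((a (p j) * d (p j) - a j * d j) * (a (p j) * l (p j) - a j * l j))"
      using a(1)[of j] a(1)[of "p j"] by (auto simp: algebra_simps)
    finally have "linear_change d l (swap_move j (p j) ?t \<nu>) = linear_change d l \<nu> -
      (a (p j) * d (p j) - a j * d j) * (a (p j) * l (p j) - a j * l j)" by simp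
    moreover have "{i. swap_move j (p j) ?t \<nu> i \<noteq> l i} \<subseteq> insert j F \<union> p ` insert j F"
      using \<nu>(2) by (auto simp: swap_move_def)
    ultimately show ?case using insert.hyps \<nu>(3)
      by (intro bexI[OF _ coordinate_orbit.move[OF \<nu>(1) mv]]) simp
  qed
  then show ?thesis using C by fastforce
qed

text \<open>In type \<open>D\<close> signs can only be changed in pairs, so the index \<open>k\<close> absorbs the parity.\<close>

lemma orbit_sign_bound:
  assumes C: "\<And>\<nu>. \<nu> \<in> coordinate_orbit T J l \<Longrightarrow> - C \<le> linear_change d l \<nu>"
    and T: "T \<noteq> Type_A" and F: "finite F" "F \<subseteq> J" "k \<in> J" "k \<notin> F"
  shows "2 * (\<Sum>j\<in>F. d j * l j) \<le> C + 2 * \<bar>d k * l k\<bar>"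
proof -
  have "\<exists>\<nu>\<in>coordinate_orbit T J l. {j. \<nu> j \<noteq> l j} \<subseteq> insert k F \<and> (\<nu> k = l k \<or> \<nu> k = - l k) \<and>
    linear_change d l \<nu> = - 2 * (\<Sum>j\<in>F. d j * l j) + d k * (\<nu> k - l k)"
    using F
  proof (induction F rule: finite_induct)
    case empty
    show ?case by (intro bexI[OF _ coordinate_orbit.base]) auto
  next
    case (insert j F)
    have "\<exists>\<nu>\<in>coordinate_orbit T J l. {j. \<nu> j \<noteq> l j} \<subseteq> insert k F \<and> (\<nu> k = l k \<or> \<nu> k = - l k) \<and>
      linear_change d l \<nu> = - 2 * (\<Sum>j\<in>F. d j * l j) + d k * (\<nu> k - l k)"
      using insert.prems by (intro insert.IH) auto
    then obtain \<nu> where \<nu>: "\<nu> \<in> coordinate_orbit T J l" "{j. \<nu> j \<noteq> l j} \<subseteq> insert k F"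
      "\<nu> k = l k \<or> \<nu> k = - l k"
      "linear_change d l \<nu> = - 2 * (\<Sum>j\<in>F. d j * l j) + d k * (\<nu> k - l k)"
      by blast
    have jk: "j \<noteq> k" "j \<in> J" using insert.prems by auto
    have unch: "\<nu> j = l j" using \<nu>(2) insert.hyps jk by auto
    have mv: "(j, k, 1) \<in> moves T J" "(j, k, -1) \<in> moves T J" using jk T insert.prems by (auto simp: moves_def)
    \<comment> \<open>The reflections in \<epsilon>_j - \<epsilon>_k and \<epsilon>_j + \<epsilon>_k
      compose to the simultaneous sign change at \<open>j\<close> and \<open>k\<close>, which is
      available in types B, C and D alike.\<close>
    define \<nu>' where "\<nu>' = \<nu> (j := - \<nu> j, k := - \<nu> k)"
    have "swap_move j k (-1) (swap_move j k 1 \<nu>) = \<nu>'"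
      using jk by (auto simp: swap_move_def \<nu>'_def fun_eq_iff)
    then have \<nu>': "\<nu>' \<in> coordinate_orbit T J l"
      using coordinate_orbit.move[OF coordinate_orbit.move[OF \<nu>(1) mv(1)] mv(2)] by simp
    have "linear_change d l \<nu>' = linear_change d l \<nu> - 2 * (d j * l j) - 2 * (d k * \<nu> k)"
      unfolding \<nu>'_def total_change_upd2[OF coordinate_orbit_support(1)[OF \<nu>(1)] jk(1)] unch by simp
    then have "linear_change d l \<nu>' = - 2 * (\<Sum>j\<in>insert j F. d j * l j) + d k * (\<nu>' k - l k)"
      using \<nu>(4) insert.hyps by (simp add: \<nu>'_def algebra_simps)
    moreover have "\<nu>' k = l k \<or> \<nu>' k = - l k" using \<nu>(3) by (auto simp: \<nu>'_def)
    moreover have "{i. \<nu>' i \<noteq> l i} \<subseteq> insert k (insert j F)"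
      using \<nu>(2) by (auto simp: \<nu>'_def)
    ultimately show ?case using \<nu>' by blast
  qed
  then obtain \<nu> where \<nu>: "\<nu> \<in> coordinate_orbit T J l" "\<nu> k = l k \<or> \<nu> k = - l k"
    "linear_change d l \<nu> = - 2 * (\<Sum>j\<in>F. d j * l j) + d k * (\<nu> k - l k)" by blast
  have "d k * (\<nu> k - l k) \<le> 2 * \<bar>d k * l k\<bar>"
    using \<nu>(2) by (auto simp: algebra_simps abs_if)
  then show ?thesis using C[OF \<nu>(1)] \<nu>(3) by simp
qed

section \<open>From bounds on the orbit to the minimal decomposition\<close>

lemma finite_set_gap:
  fixes S :: "real set"
  assumes "finite S"
  shows "\<exists>\<delta>>0. \<forall>x\<in>S. \<forall>y\<in>S. x < y \<longrightarrow> \<delta> \<le> y - x"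
proof -
  define D where "D = {y - x |x y. x \<in> S \<and> y \<in> S \<and> x < y}"
  have "finite D"
    by (rule finite_subset[of _ "(\<lambda>(x, y). y - x) ` (S \<times> S)"]) (use assms in \<open>auto simp: D_def\<close>)
  \<comment> \<open>The inserted 1 keeps the minimum defined when no two points differ.\<close>
  then have "\<forall>x\<in>D. Min (insert 1 D) \<le> x" "0 < Min (insert 1 D)"
    by (auto simp: D_def)
  then show ?thesis unfolding D_def by blast
qed

text \<open>\<open>orbit_pair_bound\<close> controls products of differences; the gap \<delta>
  between the finitely many possible values \<open>a j * l j\<close> turns this into the bound
  \<open>C / \<delta>\<close> for the differences of \<open>a j * d j\<close> alone, which is what
  \<open>exists_threshold\<close> asks for.\<close>

lemma orbit_threshold:
  assumes C: "\<And>\<nu>. \<nu> \<in> coordinate_orbit T J l \<Longrightarrow> - C \<le> linear_change d l \<nu>"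
    and a: "\<And>j. a j = 1 \<or> a j = - 1" "\<And>j. T = Type_A \<Longrightarrow> a j = 1"
    and fin: "finite (l ` J)" and s: "i \<in> J" "a i * l i \<le> s" "k \<in> J" "s < a k * l k"
  shows "\<exists>c. (\<lambda>j. max 0 (c - a j * d j)) summable_on {j\<in>J. a j * l j \<le> s} \<and>
    (\<lambda>j. max 0 (a j * d j - c)) summable_on {j\<in>J. s < a j * l j}"
proof -
  define S where "S = l ` J \<union> uminus ` l ` J"
  have "finite S" using fin by (simp add: S_def)
  then obtain \<delta> where \<delta>: "\<delta> > 0" "\<forall>x\<in>S. \<forall>y\<in>S. x < y \<longrightarrow> \<delta> \<le> y - x"
    using finite_set_gap[of S] by auto
  have inS: "a j * l j \<in> S" if "j \<in> J" for j using a(1)[of j] that by (auto simp: S_def)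
  show ?thesis
  proof (rule exists_threshold)
    show "{j\<in>J. a j * l j \<le> s} \<noteq> {}" "{j\<in>J. s < a j * l j} \<noteq> {}" using s by auto
    fix F p assume F: "finite F" "F \<subseteq> {j\<in>J. a j * l j \<le> s}" "inj_on p F" "p ` F \<subseteq> {j\<in>J. s < a j * l j}"
    define x where "x j = a (p j) * d (p j) - a j * d j" for j
    \<comment> \<open>Pairs with \<open>x j \<le> 0\<close> are left unswapped: for them the factor
      cannot be replaced by the smaller \<delta>, and dropping them only increases the sum.\<close>
    define F' where "F' = {j\<in>F. x j > 0}"
    have "\<delta> * (\<Sum>j\<in>F. x j) \<le> \<delta> * (\<Sum>j\<in>F'. x j)"
    proof (intro mult_left_mono)
      have "sum x F = sum x F' + sum x (F - F')"
        using sum.subset_diff[of F' F x] F(1) by (auto simp: F'_def)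
      moreover have "sum x (F - F') \<le> 0" by (intro sum_nonpos) (auto simp: F'_def)
      ultimately show "sum x F \<le> sum x F'" by simp
    qed (use \<delta> in auto)
    also have "\<dots> = (\<Sum>j\<in>F'. x j * \<delta>)" by (simp add: sum_distrib_left mult.commute)
    also have "\<dots> \<le> (\<Sum>j\<in>F'. x j * (a (p j) * l (p j) - a j * l j))"
    proof (rule sum_mono)
      fix j assume "j \<in> F'"
      then have j: "j \<in> F" "0 < x j" by (auto simp: F'_def)
      then have "a j * l j < a (p j) * l (p j)" "j \<in> J" "p j \<in> J" using F by force+
      then have "\<delta> \<le> a (p j) * l (p j) - a j * l j" using \<delta>(2) inS by blast
      then show "x j * \<delta> \<le> x j * (a (p j) * l (p j) - a j * l j)" using j by (intro mult_left_mono) auto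
    qed
    also have "\<dots> \<le> C"
      unfolding x_def
    proof (rule orbit_pair_bound[OF C a])
      show "finite F'" "F' \<subseteq> J" "inj_on p F'" "p ` F' \<subseteq> J"
        using F by (auto simp: F'_def inj_on_def)
      show "F' \<inter> p ` F' = {}" using F by (fastforce simp: F'_def)
    qed
    finally show "(\<Sum>j\<in>F. a (p j) * d (p j) - a j * d j) \<le> C / \<delta>"
      using \<delta>(1) by (simp add: x_def field_simps)
  qed
qed

lemma minimal_decomposition_A:
  assumes C: "\<And>\<nu>. \<nu> \<in> coordinate_orbit Type_A J l \<Longrightarrow> - C \<le> linear_change d l \<nu>"
    and fin: "finite (l ` J)"
  shows "\<exists>d'. (\<lambda>j. \<bar>d j - d' j\<bar>) summable_on J \<and>
    (\<forall>\<nu>\<in>coordinate_orbit Type_A J l. 0 \<le> linear_change d' l \<nu>)"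
proof -
  \<comment> \<open>At the largest value of \<open>l\<close> the condition is vacuous, so a
    threshold can be chosen for every value.\<close>
  have "\<exists>c. \<forall>s'\<in>l ` J. s < s' \<longrightarrow> (\<lambda>j. max 0 (c - d j)) summable_on {j\<in>J. l j \<le> s} \<and>
    (\<lambda>j. max 0 (d j - c)) summable_on {j\<in>J. s < l j}" if s: "s \<in> l ` J" for s
  proof (cases "\<exists>s'\<in>l ` J. s < s'")
    case True
    then obtain j0 k0 where "j0 \<in> J" "l j0 = s" "k0 \<in> J" "s < l k0" using s by auto
    then have "\<exists>c. (\<lambda>j. max 0 (c - d j)) summable_on {j\<in>J. l j \<le> s} \<and>
      (\<lambda>j. max 0 (d j - c)) summable_on {j\<in>J. s < l j}"
      using orbit_threshold[where a="\<lambda>_. 1" and i = j0 and s = s and k = k0, OF C _ _ fin] by simp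
    then show ?thesis by blast
  qed blast
  then have "\<exists>c. \<forall>s\<in>l ` J. \<forall>s'\<in>l ` J. s < s' \<longrightarrow> (\<lambda>j. max 0 (c s - d j)) summable_on {j\<in>J. l j \<le> s} \<and>
    (\<lambda>j. max 0 (d j - c s)) summable_on {j\<in>J. s < l j}"
    by (intro bchoice) blast
  then obtain c where c: "\<forall>s\<in>l ` J. \<forall>s'\<in>l ` J. s < s' \<longrightarrow> (\<lambda>j. max 0 (c s - d j)) summable_on {j\<in>J. l j \<le> s} \<and>
    (\<lambda>j. max 0 (d j - c s)) summable_on {j\<in>J. s < l j}" ..
  have "\<exists>d' g. (\<lambda>j. \<bar>d j - d' j\<bar>) summable_on J \<and>
    (\<forall>j\<in>J. \<forall>x\<in>l ` J. g x - g (l j) \<le> d' j * (x - l j)) \<and>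
    (\<forall>j\<in>J. \<forall>s\<in>l ` J. s < l j \<longrightarrow> d' j \<le> c s)"
    by (rule minimal_part_exists) (use fin c in auto)
  then obtain d' g where d': "(\<lambda>j. \<bar>d j - d' j\<bar>) summable_on J"
    "\<forall>j\<in>J. \<forall>x\<in>l ` J. g x - g (l j) \<le> d' j * (x - l j)"
    by (elim exE conjE) (rule that)
  show ?thesis
  proof (intro exI[of _ d'] conjI d'(1) ballI)
    fix \<nu> assume "\<nu> \<in> coordinate_orbit Type_A J l"
    then show "0 \<le> linear_change d' l \<nu>"
      by (rule linear_change_nonneg[where g=g]) (simp_all add: d'(2))
  qed
qed

text \<open>Sign changes ask for more than thresholds. With \<open>a\<close> normalising
  \<open>l\<close> to its absolute value, a flip at \<open>j\<close> changes the pairing by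
  \<open>- 2 * (d j * l j)\<close>, so \<open>a j * d j\<close> has to be nonpositive up to a
  summable error. Nonpositive slopes in turn extend the supergradient inequality from absolute
  values to all signed values.\<close>

lemma minimal_decomposition_signed:
  assumes C: "\<And>\<nu>. \<nu> \<in> coordinate_orbit T J l \<Longrightarrow> - C \<le> linear_change d l \<nu>"
    and T: "T \<noteq> Type_A" and fin: "finite (l ` J)"
  shows "\<exists>d'. (\<lambda>j. \<bar>d j - d' j\<bar>) summable_on J \<and>
    (\<forall>\<nu>\<in>coordinate_orbit T J l. 0 \<le> linear_change d' l \<nu>)"
proof -
  \<comment> \<open>Where \<open>l j = 0\<close> the sign is free and is chosen such that
    \<open>a j * d j \<le> 0\<close>; a positive \<open>a j * d j\<close> then occurs only where
    \<open>\<bar>l j\<bar>\<close> is at least the gap \<delta>.\<close>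
  define a :: "_ \<Rightarrow> real" where
    "a j = (if l j > 0 then 1 else if l j < 0 then -1 else if d j > 0 then -1 else 1)" for j
  have a: "a j = 1 \<or> a j = -1" for j by (simp add: a_def)
  have al: "a j * l j = \<bar>l j\<bar>" for j by (auto simp: a_def)
  have ad0: "a j * d j \<le> 0" if "l j = 0" for j using that by (auto simp: a_def)
  have aa: "a j * (a j * x) = x" for j x using a[of j] by auto
  have C0: "0 \<le> C" using C[OF coordinate_orbit.base] by simp
  \<comment> \<open>The artificial value -1 lies below every \<open>\<bar>l j\<bar>\<close>. It will
    get the threshold 0, so that clamping from above at -1 amounts to nonpositive slopes.\<close>
  define S where "S = insert (-1) ((\<lambda>j. \<bar>l j\<bar>) ` J)"
  have finabs: "finite ((\<lambda>j. \<bar>l j\<bar>) ` J)" using finite_imageI[OF fin, of abs] by (simp add: image_image)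
  have "finite (insert 0 S)" using finabs by (simp add: S_def)
  then obtain \<delta> where \<delta>: "\<delta> > 0" "\<forall>x\<in>insert 0 S. \<forall>y\<in>insert 0 S. x < y \<longrightarrow> \<delta> \<le> y - x"
    using finite_set_gap[of "insert 0 S"] by metis
  have pos: "(\<lambda>j. max 0 (a j * d j)) summable_on J"
  proof (cases "J = {}")
    case True then show ?thesis by simp
  next
    case False
    then obtain k where k: "k \<in> J" by auto
    \<comment> \<open>\<open>orbit_sign_bound\<close> needs a spare index \<open>k\<close>, whose
      own term is at most \<open>\<bar>d k\<bar>\<close>; the other summand is half of that bound
      divided by the gap.\<close>
    define B where "B = (C / 2 + \<bar>d k * l k\<bar>) / \<delta> + \<bar>d k\<bar>"
    show ?thesis
    proof (rule nonneg_bounded_partial_sums_imp_summable_on)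
      show "\<forall>\<^sub>F F in finite_subsets_at_top J. (\<Sum>j\<in>F. max 0 (a j * d j)) \<le> B"
      proof (rule eventually_finite_subsets_at_top_weakI)
        fix F assume F: "finite F" "F \<subseteq> J"
        define F' where "F' = {j\<in>F - {k}. a j * d j > 0}"
        have F': "finite F'" "F' \<subseteq> J" "k \<notin> F'" using F by (auto simp: F'_def)
        have le: "a j * d j * \<delta> \<le> d j * l j" if "j \<in> F'" for j
        proof -
          have j: "j \<in> J" "a j * d j > 0" using that F by (auto simp: F'_def)
          then have "l j \<noteq> 0" using ad0[of j] by linarith
          then have "\<delta> \<le> \<bar>l j\<bar>" using bspec[OF bspec[OF \<delta>(2), of 0], of "\<bar>l j\<bar>"] j by (auto simp: S_def)
          then have "a j * d j * \<delta> \<le> a j * d j * (a j * l j)"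
            unfolding al using j by (intro mult_left_mono) auto
          also have "\<dots> = d j * l j" using a[of j] by auto
          finally show ?thesis .
        qed
        have "(\<Sum>j\<in>F. max 0 (a j * d j)) \<le> (\<Sum>j\<in>insert k F. max 0 (a j * d j))"
          using F by (intro sum_mono2) auto
        also have "\<dots> = max 0 (a k * d k) + (\<Sum>j\<in>F - {k}. max 0 (a j * d j))"
          using F by (simp add: sum.insert_remove)
        also have "(\<Sum>j\<in>F - {k}. max 0 (a j * d j)) = (\<Sum>j\<in>F'. a j * d j)"
          using F(1) by (intro sum.mono_neutral_cong_right) (auto simp: F'_def)
        also have "max 0 (a k * d k) \<le> \<bar>d k\<bar>" using a[of k] by auto
        also have "(\<Sum>j\<in>F'. a j * d j) \<le> (C / 2 + \<bar>d k * l k\<bar>) / \<delta>"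
        proof -
          have "(\<Sum>j\<in>F'. a j * d j) * \<delta> \<le> (\<Sum>j\<in>F'. d j * l j)"
            unfolding sum_distrib_right using le by (intro sum_mono) auto
          also have "\<dots> \<le> C / 2 + \<bar>d k * l k\<bar>" using orbit_sign_bound[OF C T F'(1,2) k F'(3)] by simp
          finally show ?thesis using \<delta>(1) by (simp add: field_simps)
        qed
        finally show "(\<Sum>j\<in>F. max 0 (a j * d j)) \<le> B" by (simp add: B_def)
      qed
    qed auto
  qed
  have "\<exists>c. (s = -1 \<longrightarrow> c = 0) \<and> (\<forall>s'\<in>S. s < s' \<longrightarrow> (\<lambda>j. max 0 (c - a j * d j)) summable_on {j\<in>J. \<bar>l j\<bar> \<le> s} \<and>
    (\<lambda>j. max 0 (a j * d j - c)) summable_on {j\<in>J. s < \<bar>l j\<bar>})" if s: "s \<in> S" for s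
  proof (cases "s = -1")
    case True
    have "{j\<in>J. \<bar>l j\<bar> \<le> s} = {}" "{j\<in>J. s < \<bar>l j\<bar>} = J" using True by auto
    then show ?thesis using pos by (intro exI[of _ 0]) (simp only: summable_on_empty, simp)
  next
    case False
    show ?thesis
    proof (cases "\<exists>s'\<in>S. s < s'")
      case True
      then obtain s' where s': "s' \<in> S" "s < s'" by blast
      obtain j0 where j0: "j0 \<in> J" "\<bar>l j0\<bar> = s" using s False by (auto simp: S_def)
      then obtain k0 where "k0 \<in> J" "\<bar>l k0\<bar> = s'" using s' by (auto simp: S_def)
      then have "\<exists>c. (\<lambda>j. max 0 (c - a j * d j)) summable_on {j\<in>J. \<bar>l j\<bar> \<le> s} \<and>
        (\<lambda>j. max 0 (a j * d j - c)) summable_on {j\<in>J. s < \<bar>l j\<bar>}"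
        using orbit_threshold[where a = a and T = T and i = j0 and s = s and k = k0, OF C a _ fin] T s' j0 by (simp add: al)
      then show ?thesis using False by blast
    qed (use False in blast)
  qed
  then have "\<exists>c. \<forall>s\<in>S. (s = -1 \<longrightarrow> c s = 0) \<and> (\<forall>s'\<in>S. s < s' \<longrightarrow>
    (\<lambda>j. max 0 (c s - a j * d j)) summable_on {j\<in>J. \<bar>l j\<bar> \<le> s} \<and>
    (\<lambda>j. max 0 (a j * d j - c s)) summable_on {j\<in>J. s < \<bar>l j\<bar>})"
    by (intro bchoice) blast
  then obtain c where c: "\<forall>s\<in>S. (s = -1 \<longrightarrow> c s = 0) \<and> (\<forall>s'\<in>S. s < s' \<longrightarrow>
    (\<lambda>j. max 0 (c s - a j * d j)) summable_on {j\<in>J. \<bar>l j\<bar> \<le> s} \<and>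
    (\<lambda>j. max 0 (a j * d j - c s)) summable_on {j\<in>J. s < \<bar>l j\<bar>})" ..
  have "\<exists>f' g. (\<lambda>j. \<bar>a j * d j - f' j\<bar>) summable_on J \<and>
    (\<forall>j\<in>J. \<forall>x\<in>S. g x - g \<bar>l j\<bar> \<le> f' j * (x - \<bar>l j\<bar>)) \<and>
    (\<forall>j\<in>J. \<forall>s\<in>S. s < \<bar>l j\<bar> \<longrightarrow> f' j \<le> c s)"
    by (rule minimal_part_exists) (use finabs c in \<open>auto simp: S_def\<close>)
  then obtain f' g where f': "(\<lambda>j. \<bar>a j * d j - f' j\<bar>) summable_on J"
    "\<And>j x. j \<in> J \<Longrightarrow> x \<in> S \<Longrightarrow> g x - g \<bar>l j\<bar> \<le> f' j * (x - \<bar>l j\<bar>)"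
    "\<And>j s. j \<in> J \<Longrightarrow> s \<in> S \<Longrightarrow> s < \<bar>l j\<bar> \<Longrightarrow> f' j \<le> c s"
    by blast
  have neg: "f' j \<le> 0" if "j \<in> J" for j
    using f'(3)[OF that, of "-1"] bspec[OF c, of "-1"] by (simp add: S_def)
  have key: "g \<bar>x\<bar> - g \<bar>l j\<bar> \<le> a j * f' j * (x - l j)" if j: "j \<in> J" and x: "\<bar>x\<bar> \<in> S" for j x
  proof -
    have "g \<bar>x\<bar> - g \<bar>l j\<bar> \<le> f' j * (\<bar>x\<bar> - \<bar>l j\<bar>)" using f'(2)[OF j x] .
    \<comment> \<open>As \<open>a j * x \<le> \<bar>x\<bar>\<close> and the slope is nonpositive,
      the replacement can only increase the product.\<close>
    also have "\<dots> \<le> f' j * (a j * x - a j * l j)"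
      unfolding al using neg[OF j] a[of j] by (intro mult_left_mono_neg) auto
    finally show ?thesis by (simp add: algebra_simps)
  qed
  have "\<bar>a j * d j - f' j\<bar> = \<bar>d j - a j * f' j\<bar>" for j using a[of j] by auto
  then have "(\<lambda>j. \<bar>d j - a j * f' j\<bar>) summable_on J" using f'(1) by simp
  moreover have "0 \<le> linear_change (\<lambda>j. a j * f' j) l \<nu>" if "\<nu> \<in> coordinate_orbit T J l" for \<nu>
  proof (rule linear_change_nonneg[OF that, where g="\<lambda>x. g \<bar>x\<bar>"])
    fix j k assume "j \<in> J" "k \<in> J"
    then show "g \<bar>l k\<bar> - g \<bar>l j\<bar> \<le> a j * f' j * (l k - l j)"
      "g \<bar>- l k\<bar> - g \<bar>l j\<bar> \<le> a j * f' j * (- l k - l j)"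
      using key[of j "l k"] key[of j "- l k"] by (auto simp: S_def)
  qed simp
  ultimately show ?thesis by (intro exI[of _ "\<lambda>j. a j * f' j"]) auto
qed

text \<open>The combinatorial core of the theorem. In the converse direction the summable part
  changes by a bounded amount along the orbit, so it cannot spoil the lower bound 0.\<close>

lemma bounded_below_iff_decomposition:
  assumes fin: "finite (l ` J)"
  shows "(\<exists>C. \<forall>\<nu>\<in>coordinate_orbit T J l. - C \<le> linear_change d l \<nu>) \<longleftrightarrow>
    (\<exists>d'. (\<lambda>j. \<bar>d j - d' j\<bar>) summable_on J \<and> (\<forall>\<nu>\<in>coordinate_orbit T J l. 0 \<le> linear_change d' l \<nu>))"
proof
  assume "\<exists>C. \<forall>\<nu>\<in>coordinate_orbit T J l. - C \<le> linear_change d l \<nu>"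
  then show "\<exists>d'. (\<lambda>j. \<bar>d j - d' j\<bar>) summable_on J \<and> (\<forall>\<nu>\<in>coordinate_orbit T J l. 0 \<le> linear_change d' l \<nu>)"
  proof (elim exE)
    fix C assume C: "\<forall>\<nu>\<in>coordinate_orbit T J l. - C \<le> linear_change d l \<nu>"
    show ?thesis
    proof (cases "T = Type_A")
      case True
      then show ?thesis using minimal_decomposition_A[of J l C d] C fin by simp
    next
      case False
      then show ?thesis using minimal_decomposition_signed[of T J l C d] C fin by simp
    qed
  qed
next
  assume "\<exists>d'. (\<lambda>j. \<bar>d j - d' j\<bar>) summable_on J \<and> (\<forall>\<nu>\<in>coordinate_orbit T J l. 0 \<le> linear_change d' l \<nu>)"
  then obtain d' where d': "(\<lambda>j. \<bar>d j - d' j\<bar>) summable_on J"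
    "\<And>\<nu>. \<nu> \<in> coordinate_orbit T J l \<Longrightarrow> 0 \<le> linear_change d' l \<nu>" by blast
  define M where "M = Max (insert 0 (abs ` l ` J))"
  have M: "\<bar>l j\<bar> \<le> M" if "j \<in> J" for j unfolding M_def using fin that by (intro Max_ge) auto
  have "- (2 * M * infsum (\<lambda>j. \<bar>d j - d' j\<bar>) J) \<le> linear_change d l \<nu>" if "\<nu> \<in> coordinate_orbit T J l" for \<nu>
  proof -
    have "linear_change d l \<nu> = linear_change d' l \<nu> + linear_change (\<lambda>j. d j - d' j) l \<nu>"
      unfolding total_change_def by (simp add: algebra_simps flip: sum.distrib)
    then show ?thesis using d'(2)[OF that] linear_change_summable_bound[OF that M d'(1)] by simp
  qed
  then show "\<exists>C. \<forall>\<nu>\<in>coordinate_orbit T J l. - C \<le> linear_change d l \<nu>" by blast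
qed

section \<open>The Weyl group in coordinates\<close>

lemma sum_fun_apply: "(\<Sum>a\<in>A. f a) x = (\<Sum>a\<in>A. f a x)"
  for f :: "'b \<Rightarrow> 'c \<Rightarrow> 'd::comm_monoid_add"
  by (induction A rule: infinite_finite_induct) auto

lemma INF_bounded_iff:
  fixes f :: "'b \<Rightarrow> real"
  assumes "A \<noteq> {}"
  shows "(INF x\<in>A. ereal (f x)) > - \<infinity> \<longleftrightarrow> (\<exists>C. \<forall>x\<in>A. - C \<le> f x)"
proof
  assume "(INF x\<in>A. ereal (f x)) > - \<infinity>"
  then obtain r where "ereal r < (INF x\<in>A. ereal (f x))" using ereal_dense2 by blast
  then have "r \<le> f x" if "x \<in> A" for x
    using INF_lower[OF that, of "\<lambda>x. ereal (f x)"] by (metis ereal_less_eq(3) less_imp_le order_trans)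
  then show "\<exists>C. \<forall>x\<in>A. - C \<le> f x" by (intro exI[of _ "- r"]) auto
next
  assume "\<exists>C. \<forall>x\<in>A. - C \<le> f x"
  then obtain C where "\<And>x. x \<in> A \<Longrightarrow> - C \<le> f x" by blast
  then have "ereal (- C) \<le> (INF x\<in>A. ereal (f x))" by (intro INF_greatest) simp
  then show "(INF x\<in>A. ereal (f x)) > - \<infinity>" by (rule less_le_trans[rotated]) simp
qed

lemma int_span_base: "\<mu> \<in> S \<Longrightarrow> \<mu> \<in> int_span S"
  and int_span_add: "\<mu> \<in> int_span S \<Longrightarrow> \<nu> \<in> int_span S \<Longrightarrow> \<mu> + \<nu> \<in> int_span S"
  and int_span_scale: "\<mu> \<in> int_span S \<Longrightarrow> (\<lambda>x. of_int n * \<mu> x) \<in> int_span S"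
  and int_span_zero: "0 \<in> int_span S"
  unfolding int_span_def
  by (auto intro: int_fun.span_base int_fun.span_add int_fun.span_scale int_fun.span_zero)

lemma character_zero: "character_on S chi \<Longrightarrow> chi 0 = 0"
proof -
  assume "character_on S chi"
  then have "chi (0 + 0) = chi 0 + chi 0" unfolding character_on_def using int_span_zero by blast
  then show ?thesis by simp
qed

lemma character_add:
  "character_on S chi \<Longrightarrow> \<mu> \<in> int_span S \<Longrightarrow> \<nu> \<in> int_span S \<Longrightarrow> chi (\<mu> + \<nu>) = chi \<mu> + chi \<nu>"
  unfolding character_on_def by blast

lemma character_scale:
  assumes "character_on S chi" "\<mu> \<in> int_span S"
  shows "chi (\<lambda>x. of_int n * \<mu> x) = of_int n * chi \<mu>"
proof -
  have pos: "chi (\<lambda>x. of_int (int m) * \<mu> x) = of_int (int m) * chi \<mu>" for m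
  proof (induction m)
    case 0
    then show ?case using character_zero[OF assms(1)] by (simp add: zero_fun_def)
  next
    case (Suc m)
    have "(\<lambda>x. of_int (int (Suc m)) * \<mu> x) = (\<lambda>x. of_int (int m) * \<mu> x) + \<mu>"
      by (auto simp: algebra_simps)
    then have "chi (\<lambda>x. of_int (int (Suc m)) * \<mu> x) = chi (\<lambda>x. of_int (int m) * \<mu> x) + chi \<mu>"
      using character_add[OF assms(1) int_span_scale[OF assms(2)] assms(2)] by (simp only:)
    then show ?case unfolding Suc.IH by (simp add: algebra_simps)
  qed
  show ?thesis
  proof (cases "n \<ge> 0")
    case True
    then show ?thesis using pos[of "nat n"] by simp
  next
    case False
    have "(\<lambda>x. of_int n * \<mu> x) + (\<lambda>x. of_int (- n) * \<mu> x) = 0" by auto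
    then have "chi (\<lambda>x. of_int n * \<mu> x) + chi (\<lambda>x. of_int (- n) * \<mu> x) = 0"
      using character_add[OF assms(1) int_span_scale[OF assms(2), of n] int_span_scale[OF assms(2), of "- n"]]
        character_zero[OF assms(1)] by (simp only:)
    moreover have "chi (\<lambda>x. of_int (- n) * \<mu> x) = of_int (- n) * chi \<mu>"
      using pos[of "nat (- n)"] False by simp
    ultimately show ?thesis by simp
  qed
qed

text \<open>For \<open>j = k\<close> and \<open>t = -1\<close> this is \<open>2 p f\<^sub>j\<close>; in type \<open>B\<close> the short root \<open>f\<^sub>j\<close> has \<open>p = 1 / 2\<close>.\<close>

definition root_form :: "('j \<Rightarrow> 'g \<Rightarrow> complex) \<Rightarrow> 'j \<Rightarrow> 'j \<Rightarrow> real \<Rightarrow> real \<Rightarrow> 'g \<Rightarrow> complex" where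
  "root_form f j k t p = (\<lambda>h. of_real p * (f j h - of_real t * f k h))"

text \<open>One parametrisation for all four types: \<open>t\<close> is the relative sign of the two
  terms, while \<open>p\<close> carries the overall sign and the scaling. Computations with coroots
  and reflections can then be done once for all types.\<close>

definition root_indices :: "root_type \<Rightarrow> 'j set \<Rightarrow> ('j \<times> 'j \<times> real \<times> real) set" where
  "root_indices T J = {(j, k, t, p). (j, k, t) \<in> moves T J \<and>
     \<bar>p\<bar> = (if j = k \<and> T = Type_B then 1 / 2 else 1)}"

lemma signed_pairs_root_form:
  "signed_pairs J f = {root_form f j k t p |j k t p. j \<in> J \<and> k \<in> J \<and> j \<noteq> k \<and> \<bar>t\<bar> = 1 \<and> \<bar>p\<bar> = 1}"
  (is "?L = ?R")
proof
  have "f j + f k = root_form f j k (-1) 1" "f j - f k = root_form f j k 1 1"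
    "- (f j + f k) = root_form f j k (-1) (-1)" "- (f j - f k) = root_form f j k 1 (-1)" for j k
    by (auto simp: root_form_def fun_eq_iff)
  note forms = this
  have R: "root_form f j k t p \<in> ?R" if "j \<in> J" "k \<in> J" "j \<noteq> k" "\<bar>t\<bar> = 1" "\<bar>p\<bar> = 1" for j k t p
    using that by blast
  show "?L \<subseteq> ?R" unfolding signed_pairs_def forms(3,4) unfolding forms(1,2)
    by (intro UN_least, simp only: insert_subset empty_subsetI) (intro conjI R; auto)
  show "?R \<subseteq> ?L"
  proof clarify
    fix j k and t p :: real assume jk: "j \<in> J" "k \<in> J" "j \<noteq> k" and "\<bar>t\<bar> = 1" "\<bar>p\<bar> = 1"
    then have "t = 1 \<or> t = -1" "p = 1 \<or> p = -1" by auto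
    then show "root_form f j k t p \<in> signed_pairs J f"
      using jk unfolding signed_pairs_def forms(3,4) unfolding forms(1,2) by blast
  qed
qed

lemma standard_roots_root_form:
  "standard_roots T J f = {root_form f j k t p |j k t p. (j, k, t, p) \<in> root_indices T J}" (is "?L = ?R")
proof (cases T)
  case Type_A
  have 1: "f j - f k = root_form f j k 1 1" "root_form f j k 1 (-1) = f k - f j" for j k
    by (auto simp: root_form_def fun_eq_iff)
  have "(j, k, 1, 1) \<in> root_indices T J" if "j \<in> J" "k \<in> J" "j \<noteq> k" for j k
    using that by (auto simp: root_indices_def moves_def)
  then have "?L \<subseteq> ?R" using Type_A 1 by fastforce
  moreover have "?R \<subseteq> ?L"
  proof clarify
    fix j k and t p :: real assume "(j, k, t, p) \<in> root_indices T J"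
    then have "j \<in> J" "k \<in> J" "j \<noteq> k" "t = 1" "p = 1 \<or> p = -1"
      using Type_A by (auto simp: root_indices_def moves_def split: if_splits)
    then show "root_form f j k t p \<in> ?L"
      using Type_A 1 by (fastforce simp flip: 1(1))
  qed
  ultimately show ?thesis by blast
next
  case Type_B
  have idx: "(j, k, t, p) \<in> root_indices T J \<longleftrightarrow> j \<in> J \<and> k \<in> J \<and>
    (j \<noteq> k \<and> \<bar>t\<bar> = 1 \<and> \<bar>p\<bar> = 1 \<or> j = k \<and> t = -1 \<and> (p = 1/2 \<or> p = -1/2))" for j k t p
    unfolding root_indices_def moves_def using Type_B by auto
  have "f j = root_form f j j (-1) (1/2)" "- f j = root_form f j j (-1) (-1/2)" for j
    by (auto simp: root_form_def fun_eq_iff)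
  then have "(\<Union>j\<in>J. {f j, - f j}) =
      {root_form f j k t p |j k t p. j \<in> J \<and> j = k \<and> t = -1 \<and> (p = 1/2 \<or> p = -1/2)}"
    by fastforce
  then show ?thesis unfolding idx using Type_B by (auto simp: signed_pairs_root_form) blast+
next
  case Type_C
  have idx: "(j, k, t, p) \<in> root_indices T J \<longleftrightarrow> j \<in> J \<and> k \<in> J \<and>
    (j \<noteq> k \<and> \<bar>t\<bar> = 1 \<and> \<bar>p\<bar> = 1 \<or> j = k \<and> t = -1 \<and> (p = 1 \<or> p = -1))" for j k t p
    unfolding root_indices_def moves_def using Type_C by auto
  have "f j + f j = root_form f j j (-1) 1" "- (f j + f j) = root_form f j j (-1) (-1)" for j
    by (auto simp: root_form_def fun_eq_iff)
  then have "(\<Union>j\<in>J. {f j + f j, - (f j + f j)}) =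
      {root_form f j k t p |j k t p. j \<in> J \<and> j = k \<and> t = -1 \<and> (p = 1 \<or> p = -1)}"
    by fastforce
  then show ?thesis unfolding idx using Type_C by (auto simp: signed_pairs_root_form) blast+
next
  case Type_D
  have idx: "(j, k, t, p) \<in> root_indices T J \<longleftrightarrow> j \<in> J \<and> k \<in> J \<and> j \<noteq> k \<and> \<bar>t\<bar> = 1 \<and> \<bar>p\<bar> = 1" for j k t p
    unfolding root_indices_def moves_def using Type_D by auto
  show ?thesis unfolding idx using Type_D by (simp add: signed_pairs_root_form)
qed

section \<open>Coordinate functionals on \<open>H\<close>, standard coroots and reflections\<close>

context classical_coordinates
begin

abbreviation eps :: "'j \<Rightarrow> 'g \<Rightarrow> complex" where
  "eps \<equiv> coordinate_functional H scaleV \<iota> J e"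

lemma subspace_H: "subspace H"
  using splitting unfolding splitting_def maximal_abelian_subalgebra_def abelian_subalgebra_def subalgebra_def
  by auto

lemma in_span_e: "v \<in> ext.span (e ` J)"
  using span_e by simp

lemma eps_dual: "eps j \<in> dual"
  unfolding dual_def coordinate_functional_def
  using subspace_H
  by (auto simp: incl_add incl_scale subspace_add subspace_scale
    ext.representation_add[OF independent_e in_span_e in_span_e]
    ext.representation_scale[OF independent_e in_span_e])

lemma eps_scale: "x \<in> H \<Longrightarrow> eps j (scale c x) = c * eps j x"
  using eps_dual[of j] unfolding dual_def by auto

lemma eps_finite: "h \<in> H \<Longrightarrow> finite {j \<in> J. eps j h \<noteq> 0}"
proof -
  assume h: "h \<in> H"
  have "e ` {j \<in> J. eps j h \<noteq> 0} \<subseteq> {b. ext.representation (e ` J) (\<iota> h) b \<noteq> 0}"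
    using h by (auto simp: coordinate_functional_def)
  then have "finite (e ` {j \<in> J. eps j h \<noteq> 0})"
    using ext.finite_representation finite_subset by blast
  moreover have "inj_on e {j \<in> J. eps j h \<noteq> 0}" by (rule inj_on_subset[OF inj_e]) auto
  ultimately show ?thesis by (rule finite_imageD)
qed

lemma eps_expansion: "h \<in> H \<Longrightarrow> (\<Sum>j | j \<in> J \<and> eps j h \<noteq> 0. scaleV (eps j h) (e j)) = \<iota> h"
proof -
  assume h: "h \<in> H"
  let ?r = "ext.representation (e ` J) (\<iota> h)"
  have "{b. ?r b \<noteq> 0} = e ` {j. j \<in> J \<and> eps j h \<noteq> 0}"
    using h ext.representation_ne_zero by (auto simp: coordinate_functional_def) blast
  then have "(\<Sum>b | ?r b \<noteq> 0. scaleV (?r b) b) = (\<Sum>j | j \<in> J \<and> eps j h \<noteq> 0. scaleV (?r (e j)) (e j))"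
    using inj_on_subset[OF inj_e] by (simp add: sum.reindex)
  also have "\<dots> = (\<Sum>j | j \<in> J \<and> eps j h \<noteq> 0. scaleV (eps j h) (e j))"
    using h by (intro sum.cong) (auto simp: coordinate_functional_def)
  finally show ?thesis
    using ext.sum_nonzero_representation_eq[OF independent_e in_span_e] by simp
qed

lemma eps_preimage:
  assumes F: "finite F" "F \<subseteq> J" and x: "T = Type_A \<Longrightarrow> (\<Sum>j\<in>F. x j) = 0"
  shows "\<exists>h\<in>H. \<forall>i\<in>J. eps i h = (if i \<in> F then x i else 0)"
proof -
  let ?v = "\<Sum>j\<in>F. scaleV (x j) (e j)"
  have "?v \<in> \<iota> ` H" unfolding range_incl using F x by auto
  then obtain h where h: "h \<in> H" "\<iota> h = ?v" by auto
  have "eps i h = (if i \<in> F then x i else 0)" if i: "i \<in> J" for i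
  proof -
    have rep_e: "ext.representation (e ` J) (e j) (e i) = (if i = j then 1 else 0)" if "j \<in> J" for j
      using ext.representation_basis[OF independent_e, of "e j"] that i inj_e by (auto simp: inj_on_def)
    have "eps i h = ext.representation (e ` J) ?v (e i)"
      using h by (simp add: coordinate_functional_def)
    also have "\<dots> = (\<Sum>j\<in>F. ext.representation (e ` J) (scaleV (x j) (e j)) (e i))"
      by (subst ext.representation_sum[OF independent_e]) (auto simp: in_span_e)
    also have "\<dots> = (\<Sum>j\<in>F. x j * (if i = j then 1 else 0))"
      using F(2) by (intro sum.cong) (auto simp: ext.representation_scale[OF independent_e in_span_e] rep_e)
    also have "\<dots> = (\<Sum>j\<in>F. if i = j then x j else 0)" by (intro sum.cong) auto
    also have "\<dots> = (if i \<in> F then x i else 0)" using F(1) by simp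
    finally show ?thesis .
  qed
  then show ?thesis using h by blast
qed

text \<open>The vector e_j - t e_k, which is proportional to a coroot. In type A only t = 1 with
  distinct indices occurs, so its coordinate sum vanishes and it comes from
  \<open>H\<close>.\<close>

lemma move_vector:
  assumes "(j, k, t) \<in> moves T J"
  obtains h where "h \<in> H"
    "\<And>i. i \<in> J \<Longrightarrow> eps i h = of_real ((if i = j then 1 else 0) - t * (if i = k then 1 else 0))"
proof -
  have jk: "j \<in> J" "k \<in> J" and A: "T = Type_A \<Longrightarrow> j \<noteq> k \<and> t = 1"
    using assms by (auto simp: moves_def split: if_splits)
  let ?x = "\<lambda>i. of_real ((if i = j then 1 else 0) - t * (if i = k then 1 else 0)) :: complex"
  have "\<exists>h\<in>H. \<forall>i\<in>J. eps i h = (if i \<in> {j, k} then ?x i else 0)"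
    by (rule eps_preimage) (use jk A in auto)
  then obtain h where "h \<in> H" "\<forall>i\<in>J. eps i h = (if i \<in> {j, k} then ?x i else 0)" by blast
  then show ?thesis by (intro that[of h]) auto
qed

lemma roots_iff: "\<alpha> \<in> roots \<longleftrightarrow> (\<exists>j k t p. (j, k, t, p) \<in> root_indices T J \<and> \<alpha> = root_form eps j k t p)"
  unfolding roots_eq standard_roots_root_form by auto

text \<open>The factor 1/2 on the diagonal is due to e_j - t e_k being 2 e_j and the form being 2 p
  \<epsilon>_j there. The bound 2 on the values of all roots is recorded for the proof that the
  roots are reduced, the invariance of the roots for \<open>coroot_eqI\<close>.\<close>

lemma standard_coroot:
  assumes idx: "(j, k, t, p) \<in> root_indices T J"
    and h: "h \<in> H" "\<And>i. i \<in> J \<Longrightarrow> eps i h = of_real ((if i = j then 1 else 0) - t * (if i = k then 1 else 0))"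
  defines "h' \<equiv> scale (of_real ((if j = k then 1 / 2 else 1) / p)) h"
  shows "h' \<in> H" "root_form eps j k t p h' = 2"
    and "\<beta> \<in> roots \<Longrightarrow> \<beta> h' \<in> \<real> \<and> cmod (\<beta> h') \<le> 2"
    and "\<beta> \<in> roots \<Longrightarrow> (\<lambda>u. \<beta> u - \<beta> h' * root_form eps j k t p u) \<in> roots"
proof -
  define \<kappa> :: real where "\<kappa> = (if j = k then 1 / 2 else 1)"
  define E :: "'j \<Rightarrow> real" where "E i = (if i = j then 1 else 0) - t * (if i = k then 1 else 0)" for i
  have jk: "j \<in> J" "k \<in> J" and t: "t = 1 \<or> t = -1" "j = k \<Longrightarrow> t = -1" "T = Type_A \<Longrightarrow> t = 1 \<and> j \<noteq> k"
    and p: "\<bar>p\<bar> = (if j = k \<and> T = Type_B then 1 / 2 else 1)"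
    using idx by (auto simp: root_indices_def moves_def split: if_splits)
  have p0: "p \<noteq> 0" using p by (auto split: if_splits)
  show h'H: "h' \<in> H" unfolding h'_def using h subspace_H by (simp add: subspace_scale)
  have eps': "eps i h' = of_real (\<kappa> / p * E i)" if "i \<in> J" for i
    unfolding h'_def eps_scale[OF h(1)] h(2)[OF that] by (simp add: \<kappa>_def E_def)
  have val: "root_form eps a b u r h' = of_real (r * \<kappa> / p * (E a - u * E b))" if "a \<in> J" "b \<in> J" for a b u r
    unfolding root_form_def eps'[OF that(1)] eps'[OF that(2)] by (simp add: algebra_simps)
  have "p * \<kappa> / p * (E j - t * E k) = 2" using p0 t by (auto simp: \<kappa>_def E_def)
  then show "root_form eps j k t p h' = 2" by (simp only: val[OF jk]) simp
  assume "\<beta> \<in> roots"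
  then obtain a b u r where \<beta>: "(a, b, u, r) \<in> root_indices T J" "\<beta> = root_form eps a b u r"
    using roots_iff by auto
  then have ab: "a \<in> J" "b \<in> J" and u: "u = 1 \<or> u = -1" "a = b \<Longrightarrow> u = -1" "T = Type_A \<Longrightarrow> u = 1 \<and> a \<noteq> b"
    and r: "\<bar>r\<bar> = (if a = b \<and> T = Type_B then 1 / 2 else 1)"
    by (auto simp: root_indices_def moves_def split: if_splits)
  have "\<bar>r * \<kappa> / p * (E a - u * E b)\<bar> = \<bar>r\<bar> * \<kappa> / \<bar>p\<bar> * \<bar>E a - u * E b\<bar>"
    by (simp add: abs_mult \<kappa>_def)
  also have "\<dots> \<le> 2"
    unfolding r p \<kappa>_def E_def using t u by (auto split: if_splits)
  finally have "cmod (\<beta> h') \<le> 2" unfolding \<beta>(2) val[OF ab] norm_of_real .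
  moreover have "\<beta> h' \<in> \<real>" unfolding \<beta>(2) val[OF ab] by simp
  ultimately show "\<beta> h' \<in> \<real> \<and> cmod (\<beta> h') \<le> 2" by simp
  \<comment> \<open>The reflection sends \<epsilon>_i to \<sigma>_i times \<epsilon>_(\<pi> i), with
    \<pi> the transposition of \<open>j\<close> and \<open>k\<close>; so it acts on roots by
    transforming indices and signs.\<close>
  define \<pi> where "\<pi> i = (if i = j then k else if i = k then j else i)" for i
  define \<sigma> :: "'j \<Rightarrow> real" where "\<sigma> i = (if i = j \<or> i = k then t else 1)" for i
  have act: "eps i x - of_real (\<kappa> * E i) * (eps j x - of_real t * eps k x) = of_real (\<sigma> i) * eps (\<pi> i) x" for i x
    using t by (auto simp: \<kappa>_def E_def \<sigma>_def \<pi>_def algebra_simps)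
  have \<sigma>: "\<sigma> i = 1 \<or> \<sigma> i = -1" for i using t by (auto simp: \<sigma>_def)
  have "root_form eps a b u r x - root_form eps a b u r h' * root_form eps j k t p x =
    root_form eps (\<pi> a) (\<pi> b) (u * \<sigma> a * \<sigma> b) (r * \<sigma> a) x" for x
  proof -
    have "root_form eps a b u r x - root_form eps a b u r h' * root_form eps j k t p x =
      of_real r * ((eps a x - of_real (\<kappa> * E a) * (eps j x - of_real t * eps k x)) -
        of_real u * (eps b x - of_real (\<kappa> * E b) * (eps j x - of_real t * eps k x)))"
      unfolding val[OF ab] using p0 by (simp add: root_form_def field_simps)
    also have "\<dots> = root_form eps (\<pi> a) (\<pi> b) (u * \<sigma> a * \<sigma> b) (r * \<sigma> a) x"
      unfolding act root_form_def using \<sigma>[of a] by (auto simp: algebra_simps)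
    finally show ?thesis .
  qed
  then have "(\<lambda>x. \<beta> x - \<beta> h' * root_form eps j k t p x) = root_form eps (\<pi> a) (\<pi> b) (u * \<sigma> a * \<sigma> b) (r * \<sigma> a)"
    unfolding \<beta>(2) by auto
  moreover have "(\<pi> a, \<pi> b, u * \<sigma> a * \<sigma> b, r * \<sigma> a) \<in> root_indices T J"
  proof -
    have inj: "\<pi> a = \<pi> b \<longleftrightarrow> a = b" by (auto simp: \<pi>_def)
    have "\<pi> a \<in> J" "\<pi> b \<in> J" using ab jk by (auto simp: \<pi>_def)
    moreover have "u * \<sigma> a * \<sigma> b = 1 \<or> u * \<sigma> a * \<sigma> b = -1" using u(1) \<sigma>[of a] \<sigma>[of b] by auto
    moreover have "a = b \<Longrightarrow> u * \<sigma> a * \<sigma> b = -1" using u(2) \<sigma>[of a] by auto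
    moreover have "T = Type_A \<Longrightarrow> u * \<sigma> a * \<sigma> b = 1" using u(3) t(3) by (simp add: \<sigma>_def)
    moreover have "\<bar>r * \<sigma> a\<bar> = \<bar>r\<bar>" using \<sigma>[of a] by auto
    ultimately show ?thesis using \<beta>(1) unfolding root_indices_def moves_def by (auto simp: inj split: if_splits)
  qed
  ultimately show "(\<lambda>x. \<beta> x - \<beta> h' * root_form eps j k t p x) \<in> roots"
    unfolding roots_iff by blast
qed

text \<open>Only finitely many coordinates of a fixed \<open>h\<close> are nonzero, which bounds the
  roots there. For reducedness, evaluate at the standard coroots of \<alpha> and of c \<alpha>: each
  root is 2 at its own and at most 2 in modulus at the other, so |c| = 1, and c is real because the
  values are.\<close>

lemma bounded_reduced_roots: "bounded_reduced_roots scale bracket H"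
proof unfold_locales
  show simple_lie by (rule simple)
  show splitting by (rule splitting)
  show "- \<alpha> \<in> roots" if \<alpha>: "\<alpha> \<in> roots" for \<alpha>
  proof -
    obtain j k t p where "(j, k, t, p) \<in> root_indices T J" "\<alpha> = root_form eps j k t p"
      using \<alpha> roots_iff by auto
    then have "(j, k, t, - p) \<in> root_indices T J" "- \<alpha> = root_form eps j k t (- p)"
      by (auto simp: root_indices_def root_form_def)
    then show ?thesis unfolding roots_iff by blast
  qed
  show "\<exists>B. \<forall>\<alpha>\<in>roots. cmod (\<alpha> h) \<le> B" if h: "h \<in> H" for h
  proof -
    define M where "M = Max (insert 0 ((\<lambda>j. cmod (eps j h)) ` {j \<in> J. eps j h \<noteq> 0}))"
    have M: "cmod (eps j h) \<le> M" if "j \<in> J" for j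
      unfolding M_def using eps_finite[OF h] that by (cases "eps j h = 0") (auto intro!: Max_ge)
    have "cmod (\<alpha> h) \<le> 2 * M" if \<alpha>: "\<alpha> \<in> roots" for \<alpha>
    proof -
      obtain j k t p where jk: "(j, k, t, p) \<in> root_indices T J" "\<alpha> = root_form eps j k t p"
        using \<alpha> roots_iff by auto
      then have J: "j \<in> J" "k \<in> J" and "\<bar>t\<bar> = 1" "\<bar>p\<bar> \<le> 1"
        by (auto simp: root_indices_def moves_def split: if_splits)
      have "cmod (\<alpha> h) \<le> 1 * cmod (eps j h - of_real t * eps k h)"
        unfolding jk root_form_def norm_mult using \<open>\<bar>p\<bar> \<le> 1\<close> by (intro mult_right_mono) auto
      also have "\<dots> \<le> cmod (eps j h) + cmod (of_real t * eps k h)" using norm_triangle_ineq4 by simp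
      also have "\<dots> \<le> 2 * M" using M[OF J(1)] M[OF J(2)] \<open>\<bar>t\<bar> = 1\<close> by (simp add: norm_mult)
      finally show ?thesis .
    qed
    then show ?thesis by blast
  qed
  show "c = 1 \<or> c = -1" if \<alpha>: "\<alpha> \<in> roots" and \<beta>: "(\<lambda>h. c * \<alpha> h) \<in> roots" for \<alpha> c
  proof -
    have coroot: "\<exists>h. \<alpha> h = 2 \<and> (\<forall>\<beta>\<in>roots. \<beta> h \<in> \<real> \<and> cmod (\<beta> h) \<le> 2)" if "\<alpha> \<in> roots" for \<alpha>
    proof -
      obtain j k t p where idx: "(j, k, t, p) \<in> root_indices T J" "\<alpha> = root_form eps j k t p"
        using \<open>\<alpha> \<in> roots\<close> roots_iff by auto
      then have "(j, k, t) \<in> moves T J" by (auto simp: root_indices_def)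
      then obtain h where h: "h \<in> H"
        "\<And>i. i \<in> J \<Longrightarrow> eps i h = of_real ((if i = j then 1 else 0) - t * (if i = k then 1 else 0))"
        using move_vector by blast
      show ?thesis using standard_coroot[OF idx(1) h] idx(2) by blast
    qed
    have c0: "c \<noteq> 0" using rootsD(2)[OF \<beta>] by (auto simp: zero_fun_def)
    obtain h where h0: "\<alpha> h = 2" "\<forall>\<beta>\<in>roots. \<beta> h \<in> \<real> \<and> cmod (\<beta> h) \<le> 2" using coroot[OF \<alpha>] by blast
    then have h: "\<alpha> h = 2" "c * \<alpha> h \<in> \<real>" "cmod (c * \<alpha> h) \<le> 2" using bspec[OF h0(2) \<beta>] by auto
    obtain h' where h0': "c * \<alpha> h' = 2" "\<forall>\<beta>\<in>roots. \<beta> h' \<in> \<real> \<and> cmod (\<beta> h') \<le> 2" using coroot[OF \<beta>] by blast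
    then have h': "c * \<alpha> h' = 2" "cmod (\<alpha> h') \<le> 2" using bspec[OF h0'(2) \<alpha>] by auto
    have "cmod c \<le> 1" using h by (simp add: norm_mult)
    moreover have "cmod c * cmod (\<alpha> h') = 2" using h'(1) by (metis norm_mult norm_numeral)
    then have "1 \<le> cmod c" using h'(2) by (smt (verit) mult_left_less_imp_less mult_less_cancel_right2 norm_ge_zero)
    ultimately have "cmod c = 1" by simp
    moreover have "c \<in> \<real>" using h(1,2) by (metis Reals_divide Reals_numeral nonzero_mult_div_cancel_right zero_neq_numeral)
    ultimately obtain r where r: "c = of_real r" "\<bar>r\<bar> = 1" by (auto elim!: Reals_cases)
    then have "r = 1 \<or> r = -1" by auto
    then show ?thesis using r by auto
  qed
qed

lemma coroot_root_form:
  assumes idx: "(j, k, t, p) \<in> root_indices T J"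
    and h: "h \<in> H" "\<And>i. i \<in> J \<Longrightarrow> eps i h = of_real ((if i = j then 1 else 0) - t * (if i = k then 1 else 0))"
  shows "coroot (root_form eps j k t p) = scale (of_real ((if j = k then 1 / 2 else 1) / p)) h"
proof (rule bounded_reduced_roots.coroot_eqI[OF bounded_reduced_roots])
  show "root_form eps j k t p \<in> roots" using idx roots_iff by blast
qed (use standard_coroot[OF idx h] in blast)+

text \<open>A possibly infinite combination of the \<open>eps j\<close>, finite at each
  \<open>h\<close>. In type A the family \<open>l\<close> is determined only up to an additive
  constant, because the coordinates of \<open>h\<close> sum to 0.\<close>

definition has_coordinates :: "('g \<Rightarrow> complex) \<Rightarrow> ('j \<Rightarrow> real) \<Rightarrow> bool" where
  "has_coordinates \<mu> l \<longleftrightarrow> (\<forall>h\<in>H. \<mu> h = (\<Sum>j | j \<in> J \<and> eps j h \<noteq> 0. of_real (l j) * eps j h))"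

text \<open>Orbit elements are written as \<open>lam\<close> plus such a finite combination of the
  \<open>eps j\<close>, although \<open>lam\<close> itself need not be a finite combination.\<close>

definition weight_change :: "('j \<Rightarrow> real) \<Rightarrow> ('j \<Rightarrow> real) \<Rightarrow> 'g \<Rightarrow> complex" where
  "weight_change l \<nu> = (\<lambda>h. total_change (\<lambda>j x. of_real x * eps j h) l \<nu>)"

lemma has_coordinates_superset:
  assumes "has_coordinates \<mu> l" "h \<in> H" "finite F" "F \<subseteq> J" "\<And>j. j \<in> J \<Longrightarrow> eps j h \<noteq> 0 \<Longrightarrow> j \<in> F"
  shows "\<mu> h = (\<Sum>j\<in>F. of_real (l j) * eps j h)"
proof -
  have "\<mu> h = (\<Sum>j | j \<in> J \<and> eps j h \<noteq> 0. of_real (l j) * eps j h)"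
    using assms(1,2) unfolding has_coordinates_def by blast
  also have "\<dots> = (\<Sum>j\<in>F. of_real (l j) * eps j h)"
    using assms(3-5) by (intro sum.mono_neutral_left) auto
  finally show ?thesis .
qed

lemma has_coordinates_weight_change:
  assumes l: "has_coordinates lam l" and \<nu>: "\<nu> \<in> coordinate_orbit T J l"
  shows "has_coordinates (lam + weight_change l \<nu>) \<nu>"
  unfolding has_coordinates_def
proof
  fix h assume h: "h \<in> H"
  let ?N = "{j. j \<in> J \<and> eps j h \<noteq> 0}"
  let ?F = "?N \<union> {j. \<nu> j \<noteq> l j}"
  have F: "finite ?F" "?F \<subseteq> J" using eps_finite[OF h] coordinate_orbit_support[OF \<nu>] by auto
  have "(lam + weight_change l \<nu>) h =
      (\<Sum>j\<in>?F. of_real (l j) * eps j h) + (\<Sum>j\<in>?F. of_real (\<nu> j) * eps j h - of_real (l j) * eps j h)"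
    unfolding weight_change_def plus_fun_apply
    using has_coordinates_superset[OF l h F] total_change_superset[OF F(1), of \<nu> l] by auto
  also have "\<dots> = (\<Sum>j\<in>?F. of_real (\<nu> j) * eps j h)" by (simp flip: sum.distrib)
  also have "\<dots> = (\<Sum>j\<in>?N. of_real (\<nu> j) * eps j h)"
    using F by (intro sum.mono_neutral_right) auto
  finally show "(lam + weight_change l \<nu>) h = (\<Sum>j\<in>?N. of_real (\<nu> j) * eps j h)" .
qed

lemma root_form_index:
  assumes "(j, k, t) \<in> moves T J"
  shows "\<exists>p. (j, k, t, p) \<in> root_indices T J"
  using assms by (intro exI[of _ "if j = k \<and> T = Type_B then 1 / 2 else 1"]) (auto simp: root_indices_def)

text \<open>The scaling \<open>p\<close> of the root cancels against that of its coroot, so the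
  reflection subtracts (\<nu>_j - t \<nu>_k) (\<epsilon>_j - t \<epsilon>_k), halved on the
  diagonal; this is the effect of \<open>swap_move\<close>. One reflection thus matches one move,
  and the two inductively generated orbits correspond.\<close>

lemma reflection_root_form:
  assumes l: "has_coordinates lam l" and \<nu>: "\<nu> \<in> coordinate_orbit T J l"
    and idx: "(j, k, t, p) \<in> root_indices T J"
  shows "reflection (root_form eps j k t p) (lam + weight_change l \<nu>) =
    lam + weight_change l (swap_move j k t \<nu>)"
proof -
  have mv: "(j, k, t) \<in> moves T J" using idx by (auto simp: root_indices_def)
  then have jk: "j \<in> J" "k \<in> J" and t: "t = 1 \<or> t = -1" "j = k \<Longrightarrow> t = -1"
    by (auto simp: moves_def split: if_splits)
  have p0: "p \<noteq> 0" using idx by (auto simp: root_indices_def split: if_splits)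
  obtain h where h: "h \<in> H"
    "\<And>i. i \<in> J \<Longrightarrow> eps i h = of_real ((if i = j then 1 else 0) - t * (if i = k then 1 else 0))"
    using move_vector[OF mv] by blast
  define q where "q = (if j = k then 1 / 2 else 1) / p"
  define \<mu> where "\<mu> = lam + weight_change l \<nu>"
  have co: "coroot (root_form eps j k t p) = scale (of_real q) h"
    unfolding q_def by (rule coroot_root_form[OF idx h])
  have qh: "scale (of_real q) h \<in> H" using h subspace_H by (simp add: subspace_scale)
  have "\<mu> (scale (of_real q) h) = (\<Sum>i\<in>{j, k}. of_real (\<nu> i) * eps i (scale (of_real q) h))"
    by (rule has_coordinates_superset[OF has_coordinates_weight_change[OF l \<nu>, folded \<mu>_def] qh])
      (use jk h in \<open>auto simp: eps_scale split: if_splits\<close>)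
  also have "\<dots> = of_real (q * (\<nu> j - t * \<nu> k))"
    using t jk by (cases "j = k") (auto simp: eps_scale h algebra_simps)
  finally have val: "\<mu> (coroot (root_form eps j k t p)) = of_real (q * (\<nu> j - t * \<nu> k))"
    unfolding co .
  have "reflection (root_form eps j k t p) \<mu> x = (lam + weight_change l (swap_move j k t \<nu>)) x" for x
  proof -
    have "reflection (root_form eps j k t p) \<mu> x =
        \<mu> x - of_real (q * (\<nu> j - t * \<nu> k)) * root_form eps j k t p x"
      by (simp add: reflection_def val)
    also have "\<dots> = \<mu> x - of_real (q * p * (\<nu> j - t * \<nu> k)) * (eps j x - of_real t * eps k x)"
      by (simp add: root_form_def)
    also have "q * p = (if j = k then 1 / 2 else 1)" using p0 by (simp add: q_def)
    also have "\<mu> x - of_real ((if j = k then 1 / 2 else 1) * (\<nu> j - t * \<nu> k)) * (eps j x - of_real t * eps k x) =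
        (lam + weight_change l (swap_move j k t \<nu>)) x"
      unfolding \<mu>_def weight_change_def plus_fun_apply
        total_change_move[OF coordinate_orbit_support(1)[OF \<nu>]]
      using t by (auto simp: algebra_simps)
    finally show ?thesis .
  qed
  then show ?thesis unfolding \<mu>_def by auto
qed

lemma weight_change_refl [simp]: "weight_change l l = 0"
  by (auto simp: weight_change_def)

lemma orbit_differences_eq:
  assumes l: "has_coordinates lam l"
  shows "orbit_differences lam = weight_change l ` coordinate_orbit T J l"
proof -
  have "\<exists>\<nu>\<in>coordinate_orbit T J l. w lam = lam + weight_change l \<nu>" if "w \<in> weyl_group" for w
    using that
  proof induction
    case weyl_id
    show ?case by (intro bexI[OF _ coordinate_orbit.base]) auto
  next
    case (weyl_step w \<alpha>)
    then obtain \<nu> where \<nu>: "\<nu> \<in> coordinate_orbit T J l" "w lam = lam + weight_change l \<nu>" by blast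
    obtain j k t p where idx: "(j, k, t, p) \<in> root_indices T J" "\<alpha> = root_form eps j k t p"
      using weyl_step.hyps roots_iff by auto
    have "(j, k, t) \<in> moves T J" using idx by (auto simp: root_indices_def)
    from coordinate_orbit.move[OF \<nu>(1) this]
    show ?case using reflection_root_form[OF l \<nu>(1) idx(1)] \<nu>(2) idx(2) by auto
  qed
  moreover have "\<exists>w\<in>weyl_group. w lam = lam + weight_change l \<nu>" if "\<nu> \<in> coordinate_orbit T J l" for \<nu>
    using that
  proof induction
    case base
    show ?case by (intro bexI[OF _ weyl_id]) auto
  next
    case (move \<nu> j k t)
    then obtain w where w: "w \<in> weyl_group" "w lam = lam + weight_change l \<nu>" by blast
    obtain p where idx: "(j, k, t, p) \<in> root_indices T J" using root_form_index[OF move.hyps(2)] by blast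
    then have "root_form eps j k t p \<in> roots" using roots_iff by blast
    from weyl_group.weyl_step[OF w(1) this]
    show ?case using reflection_root_form[OF l move.hyps(1) idx] w(2) by (intro bexI) auto
  qed
  ultimately show ?thesis
    unfolding orbit_differences_def by (auto simp: image_iff) (metis add_diff_cancel_left')+
qed

section \<open>Characters of the root lattice as real-linear functionals\<close>

definition real_linear :: "(('g \<Rightarrow> complex) \<Rightarrow> real) \<Rightarrow> bool" where
  "real_linear \<psi> \<longleftrightarrow> (\<forall>\<mu> \<nu>. \<psi> (\<mu> + \<nu>) = \<psi> \<mu> + \<psi> \<nu>) \<and> (\<forall>r \<mu>. \<psi> (\<lambda>x. of_real r * \<mu> x) = r * \<psi> \<mu>)"

text \<open>In type A the vector e_j does not come from \<open>H\<close>. Subtracting e_k for some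
  \<open>k\<close> outside \<open>F\<close>, available since \<open>J\<close> is infinite, repairs
  this without disturbing the other coordinates in \<open>F\<close>.\<close>

lemma eps_separate:
  assumes "j \<in> J" "finite F"
  obtains h where "h \<in> H" "eps j h = 1" "\<And>i. i \<in> F \<Longrightarrow> i \<in> J \<Longrightarrow> i \<noteq> j \<Longrightarrow> eps i h = 0"
proof -
  obtain k where k: "k \<in> J" "k \<notin> insert j F"
    using infinite_J assms(2) by (meson finite_insert finite_subset subsetI)
  then have "(j, k, 1) \<in> moves T J" using assms by (auto simp: moves_def)
  then obtain h where h: "h \<in> H"
    "\<And>i. i \<in> J \<Longrightarrow> eps i h = of_real ((if i = j then 1 else 0) - 1 * (if i = k then 1 else 0))"
    using move_vector by blast
  show ?thesis by (rule that[of h]) (use h k assms in auto)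
qed

lemma eps_inj: "inj_on eps J"
proof (rule inj_onI, rule ccontr)
  fix j k assume "j \<in> J" "k \<in> J" "eps j = eps k" "j \<noteq> k"
  then show False using eps_separate[of j "{k}"] by (metis finite.emptyI finite.insertI insertI1 zero_neq_one)
qed

lemma eps_independent: "real_fun.independent (eps ` J)"
  unfolding real_fun.dependent_explicit
proof clarify
  fix t u v assume t: "finite t" "t \<subseteq> eps ` J" "(\<Sum>v\<in>t. (\<lambda>x. of_real (u v) * v x)) = 0"
    and v: "v \<in> t" "u v \<noteq> (0::real)"
  obtain j where j: "j \<in> J" "v = eps j" using v t by auto
  define F where "F = {i \<in> J. eps i \<in> t}"
  have "eps ` F \<subseteq> t" "inj_on eps F" using eps_inj by (auto simp: F_def inj_on_def)
  then have F: "finite F" using t(1) by (meson finite_imageD finite_subset)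
  obtain h where h: "h \<in> H" "eps j h = 1" "\<And>i. i \<in> F \<Longrightarrow> i \<in> J \<Longrightarrow> i \<noteq> j \<Longrightarrow> eps i h = 0"
    using eps_separate[OF j(1) F] by blast
  have key: "w h = (if w = v then 1 else 0)" if w: "w \<in> t" for w
  proof -
    obtain i where "i \<in> J" "w = eps i" using w t by auto
    then show ?thesis using h j w inj_onD[OF eps_inj, of i j] by (cases "i = j") (auto simp: F_def)
  qed
  have "(\<Sum>w\<in>t. of_real (u w) * w h) = (\<Sum>w\<in>t. if w = v then of_real (u v) else 0)"
  proof (rule sum.cong)
    fix w assume "w \<in> t"
    then show "of_real (u w) * w h = (if w = v then of_real (u v) else 0)" using key[of w] by simp
  qed simp
  also have "\<dots> = of_real (u v)" using t(1) v by simp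
  finally have "(\<Sum>w\<in>t. (\<lambda>x. of_real (u w) * w x)) h = of_real (u v)" by (simp add: sum_fun_apply)
  then show False using t(3) v by simp
qed

text \<open>Functionals are taken linear on the whole function space, which spares membership
  conditions; only their values on the spans matter. Independence of the \<open>eps j\<close> over
  the reals allows any prescribed values.\<close>

lemma real_linear_exists: "\<exists>\<psi>. real_linear \<psi> \<and> (\<forall>j\<in>J. \<psi> (eps j) = d j)"
proof -
  interpret vector_space_pair "\<lambda>(r::real) (\<mu>::'g \<Rightarrow> complex) x. of_real r * \<mu> x" "(*) :: real \<Rightarrow> real \<Rightarrow> real"
    by unfold_locales (auto simp: algebra_simps fun_eq_iff)
  obtain \<psi> where \<psi>: "Vector_Spaces.linear (\<lambda>(r::real) (\<mu>::'g \<Rightarrow> complex) x. of_real r * \<mu> x) (*) \<psi>"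
    "\<forall>v\<in>eps ` J. \<psi> v = d (inv_into J eps v)"
    using linear_independent_extend[OF eps_independent, of "\<lambda>v. d (inv_into J eps v)"] by blast
  interpret \<psi>: Vector_Spaces.linear "\<lambda>(r::real) (\<mu>::'g \<Rightarrow> complex) x. of_real r * \<mu> x" "(*)" \<psi> by fact
  have "real_linear \<psi>" unfolding real_linear_def using \<psi>.add \<psi>.scale by auto
  then show ?thesis using \<psi>(2) eps_inj by auto
qed

lemma real_linear_zero: "real_linear \<psi> \<Longrightarrow> \<psi> 0 = 0"
proof -
  assume "real_linear \<psi>"
  then have "\<psi> (0 + 0) = \<psi> 0 + \<psi> 0" unfolding real_linear_def by blast
  then show ?thesis by simp
qed

lemma real_linear_sum: "real_linear \<psi> \<Longrightarrow> \<psi> (\<Sum>a\<in>A. f a) = (\<Sum>a\<in>A. \<psi> (f a))"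
  by (induction A rule: infinite_finite_induct) (simp_all add: real_linear_zero, simp add: real_linear_def)

lemma real_linear_weight_change:
  assumes "real_linear \<psi>" "\<And>j. j \<in> J \<Longrightarrow> \<psi> (eps j) = d j" "\<nu> \<in> coordinate_orbit T J l"
  shows "\<psi> (weight_change l \<nu>) = linear_change d l \<nu>"
proof -
  let ?F = "{j. \<nu> j \<noteq> l j}"
  have "weight_change l \<nu> = (\<Sum>j\<in>?F. (\<lambda>h. of_real (\<nu> j - l j) * eps j h))"
    by (auto simp: weight_change_def total_change_def sum_fun_apply algebra_simps)
  then have "\<psi> (weight_change l \<nu>) = (\<Sum>j\<in>?F. \<psi> (\<lambda>h. of_real (\<nu> j - l j) * eps j h))"
    by (simp only: real_linear_sum[OF assms(1)])
  also have "\<dots> = (\<Sum>j\<in>?F. (\<nu> j - l j) * \<psi> (eps j))"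
    using assms(1) unfolding real_linear_def by (simp only:)
  also have "\<dots> = linear_change d l \<nu>"
    unfolding total_change_def using assms(2) coordinate_orbit_support(2)[OF assms(3)]
    by (intro sum.cong) (auto simp: algebra_simps)
  finally show ?thesis .
qed

lemma real_linear_root_form:
  assumes "real_linear \<psi>"
  shows "\<psi> (root_form eps j k t p) = p * (\<psi> (eps j) - t * \<psi> (eps k))"
proof -
  have "root_form eps j k t p = (\<lambda>x. of_real p * eps j x) + (\<lambda>x. of_real (- (p * t)) * eps k x)"
    by (auto simp: root_form_def algebra_simps)
  then have "\<psi> (root_form eps j k t p) = \<psi> (\<lambda>x. of_real p * eps j x) + \<psi> (\<lambda>x. of_real (- (p * t)) * eps k x)"
    using assms unfolding real_linear_def by (simp only:)
  also have "\<dots> = p * \<psi> (eps j) + (- (p * t)) * \<psi> (eps k)"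
    using assms unfolding real_linear_def by (simp only:)
  finally show ?thesis by (simp add: algebra_simps)
qed

lemma real_linear_int_scale: "real_linear \<psi> \<Longrightarrow> \<psi> (\<lambda>x. of_int n * \<mu> x) = of_int n * \<psi> \<mu>"
  unfolding real_linear_def by (metis of_real_of_int_eq)

lemma real_linear_character: "real_linear \<psi> \<Longrightarrow> character_on S \<psi>"
  unfolding real_linear_def character_on_def by blast

lemma character_eq_real_linear:
  assumes \<psi>: "real_linear \<psi>" and chi: "character_on S chi" and eq: "\<And>\<alpha>. \<alpha> \<in> S \<Longrightarrow> chi \<alpha> = \<psi> \<alpha>"
    and \<mu>: "\<mu> \<in> int_span S"
  shows "chi \<mu> = \<psi> \<mu>"
proof -
  have "\<mu> \<in> int_span S \<and> chi \<mu> = \<psi> \<mu>"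
    using \<mu> unfolding int_span_def
  proof (induction rule: int_fun.span_induct_alt)
    case base
    then show ?case using int_span_zero[of S] real_linear_zero[OF \<psi>] character_zero[OF chi]
      unfolding int_span_def zero_fun_def by simp
  next
    case (step c x y)
    have x: "x \<in> int_span S" and y: "y \<in> int_span S" using step int_span_base unfolding int_span_def by auto
    have "chi ((\<lambda>u. of_int c * x u) + y) = of_int c * chi x + chi y"
      using character_add[OF chi int_span_scale[OF x] y] character_scale[OF chi x] by simp
    moreover have "\<psi> ((\<lambda>u. of_int c * x u) + y) = of_int c * \<psi> x + \<psi> y"
      using real_linear_int_scale[OF \<psi>] \<psi> unfolding real_linear_def by simp
    ultimately show ?case using int_span_add[OF int_span_scale[OF x] y, of c] eq[OF step(1)] step(2)
      unfolding int_span_def plus_fun_def by simp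
  qed
  then show ?thesis ..
qed

text \<open>The \<open>eps j\<close> need not lie in the root lattice, so \<open>d j\<close> is not
  simply a value of \<open>chi\<close>; it is the value at \<open>eps j\<close> of a real-linear
  functional that agrees with \<open>chi\<close> on the roots. In type A it is unique only up to a
  constant.\<close>

definition character_coordinates :: "(('g \<Rightarrow> complex) \<Rightarrow> real) \<Rightarrow> ('j \<Rightarrow> real) \<Rightarrow> bool" where
  "character_coordinates chi d \<longleftrightarrow> (\<forall>(j, k, t, p)\<in>root_indices T J.
     chi (root_form eps j k t p) = p * (d j - t * d k))"

lemma character_coordinatesD:
  "character_coordinates chi d \<Longrightarrow> (j, k, t, p) \<in> root_indices T J \<Longrightarrow>
    chi (root_form eps j k t p) = p * (d j - t * d k)"
  unfolding character_coordinates_def by blast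

lemma character_coordinates_eq:
  assumes \<psi>: "real_linear \<psi>" "\<And>j. j \<in> J \<Longrightarrow> \<psi> (eps j) = d j"
    and chi: "character_on roots chi" "character_coordinates chi d" and \<mu>: "\<mu> \<in> int_span roots"
  shows "chi \<mu> = \<psi> \<mu>"
proof (rule character_eq_real_linear[OF \<psi>(1) chi(1) _ \<mu>])
  fix \<alpha> assume "\<alpha> \<in> roots"
  then obtain j k t p where idx: "(j, k, t, p) \<in> root_indices T J" "\<alpha> = root_form eps j k t p"
    using roots_iff by auto
  then have "j \<in> J" "k \<in> J" by (auto simp: root_indices_def moves_def)
  then show "chi \<alpha> = \<psi> \<alpha>"
    using character_coordinatesD[OF chi(2) idx(1)] \<psi> by (simp add: idx(2) real_linear_root_form)
qed

lemma root_form_int_span: "(j, k, t, p) \<in> root_indices T J \<Longrightarrow> root_form eps j k t p \<in> int_span roots"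
  using roots_iff by (intro int_span_base) blast

text \<open>\<psi> witnesses the three conditions under the \<open>SOME\<close>, and these
  conditions determine the chosen function on the real span, by induction over the span.\<close>

lemma real_extension_eq:
  assumes \<psi>: "real_linear \<psi>" "\<And>\<mu>. \<mu> \<in> int_span roots \<Longrightarrow> chi \<mu> = \<psi> \<mu>"
    and \<mu>: "\<mu> \<in> real_span roots"
  shows "real_extension roots chi \<mu> = \<psi> \<mu>"
proof -
  let ?P = "\<lambda>\<psi>. (\<forall>\<mu>\<in>int_span roots. \<psi> \<mu> = chi \<mu>) \<and>
     (\<forall>\<mu>\<in>real_span roots. \<forall>\<nu>\<in>real_span roots. \<psi> (\<mu> + \<nu>) = \<psi> \<mu> + \<psi> \<nu>) \<and>
     (\<forall>r. \<forall>\<mu>\<in>real_span roots. \<psi> (\<lambda>x. of_real r * \<mu> x) = r * \<psi> \<mu>)"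
  have "?P \<psi>" using \<psi> unfolding real_linear_def by simp
  then have ext: "?P (real_extension roots chi)"
    unfolding real_extension_def by (rule someI[where P = ?P])
  let ?\<phi> = "real_extension roots chi"
  have "\<mu> \<in> real_span roots \<and> ?\<phi> \<mu> = \<psi> \<mu>"
    using \<mu> unfolding real_span_def
  proof (induction rule: real_fun.span_induct_alt)
    case base
    have "?\<phi> 0 = \<psi> 0" using bspec[OF conjunct1[OF ext] int_span_zero] \<psi>(2)[OF int_span_zero] by simp
    then show ?case using real_fun.span_zero[of roots] unfolding zero_fun_def by simp
  next
    case (step c x y)
    have x: "x \<in> real_span roots" "y \<in> real_span roots"
      using step unfolding real_span_def by (auto intro: real_fun.span_base)
    have cx: "(\<lambda>u. of_real c * x u) \<in> real_span roots"
      using x(1) unfolding real_span_def by (rule real_fun.span_scale)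
    have "?\<phi> x = \<psi> x" using ext \<psi>(2) int_span_base[OF step(1)] by simp
    then have "?\<phi> ((\<lambda>u. of_real c * x u) + y) = c * \<psi> x + \<psi> y"
      using ext x cx step(2) by simp
    moreover have "\<psi> ((\<lambda>u. of_real c * x u) + y) = c * \<psi> x + \<psi> y"
      using \<psi>(1) unfolding real_linear_def by simp
    ultimately show ?case using real_fun.span_add[of _ roots y] cx x \<open>?\<phi> x = \<psi> x\<close>
      unfolding real_span_def plus_fun_def by simp
  qed
  then show ?thesis ..
qed

lemma weight_change_real_span:
  assumes "\<nu> \<in> coordinate_orbit T J l"
  shows "weight_change l \<nu> \<in> real_span roots"
  using assms
proof induction
  case base then show ?case using real_fun.span_zero[of roots] by (simp add: real_span_def zero_fun_def)
next
  case (move \<nu> j k t)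
  obtain p where idx: "(j, k, t, p) \<in> root_indices T J" using root_form_index[OF move.hyps(2)] by blast
  then have p0: "p \<noteq> 0" and t: "t = 1 \<or> t = -1" "j = k \<Longrightarrow> t = -1"
    by (auto simp: root_indices_def moves_def split: if_splits)
  let ?c = "- ((if j = k then 1 / 2 else 1) * (\<nu> j - t * \<nu> k) / p)"
  have "weight_change l (swap_move j k t \<nu>) =
      weight_change l \<nu> + (\<lambda>x. of_real ?c * root_form eps j k t p x)"
  proof
    fix x
    show "weight_change l (swap_move j k t \<nu>) x =
        (weight_change l \<nu> + (\<lambda>x. of_real ?c * root_form eps j k t p x)) x"
      unfolding weight_change_def plus_fun_apply root_form_def
        total_change_move[OF coordinate_orbit_support(1)[OF move.hyps(1)]]
      using t p0 by (auto simp: field_simps)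
  qed
  moreover have "root_form eps j k t p \<in> real_span roots"
    unfolding real_span_def using idx roots_iff by (intro real_fun.span_base) blast
  then have "(\<lambda>x. of_real ?c * root_form eps j k t p x) \<in> real_span roots"
    unfolding real_span_def by (rule real_fun.span_scale)
  ultimately show ?case using move.IH unfolding real_span_def by (simp only: real_fun.span_add)
qed

lemma real_extension_weight_change:
  assumes "character_on roots chi" "character_coordinates chi d" "\<nu> \<in> coordinate_orbit T J l"
  shows "real_extension roots chi (weight_change l \<nu>) = linear_change d l \<nu>"
proof -
  obtain \<psi> where \<psi>: "real_linear \<psi>" "\<And>j. j \<in> J \<Longrightarrow> \<psi> (eps j) = d j" using real_linear_exists by blast
  show ?thesis
    using real_extension_eq[OF \<psi>(1) character_coordinates_eq[OF \<psi> assms(1,2)] weight_change_real_span[OF assms(3)]]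
      real_linear_weight_change[OF \<psi> assms(3)] by simp
qed

text \<open>In type A the coordinates are the values at \<epsilon>_j - \<epsilon>_i for a fixed base
  index \<open>i\<close>. In the other types 2 \<epsilon>_j = (\<epsilon>_j - \<epsilon>_k) +
  (\<epsilon>_j + \<epsilon>_k) lies in the root lattice, and half of the value there is
  taken.\<close>

lemma character_coordinates_exist:
  assumes chi: "character_on roots chi"
  shows "\<exists>d. character_coordinates chi d"
proof (cases "T = Type_A")
  case True
  obtain i where i: "i \<in> J" using infinite_J by fastforce
  define D where "D j = root_form eps j i 1 1" for j
  have D: "D j \<in> int_span roots" if "j \<in> J" for j
  proof (cases "j = i")
    case True
    then have "D j = 0" by (auto simp: D_def root_form_def)
    then show ?thesis by (simp add: int_span_zero)
  next
    case False
    then have "(j, i, 1, 1) \<in> root_indices T J" using i that by (auto simp: root_indices_def moves_def)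
    then show ?thesis unfolding D_def by (rule root_form_int_span)
  qed
  have "chi (root_form eps j k t p) = p * (chi (D j) - t * chi (D k))" if idx: "(j, k, t, p) \<in> root_indices T J" for j k t p
  proof -
    have jk: "j \<in> J" "k \<in> J" "t = 1" "p = 1 \<or> p = -1"
      using idx True by (auto simp: root_indices_def moves_def split: if_splits)
    then obtain n :: int where n: "p = of_int n" by (metis of_int_1 of_int_minus)
    have "root_form eps j k t p = (\<lambda>x. of_int n * D j x) + (\<lambda>x. of_int (- n) * D k x)"
      by (auto simp: root_form_def D_def n jk algebra_simps)
    then have "chi (root_form eps j k t p) = of_int n * chi (D j) + of_int (- n) * chi (D k)"
      using character_add[OF chi int_span_scale[OF D[OF jk(1)]] int_span_scale[OF D[OF jk(2)]]]
        character_scale[OF chi D[OF jk(1)]] character_scale[OF chi D[OF jk(2)]] by (simp only:)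
    then show ?thesis by (simp add: n jk algebra_simps)
  qed
  then show ?thesis unfolding character_coordinates_def by (intro exI[of _ "\<lambda>j. chi (D j)"]) auto
next
  case False
  define D where "D j = eps j + eps j" for j
  have D: "D j \<in> int_span roots" if j: "j \<in> J" for j
  proof -
    obtain k where k: "k \<in> J" "k \<noteq> j" using infinite_J
      by (metis finite.emptyI finite.insertI finite_subset insertI1 subsetI insert_iff)
    then have "(j, k, 1, 1) \<in> root_indices T J" "(j, k, -1, 1) \<in> root_indices T J"
      using j False by (auto simp: root_indices_def moves_def)
    then have "root_form eps j k 1 1 \<in> int_span roots" "root_form eps j k (-1) 1 \<in> int_span roots"
      by (auto intro!: root_form_int_span)
    moreover have "D j = root_form eps j k 1 1 + root_form eps j k (-1) 1"
      by (auto simp: D_def root_form_def)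
    ultimately show ?thesis by (simp add: int_span_add)
  qed
  have "chi (root_form eps j k t p) = p * (chi (D j) / 2 - t * (chi (D k) / 2))"
    if idx: "(j, k, t, p) \<in> root_indices T J" for j k t p
  proof -
    have jk: "j \<in> J" "k \<in> J" and t: "t = 1 \<or> t = -1" "j = k \<Longrightarrow> t = -1"
      and p: "\<bar>p\<bar> = (if j = k \<and> T = Type_B then 1 / 2 else 1)"
      using idx by (auto simp: root_indices_def moves_def split: if_splits)
    have R: "root_form eps j k t p \<in> int_span roots"
      using idx by (rule root_form_int_span)
    \<comment> \<open>Twice a root is an integer combination of the \<open>D j\<close>, while the
      root itself need not be one; the real values can be halved afterwards.\<close>
    have two: "chi (\<lambda>x. of_int 2 * root_form eps j k t p x) = 2 * chi (root_form eps j k t p)"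
      using character_scale[OF chi R, of 2] by simp
    show ?thesis
    proof (cases "j = k \<and> T = Type_B")
      case True
      then have "2 * p = 1 \<or> 2 * p = -1" using p by auto
      then obtain n :: int where n: "2 * p = of_int n" by (metis of_int_1 of_int_minus)
      have "of_real (2 * p) = (of_int n :: complex)" unfolding n by simp
      then have "of_real p = (of_int n / 2 :: complex)" by (simp add: field_simps)
      then have "(\<lambda>x. of_int 2 * root_form eps j k t p x) = (\<lambda>x. of_int n * D j x)"
        using True t by (auto simp: root_form_def D_def algebra_simps)
      then have "2 * chi (root_form eps j k t p) = of_int n * chi (D j)"
        using two character_scale[OF chi D[OF jk(1)]] by (simp only:)
      then have "2 * chi (root_form eps j k t p) = 2 * p * chi (D j)" using n by simp
      then show ?thesis using True t by simp
    next
      case False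
      then have "p = 1 \<or> p = -1" using p by auto
      then obtain n m :: int where n: "p = of_int n" "p * t = of_int m"
        using t(1) by (metis of_int_1 of_int_minus mult.right_neutral mult_minus1_right minus_minus)
      have pc: "of_real p = (of_int n :: complex)" "of_real p * of_real t = (of_int m :: complex)"
        using n by (metis of_real_of_int_eq) (metis n(2) of_real_mult of_real_of_int_eq)
      have "(\<lambda>x. of_int 2 * root_form eps j k t p x) = (\<lambda>x. of_int n * D j x) + (\<lambda>x. of_int (- m) * D k x)"
        unfolding pc[symmetric] of_int_minus by (auto simp: root_form_def D_def algebra_simps)
      then have "2 * chi (root_form eps j k t p) = of_int n * chi (D j) + of_int (- m) * chi (D k)"
        using two character_add[OF chi int_span_scale[OF D[OF jk(1)]] int_span_scale[OF D[OF jk(2)]]]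
          character_scale[OF chi D[OF jk(1)]] character_scale[OF chi D[OF jk(2)]] by (simp only:)
      also have "\<dots> = p * chi (D j) - p * t * chi (D k)" using n by simp
      finally show ?thesis by (simp add: algebra_simps)
    qed
  qed
  then show ?thesis unfolding character_coordinates_def by (intro exI[of _ "\<lambda>j. chi (D j) / 2"]) auto
qed

lemma character_coordinates_eps:
  assumes chi: "character_on (eps ` J) chi'" and eq: "\<And>\<mu>. \<mu> \<in> int_span roots \<Longrightarrow> chi \<mu> = chi' \<mu>"
  shows "character_coordinates chi (\<lambda>j. chi' (eps j))"
proof -
  obtain \<psi> where \<psi>: "real_linear \<psi>" "\<And>j. j \<in> J \<Longrightarrow> \<psi> (eps j) = chi' (eps j)"
    using real_linear_exists[of "\<lambda>j. chi' (eps j)"] by blast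
  have "chi (root_form eps j k t p) = p * (chi' (eps j) - t * chi' (eps k))"
    if idx: "(j, k, t, p) \<in> root_indices T J" for j k t p
  proof -
    have jk: "j \<in> J" "k \<in> J" and t: "t = 1 \<or> t = -1" "j = k \<Longrightarrow> t = -1"
      and p: "\<bar>p\<bar> = (if j = k \<and> T = Type_B then 1 / 2 else 1)"
      using idx by (auto simp: root_indices_def moves_def split: if_splits)
    have E: "eps j \<in> int_span (eps ` J)" "eps k \<in> int_span (eps ` J)" using jk by (auto intro: int_span_base)
    have "root_form eps j k t p \<in> int_span (eps ` J)"
    proof (cases "j = k \<and> T = Type_B")
      case True
      then have "2 * p = 1 \<or> 2 * p = -1" using p by auto
      then obtain n :: int where n: "2 * p = of_int n" by (metis of_int_1 of_int_minus)
      then have "of_int n = (2 * of_real p :: complex)" by (metis of_real_mult of_real_numeral of_real_of_int_eq)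
      then have "root_form eps j k t p = (\<lambda>x. of_int n * eps j x)"
        using True t by (auto simp: root_form_def algebra_simps)
      then show ?thesis using int_span_scale[OF E(1)] by (simp only:)
    next
      case False
      then have "p = 1 \<or> p = -1" using p by auto
      then obtain n m :: int where n: "p = of_int n" "p * t = of_int m"
        using t(1) by (metis of_int_1 of_int_minus mult.right_neutral mult_minus1_right minus_minus)
      have pc: "of_real p = (of_int n :: complex)" "of_real p * of_real t = (of_int m :: complex)"
        using n by (metis of_real_of_int_eq) (metis n(2) of_real_mult of_real_of_int_eq)
      have "root_form eps j k t p = (\<lambda>x. of_int n * eps j x) + (\<lambda>x. of_int (- m) * eps k x)"
        unfolding pc[symmetric] of_int_minus by (auto simp: root_form_def algebra_simps)
      then show ?thesis using int_span_add[OF int_span_scale[OF E(1)] int_span_scale[OF E(2)]] by (simp only:)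
    qed
    then have "chi' (root_form eps j k t p) = \<psi> (root_form eps j k t p)"
      by (rule character_eq_real_linear[OF \<psi>(1) chi, rotated]) (auto simp: \<psi>(2))
    moreover have "root_form eps j k t p \<in> int_span roots"
      using idx by (rule root_form_int_span)
    ultimately show ?thesis using eq \<psi> jk by (simp add: real_linear_root_form)
  qed
  then show ?thesis unfolding character_coordinates_def by auto
qed

text \<open>The two properties may be witnessed by different extensions. Both agree on e_j - e_i,
  which comes from \<open>H\<close>, so on the basis they differ by a constant. The discrete
  extension is therefore bounded as well, and a bounded set of reals without accumulation point is
  finite.\<close>

lemma discrete_bounded_coordinates:
  assumes "discrete_functional H scaleV \<iota> J e lam" "bounded_functional H scaleV \<iota> J e lam"
  shows "\<exists>l. has_coordinates lam l \<and> finite (l ` J)"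
proof -
  obtain \<mu> where \<mu>: "extends_functional H scaleV \<iota> lam \<mu>" "\<forall>j\<in>J. \<mu> (e j) \<in> \<real>"
    "\<not> (\<exists>a::real. a islimpt (\<lambda>j. Re (\<mu> (e j))) ` J)"
    using assms(1) unfolding discrete_functional_def by blast
  obtain \<mu>' where \<mu>': "extends_functional H scaleV \<iota> lam \<mu>'" "bounded ((\<lambda>j. \<mu>' (e j)) ` J)"
    using assms(2) unfolding bounded_functional_def by blast
  have lin: "Vector_Spaces.linear scaleV (*) \<mu>" "Vector_Spaces.linear scaleV (*) \<mu>'"
    using \<mu>(1) \<mu>'(1) unfolding extends_functional_def by auto
  interpret \<mu>: Vector_Spaces.linear scaleV "(*)" \<mu> by (rule lin)
  interpret \<mu>': Vector_Spaces.linear scaleV "(*)" \<mu>' by (rule lin)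
  obtain i where i: "i \<in> J" using infinite_J by fastforce
  define l where "l j = Re (\<mu> (e j))" for j
  have l: "of_real (l j) = \<mu> (e j)" if "j \<in> J" for j using \<mu>(2) that by (simp add: l_def)
  have diff: "\<mu> (e j) = \<mu>' (e j) + (\<mu> (e i) - \<mu>' (e i))" if j: "j \<in> J" for j
  proof (cases "j = i")
    case False
    let ?x = "\<lambda>k. if k = j then 1 else if k = i then -1 else (0::complex)"
    have "e j - e i = (\<Sum>k\<in>{j, i}. scaleV (?x k) (e k))" using False by simp
    then have "e j - e i \<in> \<iota> ` H" unfolding range_incl using i j False
      by (auto intro!: exI[of _ "{j, i}"] exI[of _ ?x])
    then obtain h where "h \<in> H" "e j - e i = \<iota> h" by auto
    then have "\<mu> (e j - e i) = \<mu>' (e j - e i)"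
      using \<mu>(1) \<mu>'(1) unfolding extends_functional_def by simp
    then show ?thesis by (simp add: \<mu>.diff \<mu>'.diff algebra_simps)
  qed simp
  have "bounded (l ` J)"
  proof -
    obtain B where B: "\<And>j. j \<in> J \<Longrightarrow> cmod (\<mu>' (e j)) \<le> B" using \<mu>'(2) unfolding bounded_iff by auto
    have "\<bar>l j\<bar> \<le> B + cmod (\<mu> (e i) - \<mu>' (e i))" if j: "j \<in> J" for j
    proof -
      have "\<bar>l j\<bar> \<le> cmod (\<mu> (e j))" unfolding l_def by (rule abs_Re_le_cmod)
      also have "\<dots> \<le> cmod (\<mu>' (e j)) + cmod (\<mu> (e i) - \<mu>' (e i))"
        by (subst diff[OF j]) (rule norm_triangle_ineq)
      finally show ?thesis using B[OF j] by simp
    qed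
    then show ?thesis unfolding bounded_iff by auto
  qed
  then have "finite (l ` J)"
    using \<mu>(3) bounded_infinite_imp_islimpt[of "l ` J" "l ` J"] unfolding l_def by blast
  moreover have "has_coordinates lam l"
    unfolding has_coordinates_def
  proof
    fix h assume h: "h \<in> H"
    have "lam h = \<mu> (\<iota> h)" using \<mu>(1) h unfolding extends_functional_def by simp
    also have "\<dots> = \<mu> (\<Sum>j | j \<in> J \<and> eps j h \<noteq> 0. scaleV (eps j h) (e j))" using eps_expansion[OF h] by simp
    also have "\<dots> = (\<Sum>j | j \<in> J \<and> eps j h \<noteq> 0. of_real (l j) * eps j h)"
      unfolding \<mu>.sum using l by (intro sum.cong) (auto simp: \<mu>.scale)
    finally show "lam h = (\<Sum>j | j \<in> J \<and> eps j h \<noteq> 0. of_real (l j) * eps j h)" .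
  qed
  ultimately show ?thesis by blast
qed

lemma main_equivalence:
  assumes lam: "discrete_functional H scaleV \<iota> J e lam" "bounded_functional H scaleV \<iota> J e lam"
    and chi: "character_on roots chi"
  shows "(INF \<mu>\<in>orbit_differences lam. ereal (real_extension roots chi \<mu>)) > - \<infinity> \<longleftrightarrow>
    (\<exists>chi_min chi_sum. character_on roots chi_min \<and> character_on roots chi_sum \<and>
       (\<forall>\<mu>\<in>int_span roots. chi \<mu> = chi_min \<mu> + chi_sum \<mu>) \<and>
       (INF \<mu>\<in>orbit_differences lam. ereal (real_extension roots chi_min \<mu>)) = 0 \<and>
       summable_character roots J eps chi_sum)" (is "?bdd \<longleftrightarrow> ?dec")
proof -
  obtain l where l: "has_coordinates lam l" and fin: "finite (l ` J)"
    using discrete_bounded_coordinates[OF lam] by blast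
  let ?O = "coordinate_orbit T J l"
  have INF: "(INF \<mu>\<in>orbit_differences lam. ereal (real_extension roots \<xi> \<mu>)) =
      (INF \<nu>\<in>?O. ereal (linear_change d l \<nu>))"
    if "character_on roots \<xi>" "character_coordinates \<xi> d" for \<xi> d
    unfolding orbit_differences_eq[OF l] image_image
    using real_extension_weight_change[OF that] by simp
  have base: "l \<in> ?O" by (rule coordinate_orbit.base)
  show ?thesis
  proof
    assume ?bdd
    obtain d where d: "character_coordinates chi d" using character_coordinates_exist[OF chi] by blast
    have "\<exists>C. \<forall>\<nu>\<in>?O. - C \<le> linear_change d l \<nu>"
      using \<open>?bdd\<close> base unfolding INF[OF chi d] by (subst (asm) INF_bounded_iff) auto
    then obtain d' where d': "(\<lambda>j. \<bar>d j - d' j\<bar>) summable_on J" "\<And>\<nu>. \<nu> \<in> ?O \<Longrightarrow> 0 \<le> linear_change d' l \<nu>"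
      using bounded_below_iff_decomposition[OF fin] by blast
    obtain \<psi> where \<psi>: "real_linear \<psi>" "\<And>j. j \<in> J \<Longrightarrow> \<psi> (eps j) = d j" using real_linear_exists by blast
    obtain \<psi>' where \<psi>': "real_linear \<psi>'" "\<And>j. j \<in> J \<Longrightarrow> \<psi>' (eps j) = d' j" using real_linear_exists by blast
    define \<xi> where "\<xi> \<mu> = \<psi> \<mu> - \<psi>' \<mu>" for \<mu>
    have \<xi>: "real_linear \<xi>" using \<psi>(1) \<psi>'(1) unfolding real_linear_def \<xi>_def by (simp add: algebra_simps)
    have co': "character_coordinates \<psi>' d'"
      unfolding character_coordinates_def
      using \<psi>' by (auto simp: real_linear_root_form root_indices_def moves_def)
    \<comment> \<open>The identity of the Weyl group contributes the value 0, so nonnegativity on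
      the orbit already makes the infimum 0.\<close>
    have "(INF \<mu>\<in>orbit_differences lam. ereal (real_extension roots \<psi>' \<mu>)) = 0"
      unfolding INF[OF real_linear_character[OF \<psi>'(1)] co']
    proof (rule antisym)
      show "(INF \<nu>\<in>?O. ereal (linear_change d' l \<nu>)) \<le> 0"
        using INF_lower[OF base, of "\<lambda>\<nu>. ereal (linear_change d' l \<nu>)"] by (simp add: zero_ereal_def)
      show "0 \<le> (INF \<nu>\<in>?O. ereal (linear_change d' l \<nu>))"
        using d'(2) by (intro INF_greatest) simp
    qed
    moreover have "summable_character roots J eps \<xi>"
      unfolding summable_character_def
    proof (intro exI[of _ \<xi>] conjI real_linear_character[OF \<xi>] ballI refl)
      show "(\<lambda>j. \<bar>\<xi> (eps j)\<bar>) summable_on J"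
        using d'(1) by (rule summable_on_cong[THEN iffD1, rotated]) (simp add: \<xi>_def \<psi> \<psi>')
    qed
    moreover have "\<forall>\<mu>\<in>int_span roots. chi \<mu> = \<psi>' \<mu> + \<xi> \<mu>"
      using character_coordinates_eq[OF \<psi> chi d] by (simp add: \<xi>_def)
    ultimately show ?dec using real_linear_character[OF \<psi>'(1)] real_linear_character[OF \<xi>] by blast
  next
    assume ?dec
    then obtain chi_min chi_sum where dec: "character_on roots chi_min" "character_on roots chi_sum"
      "\<forall>\<mu>\<in>int_span roots. chi \<mu> = chi_min \<mu> + chi_sum \<mu>"
      "(INF \<mu>\<in>orbit_differences lam. ereal (real_extension roots chi_min \<mu>)) = 0"
      "summable_character roots J eps chi_sum" by blast
    obtain d' where d': "character_coordinates chi_min d'" using character_coordinates_exist[OF dec(1)] by blast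
    obtain chi' where chi': "character_on (eps ` J) chi'" "\<forall>\<mu>\<in>int_span roots. chi_sum \<mu> = chi' \<mu>"
      "(\<lambda>j. \<bar>chi' (eps j)\<bar>) summable_on J"
      using dec(5) unfolding summable_character_def by blast
    have ds: "character_coordinates chi_sum (\<lambda>j. chi' (eps j))"
      using character_coordinates_eps[OF chi'(1)] chi'(2) by blast
    \<comment> \<open>Not an arbitrary family of coordinates of \<open>chi\<close>: in type A that
      could differ from this one by a nonzero constant, and its difference from \<open>d'\<close>
      would not be summable over the infinite \<open>J\<close>.\<close>
    define d where "d j = d' j + chi' (eps j)" for j
    have d: "character_coordinates chi d"
      unfolding character_coordinates_def
    proof clarify
      fix j k t p assume idx: "(j, k, t, p) \<in> root_indices T J"
      then have "root_form eps j k t p \<in> int_span roots" by (rule root_form_int_span)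
      then show "chi (root_form eps j k t p) = p * (d j - t * d k)"
        using dec(3) character_coordinatesD[OF d' idx] character_coordinatesD[OF ds idx]
        by (simp add: d_def algebra_simps)
    qed
    have "0 \<le> linear_change d' l \<nu>" if "\<nu> \<in> ?O" for \<nu>
      using INF_lower[OF that, of "\<lambda>\<nu>. ereal (linear_change d' l \<nu>)"] dec(4)
      unfolding INF[OF dec(1) d'] by simp
    moreover have "(\<lambda>j. \<bar>d j - d' j\<bar>) summable_on J" using chi'(3) by (simp add: d_def)
    ultimately have "\<exists>C. \<forall>\<nu>\<in>?O. - C \<le> linear_change d l \<nu>"
      using bounded_below_iff_decomposition[OF fin] by blast
    then show ?bdd unfolding INF[OF chi d] using base by (subst INF_bounded_iff) auto
  qed
qed

end

theorem theorem1:
  fixes scale :: "complex \<Rightarrow> 'g::ab_group_add \<Rightarrow> 'g"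
    and bracket :: "'g \<Rightarrow> 'g \<Rightarrow> 'g"
    and H :: "'g set"
    and scaleV :: "complex \<Rightarrow> 'v::ab_group_add \<Rightarrow> 'v"
    and \<iota> :: "'g \<Rightarrow> 'v" and T :: root_type and J :: "'j set" and e :: "'j \<Rightarrow> 'v"
    and \<Delta> :: "('g \<Rightarrow> complex) set" and \<epsilon> :: "'j \<Rightarrow> 'g \<Rightarrow> complex"
    and lam :: "'g \<Rightarrow> complex" and D :: "('g \<Rightarrow> complex) set"
    and chi :: "('g \<Rightarrow> complex) \<Rightarrow> real"
  assumes "classical_coordinates scale bracket H scaleV \<iota> T J e"
    and "\<Delta> = lie_pair.roots scale bracket H"
    and "\<epsilon> = coordinate_functional H scaleV \<iota> J e"
    and "lam \<in> lie_pair.dual scale H"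
    and "discrete_functional H scaleV \<iota> J e lam"
    and "bounded_functional H scaleV \<iota> J e lam"
    and "D = lie_pair.orbit_differences scale bracket H lam"
    and "character_on \<Delta> chi"
  shows "(INF \<mu>\<in>D. ereal (real_extension \<Delta> chi \<mu>)) > - \<infinity> \<longleftrightarrow>
    (\<exists>chi_min chi_sum. character_on \<Delta> chi_min \<and> character_on \<Delta> chi_sum \<and>
       (\<forall>\<mu>\<in>int_span \<Delta>. chi \<mu> = chi_min \<mu> + chi_sum \<mu>) \<and>
       (INF \<mu>\<in>D. ereal (real_extension \<Delta> chi_min \<mu>)) = 0 \<and>
       summable_character \<Delta> J \<epsilon> chi_sum)"
  using classical_coordinates.main_equivalence[OF assms(1,5,6)] assms(2,3,7,8) by simp

end
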